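(* Let $L>0$, $\nu>0$, $\alpha\in\mathbb R$, $\gamma\ge0$, $u_0\in H^1(0,L)$ with $u_0(0)=0$, and, for given $\mu>0$, let $k$ be a solution of the kernel boundary value problem $$(\nu+i\alpha)(k_{xx}-k_{yy})+\mu k=0,\quad k(x,0)=0,\quad k(x,x)=-\frac{\mu x}{2(\nu+i\alpha)},\qquad 0\le y\le x\le L.$$ Consider the closed-loop problem $$u_t-(\nu+i\alpha)u_{xx}-\gamma u=0\ \text{ in }(0,L)\times(0,\infty),\qquad u(0,t)=0,\quad u_x(L,t)=b(P_Nu)(t),\qquad u(x,0)=u_0(x),$$ with the feedback law $$b(P_Nu)(t)=\int_0^Lk_x(L,y)\,\Gamma_N[P_Nu](y,t)\,dy-\frac{\mu L}{2(\nu+i\alpha)}\,\Gamma_N[P_Nu](x,t)\Big|_{x=L}.$$ \begin{enumerate} \item[(i)] (Rapid stabilization) Suppose $\mu>\gamma-\nu\lambda_1$. If $N$ satisfies $$N>\max\Big\{\frac{\mu}{4\nu\lambda_1}-\frac12,\ \frac{\mu}{2(\mu+\nu\lambda_1-\gamma)}-\frac12\Big\}$$ and $(\mu,N)$ is an admissible decay rate-mode pair, then the zero equilibrium of the closed-loop problem with $u_x(L,t)=b(P_Nu)$ is globally exponentially stable in $H^1(0,L)$. Moreover, the weak solution satisfies $$\|u(t)\|_{H^1_x(0,L)}\le c_ke^{-\eta_1t}\|u_0\|_{H^1(0,L)},\quad \eta_1=\nu\lambda_1-\gamma+\mu\Big(1-\frac1{2N+1}\Big),\quad\text{a.e. }t>0,$$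 where the constant $c_k>0$ depends on $k$ but is independent of the initial datum. \item[(ii)] (Minimal Fourier mode count) Let $\gamma,\nu,L$ be such that $\lambda_M\le\frac{\gamma}{\nu}<\lambda_{M+1}$. If $\mu$ satisfies $$2(\gamma-\nu\lambda_1)\Big(1-\frac1{2M+1}\Big)^{-1}<\mu<2\nu\lambda_{M+1}$$ and $(\mu,M)$ is an admissible decay rate-mode pair, then the zero equilibrium of the closed-loop problem with $u_x(L,t)=b(P_Mu)$ (the same law with $N=M$) is globally exponentially stable in $H^1(0,L)$. Moreover, the weak solution satisfies $$\|u(t)\|_{H^1_x(0,L)}\le c_ke^{-\eta_2t}\|u_0\|_{H^1(0,L)},\quad \eta_2=\nu\lambda_1-\gamma+\frac\mu2\Big(1-\frac1{(2M+1)^2}\Big),\quad\text{a.e. }t>0,$$ where the constant $c_k>0$ depends on $k$ but is independent of the initial datum. \end{enumerate}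
   Context: $e_j(x)=\sqrt{\frac2L}\sin\big(\frac{(2j-1)\pi x}{2L}\big)$ and $\lambda_j=\big(\frac{2j-1}{2}\big)^2\frac{\pi^2}{L^2}$, $j\ge1$, are the eigenfunctions and eigenvalues of $-\varphi''=\lambda\varphi$ on $(0,L)$, $\varphi(0)=\varphi'(L)=0$. $(f,g)_2=\int_0^Lf\bar g\,dx$. For $N\in\mathbb Z_+$, $P_N\varphi=\sum_{j=1}^N(\varphi,e_j)_2e_j$ is the projection. $N,M$ are positive integers. $T_N$ is the transformation $(T_N\varphi)(x)=\varphi(x)+\int_0^xk(x,y)(P_N\varphi)(y)\,dy$, acting on $H^\ell(0,L)$, $\ell=0,1,2$. The pair $(\mu,N)$, $\mu>0$, $N\in\mathbb Z_+$, is an admissible decay rate-mode pair if $T_N$ is invertible with a bounded inverse. In that case $\Upsilon_N:=I-T_N^{-1}$ and $\Gamma_N:=I-P_N\Upsilon_N$ (so that $P_NT_N^{-1}u=\Gamma_N[P_Nu]$). The kernel $k$ is the smooth solution given by $k(x,y)=-\frac{\mu y}{2(\nu+i\alpha)}\sum_{m\ge0}\big(-\frac{\mu}{4(\nu+i\alpha)}\big)^m\frac{(x^2-y^2)^m}{m!(m+1)!}$. *)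

theory Defs
  imports "HOL-Analysis.Analysis"
begin

subsection \<open>Lebesgue and Sobolev spaces on the interval\<close>

text \<open>
  Elements of the function spaces are represented by functions \<open>real \<Rightarrow> complex\<close>, of which only the
  Lebesgue equivalence class on the interval matters; equality of elements is equality almost
  everywhere.
\<close>

abbreviation leb :: "real \<Rightarrow> real measure" where
  "leb L \<equiv> lebesgue_on {0..L}"

definition L2 :: "real \<Rightarrow> (real \<Rightarrow> complex) set" where
  "L2 L = {f \<in> borel_measurable (leb L). integrable (leb L) (\<lambda>x. (norm (f x))\<^sup>2)}"

definition inner2 :: "real \<Rightarrow> (real \<Rightarrow> complex) \<Rightarrow> (real \<Rightarrow> complex) \<Rightarrow> complex" where
  "inner2 L f g = (\<integral>x. f x * cnj (g x) \<partial>leb L)"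

definition norm2 :: "real \<Rightarrow> (real \<Rightarrow> complex) \<Rightarrow> real" where
  "norm2 L f = sqrt (\<integral>x. (norm (f x))\<^sup>2 \<partial>leb L)"

definition eq_ae :: "real \<Rightarrow> (real \<Rightarrow> complex) \<Rightarrow> (real \<Rightarrow> complex) \<Rightarrow> bool" where
  "eq_ae L f g \<longleftrightarrow> (AE x in leb L. f x = g x)"

text \<open>\<open>C1c S \<phi> \<phi>'\<close>: \<open>\<phi>\<close> is continuously differentiable with compact support in \<open>S\<close> and has derivative \<open>\<phi>'\<close>.\<close>

definition C1c :: "real set \<Rightarrow> (real \<Rightarrow> real) \<Rightarrow> (real \<Rightarrow> real) \<Rightarrow> bool" where
  "C1c S \<phi> \<phi>' \<longleftrightarrow>
     (\<forall>x. (\<phi> has_real_derivative \<phi>' x) (at x)) \<and> continuous_on UNIV \<phi>' \<and>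
     (\<exists>K. compact K \<and> K \<subseteq> S \<and> (\<forall>x. x \<notin> K \<longrightarrow> \<phi> x = 0))"

definition weak_deriv :: "real \<Rightarrow> (real \<Rightarrow> complex) \<Rightarrow> (real \<Rightarrow> complex) \<Rightarrow> bool" where
  "weak_deriv L f g \<longleftrightarrow>
     (\<forall>\<phi> \<phi>'. C1c {0<..<L} \<phi> \<phi>' \<longrightarrow>
        (\<integral>x. f x * of_real (\<phi>' x) \<partial>leb L) = - (\<integral>x. g x * of_real (\<phi> x) \<partial>leb L))"

text \<open>A representative of the weak derivative, which is unique almost everywhere.\<close>

definition wderiv :: "real \<Rightarrow> (real \<Rightarrow> complex) \<Rightarrow> real \<Rightarrow> complex" where
  "wderiv L f = (SOME g. g \<in> L2 L \<and> weak_deriv L f g)"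

primrec sobolev :: "real \<Rightarrow> nat \<Rightarrow> (real \<Rightarrow> complex) set" where
  "sobolev L 0 = L2 L"
| "sobolev L (Suc l) = {f \<in> L2 L. \<exists>g \<in> sobolev L l. weak_deriv L f g}"

primrec sobolev_norm :: "real \<Rightarrow> nat \<Rightarrow> (real \<Rightarrow> complex) \<Rightarrow> real" where
  "sobolev_norm L 0 f = norm2 L f"
| "sobolev_norm L (Suc l) f = sqrt ((norm2 L f)\<^sup>2 + (sobolev_norm L l (wderiv L f))\<^sup>2)"

text \<open>
  Point values of a function in \<open>H\<^sup>1(0,L)\<close> are those of its continuous representative.
\<close>

definition trace_at :: "real \<Rightarrow> (real \<Rightarrow> complex) \<Rightarrow> real \<Rightarrow> complex" where
  "trace_at L f p = (THE c. \<exists>g. continuous_on {0..L} g \<and> eq_ae L f g \<and> g p = c)"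

definition H1_left :: "real \<Rightarrow> (real \<Rightarrow> complex) set" where
  "H1_left L = {f \<in> sobolev L 1. trace_at L f 0 = 0}"


subsection \<open>Eigenfunctions and the spectral projection\<close>

definition eigenval :: "real \<Rightarrow> nat \<Rightarrow> real" where
  "eigenval L j = ((2 * real j - 1) / 2)\<^sup>2 * (pi\<^sup>2 / L\<^sup>2)"

definition eigenfun :: "real \<Rightarrow> nat \<Rightarrow> real \<Rightarrow> complex" where
  "eigenfun L j x = of_real (sqrt (2 / L) * sin ((2 * real j - 1) * pi * x / (2 * L)))"

definition proj :: "real \<Rightarrow> nat \<Rightarrow> (real \<Rightarrow> complex) \<Rightarrow> real \<Rightarrow> complex" where
  "proj L N f x = (\<Sum>j=1..N. inner2 L f (eigenfun L j) * eigenfun L j x)"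


subsection \<open>The kernel\<close>

definition triangle :: "real \<Rightarrow> (real \<times> real) set" where
  "triangle L = {(x, y). 0 \<le> y \<and> y \<le> x \<and> x \<le> L}"

text \<open>
  Derivatives on the closed triangle are taken relative to the triangle, hence are one-sided on its
  boundary.  As the triangle is convex with nonempty interior, they are uniquely determined.
\<close>

definition has_partials ::
    "real \<Rightarrow> (real \<Rightarrow> real \<Rightarrow> complex) \<Rightarrow> (real \<Rightarrow> real \<Rightarrow> complex) \<Rightarrow> (real \<Rightarrow> real \<Rightarrow> complex) \<Rightarrow> bool" where
  "has_partials L f fx fy \<longleftrightarrow>
     (\<forall>x y. (x, y) \<in> triangle L \<longrightarrow>
        ((\<lambda>p. f (fst p) (snd p)) has_derivative (\<lambda>h. fst h *\<^sub>R fx x y + snd h *\<^sub>R fy x y))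
          (at (x, y) within triangle L))"

definition cont_triangle :: "real \<Rightarrow> (real \<Rightarrow> real \<Rightarrow> complex) \<Rightarrow> bool" where
  "cont_triangle L f \<longleftrightarrow> continuous_on (triangle L) (\<lambda>p. f (fst p) (snd p))"

text \<open>
  \<open>k\<close> is a classical solution, twice continuously differentiable up to the boundary, of the
  kernel boundary value problem.  Its values outside the triangle are irrelevant.
\<close>

definition kernel_solution ::
    "real \<Rightarrow> real \<Rightarrow> real \<Rightarrow> real \<Rightarrow> (real \<Rightarrow> real \<Rightarrow> complex) \<Rightarrow> bool" where
  "kernel_solution L \<nu> \<alpha> \<mu> k \<longleftrightarrow>
     (\<exists>kx ky kxx kxy kyx kyy.
        has_partials L k kx ky \<and> has_partials L kx kxx kxy \<and> has_partials L ky kyx kyy \<and>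
        cont_triangle L kxx \<and> cont_triangle L kxy \<and> cont_triangle L kyx \<and> cont_triangle L kyy \<and>
        (\<forall>x y. (x, y) \<in> triangle L \<longrightarrow>
           Complex \<nu> \<alpha> * (kxx x y - kyy x y) + of_real \<mu> * k x y = 0)) \<and>
     (\<forall>x\<in>{0..L}. k x 0 = 0) \<and>
     (\<forall>x\<in>{0..L}. k x x = - (of_real (\<mu> * x) / (2 * Complex \<nu> \<alpha>)))"


subsection \<open>The transformation and the feedback law\<close>

definition trafo ::
    "real \<Rightarrow> (real \<Rightarrow> real \<Rightarrow> complex) \<Rightarrow> nat \<Rightarrow> (real \<Rightarrow> complex) \<Rightarrow> real \<Rightarrow> complex" where
  "trafo L k N \<phi> x = \<phi> x + (\<integral>y. k x y * proj L N \<phi> y \<partial>lebesgue_on {0..x})"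

definition boundedly_invertible ::
    "real \<Rightarrow> nat \<Rightarrow> ((real \<Rightarrow> complex) \<Rightarrow> real \<Rightarrow> complex) \<Rightarrow> bool" where
  "boundedly_invertible L l T \<longleftrightarrow>
     (\<forall>\<phi>\<in>sobolev L l. T \<phi> \<in> sobolev L l) \<and>
     (\<forall>\<phi>\<in>sobolev L l. \<forall>\<psi>\<in>sobolev L l. eq_ae L (T \<phi>) (T \<psi>) \<longrightarrow> eq_ae L \<phi> \<psi>) \<and>
     (\<forall>\<psi>\<in>sobolev L l. \<exists>\<phi>\<in>sobolev L l. eq_ae L (T \<phi>) \<psi>) \<and>
     (\<exists>C. \<forall>\<phi>\<in>sobolev L l. sobolev_norm L l \<phi> \<le> C * sobolev_norm L l (T \<phi>))"

text \<open>
  \<open>k\<close> is meant to be the kernel belonging to \<open>\<mu>\<close>; this is how \<open>\<mu>\<close> enters.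
\<close>

definition admissible :: "real \<Rightarrow> (real \<Rightarrow> real \<Rightarrow> complex) \<Rightarrow> real \<Rightarrow> nat \<Rightarrow> bool" where
  "admissible L k \<mu> N \<longleftrightarrow>
     0 < \<mu> \<and> 0 < N \<and> (\<forall>l\<in>{0, 1, 2}. boundedly_invertible L l (trafo L k N))"

text \<open>
  The inverse is determined up to equality almost everywhere, which is all that the projection in
  \<open>Gam\<close> sees.
\<close>

definition trafo_inv ::
    "real \<Rightarrow> (real \<Rightarrow> real \<Rightarrow> complex) \<Rightarrow> nat \<Rightarrow> (real \<Rightarrow> complex) \<Rightarrow> real \<Rightarrow> complex" where
  "trafo_inv L k N \<psi> = (SOME \<phi>. \<phi> \<in> L2 L \<and> eq_ae L (trafo L k N \<phi>) \<psi>)"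

definition Ups ::
    "real \<Rightarrow> (real \<Rightarrow> real \<Rightarrow> complex) \<Rightarrow> nat \<Rightarrow> (real \<Rightarrow> complex) \<Rightarrow> real \<Rightarrow> complex" where
  "Ups L k N \<phi> x = \<phi> x - trafo_inv L k N \<phi> x"

definition Gam ::
    "real \<Rightarrow> (real \<Rightarrow> real \<Rightarrow> complex) \<Rightarrow> nat \<Rightarrow> (real \<Rightarrow> complex) \<Rightarrow> real \<Rightarrow> complex" where
  "Gam L k N \<phi> x = \<phi> x - proj L N (Ups L k N \<phi>) x"

text \<open>
  The feedback as a functional of the projected state \<open>p\<close>.  The derivative of \<open>k(\<cdot>,y)\<close> at \<open>L\<close> is
  one-sided, within the domain of \<open>k\<close>; the degenerate case \<open>y = L\<close> is a null set for the integral.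
\<close>

definition feedback ::
    "real \<Rightarrow> real \<Rightarrow> real \<Rightarrow> real \<Rightarrow> (real \<Rightarrow> real \<Rightarrow> complex) \<Rightarrow> nat \<Rightarrow> (real \<Rightarrow> complex) \<Rightarrow> complex" where
  "feedback L \<nu> \<alpha> \<mu> k N p =
     (\<integral>y. vector_derivative (\<lambda>x. k x y) (at L within {y..L}) * Gam L k N p y \<partial>leb L)
     - of_real (\<mu> * L) / (2 * Complex \<nu> \<alpha>) * Gam L k N p L"


subsection \<open>Weak solutions of the closed-loop problem and stability\<close>

text \<open>
  Weak solutions in the usual sense for parabolic problems: \<open>u\<close> lies in
  \<open>C([0,\<infinity>); L\<^sup>2) \<inter> L\<^sup>2\<^sub>l\<^sub>o\<^sub>c([0,\<infinity>); V)\<close> with \<open>V = {v \<in> H\<^sup>1(0,L). v(0) = 0}\<close>, \<open>u(0) = u\<^sub>0\<close>, and for all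
  \<open>v \<in> V\<close>
  \[ \frac{d}{dt} (u,v)_2 + (\nu + i\alpha) \big((u_x,v_x)_2 - b(P_N u)\,\overline{v(L)}\big)
       - \gamma (u,v)_2 = 0 \]
  in the sense of distributions on \<open>(0,\<infinity>)\<close>.  The Neumann condition enters through the boundary term
  of the integration by parts.
\<close>

definition weak_solution ::
    "real \<Rightarrow> real \<Rightarrow> real \<Rightarrow> real \<Rightarrow> real \<Rightarrow> (real \<Rightarrow> real \<Rightarrow> complex) \<Rightarrow> nat \<Rightarrow>
     (real \<Rightarrow> complex) \<Rightarrow> (real \<Rightarrow> real \<Rightarrow> complex) \<Rightarrow> bool" where
  "weak_solution L \<nu> \<alpha> \<gamma> \<mu> k N u0 u \<longleftrightarrow>
     (\<forall>t\<ge>0. u t \<in> L2 L) \<and>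
     (\<forall>t\<ge>0. ((\<lambda>s. norm2 L (\<lambda>x. u s x - u t x)) \<longlongrightarrow> 0) (at t within {0..})) \<and>
     eq_ae L (u 0) u0 \<and>
     (AE t in lebesgue_on {0..}. u t \<in> H1_left L) \<and>
     (\<forall>T>0. integrable (lebesgue_on {0..T}) (\<lambda>t. (sobolev_norm L 1 (u t))\<^sup>2)) \<and>
     (\<forall>v\<in>H1_left L. \<forall>\<phi> \<phi>'. C1c {0<..} \<phi> \<phi>' \<longrightarrow>
        - (\<integral>t. inner2 L (u t) v * of_real (\<phi>' t) \<partial>lebesgue_on {0..})
        + (\<integral>t. (Complex \<nu> \<alpha> *
                  (inner2 L (wderiv L (u t)) (wderiv L v)
                   - feedback L \<nu> \<alpha> \<mu> k N (proj L N (u t)) * cnj (trace_at L v L))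
                 - of_real \<gamma> * inner2 L (u t) v) * of_real (\<phi> t) \<partial>lebesgue_on {0..}) = 0)"

text \<open>
  \<open>sol u0 u\<close> expresses that \<open>u\<close> is a solution with initial datum \<open>u0\<close>.
\<close>

definition H1_decay ::
    "real \<Rightarrow> ((real \<Rightarrow> complex) \<Rightarrow> (real \<Rightarrow> real \<Rightarrow> complex) \<Rightarrow> bool) \<Rightarrow> real \<Rightarrow> real \<Rightarrow> bool" where
  "H1_decay L sol c \<eta> \<longleftrightarrow>
     (\<forall>u0\<in>H1_left L. \<forall>u. sol u0 u \<longrightarrow>
        (AE t in lebesgue_on {0<..}.
           sobolev_norm L 1 (u t) \<le> c * exp (- \<eta> * t) * sobolev_norm L 1 u0))"

text \<open>
  Stability includes global existence of solutions.  For a linear problem, uniqueness (almost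
  everywhere in time and space) follows from the decay estimate for all solutions.
\<close>

definition globally_exp_stable_H1 ::
    "real \<Rightarrow> ((real \<Rightarrow> complex) \<Rightarrow> (real \<Rightarrow> real \<Rightarrow> complex) \<Rightarrow> bool) \<Rightarrow> bool" where
  "globally_exp_stable_H1 L sol \<longleftrightarrow>
     (\<forall>u0\<in>H1_left L. \<exists>u. sol u0 u) \<and> (\<exists>c>0. \<exists>\<eta>>0. H1_decay L sol c \<eta>)"

end

theory Submission
  imports Defs "HOL-Real_Asymp.Real_Asymp"
begin

text \<open>
  The map \<open>u = w + \<integral>\<^sub>0\<^sup>x k(x,y) (P\<^sub>N w)(y) dy\<close> carries the closed loop to the target system
  \<open>w\<^sub>t = (\<nu> + i\<alpha>) w\<^sub>x\<^sub>x + \<gamma> w - \<mu> P\<^sub>N w\<close>, which is diagonal in the eigenfunctions.  Only the images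
  \<open>D m\<close> of finitely many eigenfunctions under the kernel operator enter.  By the kernel equation they
  satisfy \<open>\<kappa> D'' = - \<mu> e m - (\<mu> + \<kappa> \<lambda>\<^sub>m) D m\<close> with \<open>\<kappa> = \<nu> + i\<alpha>\<close>, and Green's formula against \<open>e j\<close>
  is exactly the identity that decouples the modes.  Hence the \<open>j\<close>th mode of the target state decays like
  \<open>exp (- \<sigma> j t)\<close> with \<open>Re (\<sigma> j) = \<nu> \<lambda>\<^sub>j - \<gamma>\<close>, increased by \<open>\<mu>\<close> if \<open>j \<le> N\<close>; the conditions on \<open>\<mu>\<close> and
  \<open>N\<close> bound all these rates from below.  Bessel's inequality for the derivative transfers the decay to
  the \<open>H\<^sup>1\<close> norm, with no loss in the rate, and summing the modes gives a solution.
\<close>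

subsection \<open>The Hilbert space structure\<close>

text \<open>The decay is claimed for every weak solution, of which little is known: it is continuous
  in time with values in \<open>L2\<close>, and the equation holds only in the sense of
  distributions. No energy estimate is made. The feedback sees \<open>u\<close> through its first
  \<open>N\<close> Fourier coefficients alone, so testing with \<open>e j\<close> turns the weak
  form into linear ordinary differential equations with continuous right-hand side; solving them and
  using completeness of the eigenfunctions identifies \<open>u t\<close> with an explicit series. In
  modal coordinates \<open>trafo\<close> is block triangular: the high modes carry the identity, the
  low ones the matrix I + A with A j m = (D m, e j). Invertibility of the transformation yields that
  of I + A, whose inverse takes the low modes of \<open>u\<close> to those of \<open>w\<close>. The
  slowest target modes are 1 and N + 1, with rates \<nu> \<lambda>_1 - \<gamma> + \<mu> and \<nu>
  \<lambda>_{N+1} - \<gamma>, where \<lambda>_{N+1} = (2 N + 1)^2 \<lambda>_1; the rates of the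
  theorem lie below both.\<close>

lemma integrable_leb_bounded_by:
  fixes f :: "real \<Rightarrow> 'a::euclidean_space"
  assumes "f \<in> borel_measurable (leb L)" "integrable (leb L) g"
    and "\<And>x. x \<in> {0..L} \<Longrightarrow> norm (f x) \<le> g x"
  shows "integrable (leb L) f"
  using measurable_bounded_by_integrable_imp_lebesgue_integrable[OF assms(1,2)] assms(3) by auto

lemma continuous_borel_measurable_leb:
  fixes f :: "real \<Rightarrow> 'a::euclidean_space"
  assumes "continuous_on {0..L} f" shows "f \<in> borel_measurable (leb L)"
  using continuous_imp_integrable_real[OF assms] by (rule borel_measurable_integrable)

lemma L2_measurable: "f \<in> L2 L \<Longrightarrow> f \<in> borel_measurable (leb L)"
  and L2_norm_sq_integrable: "f \<in> L2 L \<Longrightarrow> integrable (leb L) (\<lambda>x. (norm (f x))\<^sup>2)"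
  by (simp_all add: L2_def)

lemma L2_integrable:
  assumes "f \<in> L2 L" shows "integrable (leb L) f"
proof (rule integrable_leb_bounded_by)
  show "integrable (leb L) (\<lambda>x. 1 + (norm (f x))\<^sup>2)"
    using L2_norm_sq_integrable[OF assms] by (intro Bochner_Integration.integrable_add) auto
  show "norm (f x) \<le> 1 + (norm (f x))\<^sup>2" for x
    using sum_squares_bound[of 1 "norm (f x)"] norm_ge_zero[of "f x"] unfolding power2_eq_square by linarith
qed (rule L2_measurable[OF assms])

lemma L2_mult_integrable:
  assumes "f \<in> L2 L" "g \<in> L2 L" shows "integrable (leb L) (\<lambda>x. f x * g x)"
proof (rule integrable_leb_bounded_by)
  show "(\<lambda>x. f x * g x) \<in> borel_measurable (leb L)"
    using assms by (intro borel_measurable_times L2_measurable)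
  show "integrable (leb L) (\<lambda>x. (norm (f x))\<^sup>2 + (norm (g x))\<^sup>2)"
    using assms by (intro Bochner_Integration.integrable_add L2_norm_sq_integrable)
  show "norm (f x * g x) \<le> (norm (f x))\<^sup>2 + (norm (g x))\<^sup>2" for x
    using sum_squares_bound[of "norm (f x)" "norm (g x)"]
      mult_nonneg_nonneg[OF norm_ge_zero[of "f x"] norm_ge_zero[of "g x"]]
    unfolding norm_mult by linarith
qed

lemma L2_cnj: "f \<in> L2 L \<Longrightarrow> (\<lambda>x. cnj (f x)) \<in> L2 L"
  by (simp add: L2_def borel_measurable_continuous_on[where f=cnj] continuous_on_cnj)

lemma L2_cmult: "f \<in> L2 L \<Longrightarrow> (\<lambda>x. c * f x) \<in> L2 L"
  by (simp add: L2_def norm_mult power_mult_distrib borel_measurable_times)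

lemma L2_add:
  assumes "f \<in> L2 L" "g \<in> L2 L" shows "(\<lambda>x. f x + g x) \<in> L2 L"
proof -
  have "integrable (leb L) (\<lambda>x. (norm (f x + g x))\<^sup>2)"
  proof (rule integrable_leb_bounded_by)
    show "(\<lambda>x. (norm (f x + g x))\<^sup>2) \<in> borel_measurable (leb L)"
      using assms[THEN L2_measurable] by measurable
    show "integrable (leb L) (\<lambda>x. 2 * (norm (f x))\<^sup>2 + 2 * (norm (g x))\<^sup>2)"
      using assms by (intro Bochner_Integration.integrable_add integrable_mult_right L2_norm_sq_integrable)
    show "norm ((norm (f x + g x))\<^sup>2) \<le> 2 * (norm (f x))\<^sup>2 + 2 * (norm (g x))\<^sup>2" for x
    proof -
      have "(norm (f x + g x))\<^sup>2 \<le> (norm (f x) + norm (g x))\<^sup>2"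
        by (intro power_mono norm_triangle_ineq) auto
      also have "\<dots> \<le> 2 * (norm (f x))\<^sup>2 + 2 * (norm (g x))\<^sup>2"
        using sum_squares_bound[of "norm (f x)" "norm (g x)"] by (simp add: power2_sum)
      finally show ?thesis by simp
    qed
  qed
  then show ?thesis using assms by (simp add: L2_def borel_measurable_add)
qed

lemma L2_diff: "f \<in> L2 L \<Longrightarrow> g \<in> L2 L \<Longrightarrow> (\<lambda>x. f x - g x) \<in> L2 L"
  using L2_add[OF _ L2_cmult[of g L "-1"], of f] by simp

lemma L2_continuous:
  assumes "continuous_on {0..L} f" shows "f \<in> L2 L"
  using assms
  by (simp add: L2_def continuous_borel_measurable_leb continuous_imp_integrable_real continuous_on_norm
      continuous_on_power)

lemma L2_sum: "(\<And>i. i \<in> I \<Longrightarrow> f i \<in> L2 L) \<Longrightarrow> (\<lambda>x. \<Sum>i\<in>I. f i x) \<in> L2 L"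
  by (induction I rule: infinite_finite_induct) (simp_all add: L2_add L2_continuous)

lemma norm2_nonneg [simp]: "0 \<le> norm2 L f"
  by (simp add: norm2_def)

lemma norm2_sq: "(norm2 L f)\<^sup>2 = (\<integral>x. (norm (f x))\<^sup>2 \<partial>leb L)"
  by (simp add: norm2_def)

lemma eq_ae_sym: "eq_ae L f g \<Longrightarrow> eq_ae L g f"
  unfolding eq_ae_def by (erule eventually_mono) auto

lemma eq_ae_trans: "eq_ae L f g \<Longrightarrow> eq_ae L g h \<Longrightarrow> eq_ae L f h"
  unfolding eq_ae_def by (erule (1) eventually_elim2) auto

lemma eq_ae_refl [simp]: "eq_ae L f f"
  by (simp add: eq_ae_def)

lemma norm2_cong:
  assumes "eq_ae L f g" "f \<in> L2 L" "g \<in> L2 L" shows "norm2 L f = norm2 L g"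
  unfolding norm2_def
proof (intro arg_cong[where f=sqrt] integral_cong_AE)
  show "AE x in leb L. (cmod (f x))\<^sup>2 = (cmod (g x))\<^sup>2"
    using assms(1) unfolding eq_ae_def by (rule eventually_mono) auto
qed (use assms in \<open>auto dest: L2_measurable\<close>)

lemma inner2_cong:
  assumes "eq_ae L f f'" "eq_ae L g g'" "f \<in> L2 L" "f' \<in> L2 L" "g \<in> L2 L" "g' \<in> L2 L"
  shows "inner2 L f g = inner2 L f' g'"
  unfolding inner2_def
proof (intro integral_cong_AE)
  show "AE x in leb L. f x * cnj (g x) = f' x * cnj (g' x)"
    using assms(1,2) unfolding eq_ae_def by (rule eventually_elim2) auto
qed (intro borel_measurable_times L2_measurable[OF L2_cnj] L2_measurable assms)+

lemma inner2_add_left: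
  assumes "f \<in> L2 L" "g \<in> L2 L" "h \<in> L2 L"
  shows "inner2 L (\<lambda>x. f x + g x) h = inner2 L f h + inner2 L g h"
  unfolding inner2_def using L2_mult_integrable[OF _ L2_cnj] assms by (simp add: distrib_right)

lemma inner2_diff_left:
  assumes "f \<in> L2 L" "g \<in> L2 L" "h \<in> L2 L"
  shows "inner2 L (\<lambda>x. f x - g x) h = inner2 L f h - inner2 L g h"
  unfolding inner2_def using L2_mult_integrable[OF _ L2_cnj] assms by (simp add: left_diff_distrib)

lemma inner2_cmult_left: "inner2 L (\<lambda>x. c * f x) h = c * inner2 L f h"
  unfolding inner2_def by (simp add: mult.assoc)

lemma inner2_sum_left:
  assumes "\<And>i. i \<in> I \<Longrightarrow> f i \<in> L2 L" "h \<in> L2 L"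
  shows "inner2 L (\<lambda>x. \<Sum>i\<in>I. f i x) h = (\<Sum>i\<in>I. inner2 L (f i) h)"
  unfolding inner2_def using L2_mult_integrable[OF _ L2_cnj] assms
  by (simp add: sum_distrib_right)

lemma inner2_cnj: "inner2 L f g = cnj (inner2 L g f)"
  unfolding inner2_def Bochner_Integration.integral_cnj[symmetric] by (simp add: mult.commute)

lemma inner2_self: "inner2 L f f = of_real ((norm2 L f)\<^sup>2)"
  unfolding inner2_def norm2_sq
  by (subst integral_complex_of_real[symmetric]) (simp only: complex_norm_square)

text \<open>Young's inequality |f g| \<le> a/2 |f|^2 + 1/(2a) |g|^2 is integrated with the optimal
  weight a = G / F. Adding \<open>d\<close> to both norms keeps the weight defined and positive when
  a norm vanishes, and \<open>d\<close> is chosen so that the resulting error stays below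
  \<open>e\<close>.\<close>

lemma norm_inner2_le:
  assumes f: "f \<in> L2 L" and g: "g \<in> L2 L"
  shows "norm (inner2 L f g) \<le> norm2 L f * norm2 L g"
proof (rule field_le_epsilon)
  fix e :: real assume "e > 0"
  define F G where "F = norm2 L f" and "G = norm2 L g"
  have FG: "F \<ge> 0" "G \<ge> 0" by (auto simp: F_def G_def)
  define d where "d = e / (F + G + 1)"
  have d: "d > 0" using \<open>e > 0\<close> FG by (simp add: d_def)
  define a where "a = (G + d) / (F + d)"
  have a: "a > 0" using d FG by (simp add: a_def)
  have int: "integrable (leb L) (\<lambda>x. f x * cnj (g x))"
    by (intro L2_mult_integrable L2_cnj f g)
  have pt: "norm (f x * cnj (g x)) \<le> a / 2 * (norm (f x))\<^sup>2 + 1 / (2 * a) * (norm (g x))\<^sup>2" for x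
  proof -
    have "2 * (norm (f x) * norm (g x)) * a \<le> a\<^sup>2 * (norm (f x))\<^sup>2 + (norm (g x))\<^sup>2"
      using sum_squares_bound[of "a * norm (f x)" "norm (g x)"] by (simp add: power_mult_distrib mult_ac)
    then show ?thesis using a by (simp add: norm_mult field_simps power2_eq_square)
  qed
  have "norm (inner2 L f g) \<le> (\<integral>x. norm (f x * cnj (g x)) \<partial>leb L)"
    unfolding inner2_def by (rule integral_norm_bound)
  also have "\<dots> \<le> (\<integral>x. a / 2 * (norm (f x))\<^sup>2 + 1 / (2 * a) * (norm (g x))\<^sup>2 \<partial>leb L)"
    using int L2_norm_sq_integrable[OF f] L2_norm_sq_integrable[OF g] pt
    by (intro integral_mono integrable_norm Bochner_Integration.integrable_add integrable_mult_right) auto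
  also have "\<dots> = a / 2 * F\<^sup>2 + 1 / (2 * a) * G\<^sup>2"
    using L2_norm_sq_integrable[OF f] L2_norm_sq_integrable[OF g] by (simp add: F_def G_def norm2_sq)
  also have "a / 2 * F\<^sup>2 \<le> (G + d) * F / 2"
  proof -
    have "F\<^sup>2 / (F + d) \<le> F" using d FG by (simp add: field_simps power2_eq_square)
    then have "(G + d) / 2 * (F\<^sup>2 / (F + d)) \<le> (G + d) / 2 * F" using d FG by (intro mult_left_mono) auto
    then show ?thesis by (simp add: a_def field_simps)
  qed
  also have "1 / (2 * a) * G\<^sup>2 \<le> (F + d) * G / 2"
  proof -
    have "G\<^sup>2 / (G + d) \<le> G" using d FG by (simp add: field_simps power2_eq_square)
    then have "(F + d) / 2 * (G\<^sup>2 / (G + d)) \<le> (F + d) / 2 * G" using d FG by (intro mult_left_mono) auto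
    then show ?thesis by (simp add: a_def)
  qed
  also have "(G + d) * F / 2 + (F + d) * G / 2 = F * G + d * (F + G) / 2" by (simp add: field_simps)
  also have "d * (F + G) / 2 \<le> e"
  proof -
    have "d * (F + G) \<le> d * (F + G + 1)" using d by simp
    also have "\<dots> = e" using FG by (simp add: d_def)
    finally show ?thesis using \<open>e > 0\<close> by simp
  qed
  finally show "norm (inner2 L f g) \<le> norm2 L f * norm2 L g + e" by (simp add: F_def G_def)
qed

lemma norm2_triangle:
  assumes f: "f \<in> L2 L" and g: "g \<in> L2 L"
  shows "norm2 L (\<lambda>x. f x + g x) \<le> norm2 L f + norm2 L g"
proof (rule power2_le_imp_le)
  have fg: "(\<lambda>x. f x + g x) \<in> L2 L" by (rule L2_add[OF f g])
  have "of_real ((norm2 L (\<lambda>x. f x + g x))\<^sup>2) = inner2 L (\<lambda>x. f x + g x) (\<lambda>x. f x + g x)"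
    by (simp add: inner2_self)
  also have "\<dots> = inner2 L f (\<lambda>x. f x + g x) + inner2 L g (\<lambda>x. f x + g x)"
    by (rule inner2_add_left[OF f g fg])
  finally have "(norm2 L (\<lambda>x. f x + g x))\<^sup>2 =
      Re (inner2 L f (\<lambda>x. f x + g x)) + Re (inner2 L g (\<lambda>x. f x + g x))"
    by (metis Re_complex_of_real plus_complex.sel(1))
  also have "\<dots> \<le> norm2 L f * norm2 L (\<lambda>x. f x + g x) + norm2 L g * norm2 L (\<lambda>x. f x + g x)"
    by (intro add_mono order_trans[OF complex_Re_le_cmod] norm_inner2_le f g fg)
  finally have *: "norm2 L (\<lambda>x. f x + g x) * norm2 L (\<lambda>x. f x + g x) \<le>
      (norm2 L f + norm2 L g) * norm2 L (\<lambda>x. f x + g x)"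
    by (simp add: power2_eq_square algebra_simps)
  have "norm2 L (\<lambda>x. f x + g x) \<le> norm2 L f + norm2 L g"
  proof (cases "norm2 L (\<lambda>x. f x + g x) = 0")
    case False
    then have "0 < norm2 L (\<lambda>x. f x + g x)" using norm2_nonneg less_le by metis
    then show ?thesis using * mult_le_cancel_right_pos by blast
  qed simp
  then show "(norm2 L (\<lambda>x. f x + g x))\<^sup>2 \<le> (norm2 L f + norm2 L g)\<^sup>2" by (intro power_mono) auto
qed simp

lemma norm2_cmult: "norm2 L (\<lambda>x. c * f x) = norm c * norm2 L f"
  by (simp add: norm2_def norm_mult power_mult_distrib real_sqrt_mult)

lemma norm2_sum:
  assumes "\<And>i. i \<in> I \<Longrightarrow> f i \<in> L2 L"
  shows "norm2 L (\<lambda>x. \<Sum>i\<in>I. f i x) \<le> (\<Sum>i\<in>I. norm2 L (f i))"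
  using assms
proof (induction I rule: infinite_finite_induct)
  case (insert i I)
  have "norm2 L (\<lambda>x. \<Sum>i\<in>insert i I. f i x) \<le> norm2 L (f i) + norm2 L (\<lambda>x. \<Sum>i\<in>I. f i x)"
    using insert by (simp add: norm2_triangle L2_sum)
  then show ?case using insert by auto
qed (auto simp: norm2_def)

lemma norm2_le_sup:
  assumes "f \<in> L2 L" "0 \<le> L" "0 \<le> B" "\<And>x. x \<in> {0..L} \<Longrightarrow> norm (f x) \<le> B"
  shows "norm2 L f \<le> B * sqrt L"
proof -
  have "(\<integral>x. (norm (f x))\<^sup>2 \<partial>leb L) \<le> (\<integral>x. B\<^sup>2 \<partial>leb L)"
    using assms by (intro integral_mono L2_norm_sq_integrable) (auto intro: power_mono)
  also have "\<dots> = B\<^sup>2 * L" using assms(2) by (simp add: lebesgue_integral_eq_integral measure_restrict_space)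
  finally show ?thesis
    unfolding norm2_def using assms real_sqrt_le_mono[of _ "B\<^sup>2 * L"] by (fastforce simp: real_sqrt_mult)
qed

subsection \<open>Weak derivatives in one dimension\<close>

lemma AE_leb_iff: "(AE x in leb L. P x) \<longleftrightarrow> (AE x in lebesgue. x \<in> {0..L} \<longrightarrow> P x)"
  by (subst AE_restrict_space_iff) auto

text \<open>
  The sign of \<open>g\<close> is almost everywhere a limit of continuous functions.
\<close>

lemma AE_zero_if_orthogonal_continuous:
  fixes g :: "real \<Rightarrow> complex"
  assumes g: "integrable (leb L) g"
    and orth: "\<And>\<psi>. continuous_on UNIV \<psi> \<Longrightarrow> (\<integral>x. g x * \<psi> x \<partial>leb L) = 0"
  shows "AE x in leb L. g x = 0"
proof -
  define s where "s x = cnj (g x) / of_real (norm (g x))" for x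
  have gm: "g \<in> borel_measurable (leb L)" using g by (rule borel_measurable_integrable)
  have s_meas: "s \<in> borel_measurable (leb L)"
    unfolding s_def using borel_measurable_continuous_on[where f=cnj, OF _ gm] gm
    by (intro borel_measurable_divide borel_measurable_of_real borel_measurable_norm)
       (auto intro: continuous_on_cnj)
  have s_le: "norm (s x) \<le> 1" for x by (simp add: s_def norm_divide)
  have "s measurable_on {0..L}" using s_meas by (simp add: measurable_on_iff_borel_measurable)
  then obtain N h where N: "negligible N" and h: "\<And>n. continuous_on UNIV (h n)"
    and lim: "\<And>x. x \<notin> N \<Longrightarrow> (\<lambda>n. h n x) \<longlonglongrightarrow> (if x \<in> {0..L} then s x else 0)"
    unfolding measurable_on_def by blast
  \<comment> \<open>Truncating to modulus at most 1 does not change the limit, as norm (s x) \<le>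
    1, and it makes norm (g x) a dominating function.\<close>
  define p where "p n x = h n x / of_real (max 1 (norm (h n x)))" for n x
  have nz: "complex_of_real (max 1 r) \<noteq> 0" for r by (simp add: max_def)
  have p_cont: "continuous_on UNIV (p n)" for n
    unfolding p_def by (intro continuous_intros h) (use nz in blast)
  have p_le: "norm (p n x) \<le> 1" for n x
    by (simp add: p_def norm_divide)
  have p_lim: "(\<lambda>n. p n x) \<longlonglongrightarrow> s x" if "x \<notin> N" "x \<in> {0..L}" for x
  proof -
    have "(\<lambda>n. h n x) \<longlonglongrightarrow> s x" using lim[OF that(1)] that(2) by simp
    then have "(\<lambda>n. p n x) \<longlonglongrightarrow> s x / of_real (max 1 (norm (s x)))"
      unfolding p_def by (intro tendsto_intros nz)
    moreover have "max 1 (norm (s x)) = 1" using s_le[of x] by simp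
    ultimately show ?thesis by simp
  qed
  have "AE x in lebesgue. x \<notin> N" using N by (simp add: negligible_iff_null_sets AE_not_in)
  then have AE_lim: "AE x in leb L. (\<lambda>n. g x * p n x) \<longlonglongrightarrow> g x * s x"
    unfolding AE_leb_iff by (rule eventually_mono) (intro impI tendsto_mult tendsto_const p_lim, auto)
  have "(\<lambda>n. \<integral>x. g x * p n x \<partial>leb L) \<longlonglongrightarrow> (\<integral>x. g x * s x \<partial>leb L)"
  proof (rule integral_dominated_convergence[where w = "\<lambda>x. norm (g x)"])
    show "(\<lambda>x. g x * s x) \<in> borel_measurable (leb L)" by (intro borel_measurable_times gm s_meas)
    show "(\<lambda>x. g x * p n x) \<in> borel_measurable (leb L)" for n
      by (intro borel_measurable_times gm continuous_borel_measurable_leb continuous_on_subset[OF p_cont]) auto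
    show "AE x in leb L. norm (g x * p n x) \<le> norm (g x)" for n
      using p_le by (auto simp: norm_mult intro!: AE_I2 mult_left_le)
  qed (use g AE_lim in auto)
  moreover have "(\<integral>x. g x * p n x \<partial>leb L) = 0" for n by (rule orth[OF p_cont])
  ultimately have "(\<integral>x. g x * s x \<partial>leb L) = 0" by (simp add: LIMSEQ_const_iff)
  moreover have "g x * s x = of_real (norm (g x))" for x
    by (cases "g x = 0") (simp_all add: s_def complex_norm_square[symmetric] power2_eq_square)
  ultimately have "(\<integral>x. norm (g x) \<partial>leb L) = 0" by simp
  then have "AE x in leb L. norm (g x) = 0"
    by (subst (asm) integral_nonneg_eq_0_iff_AE) (use g in auto)
  then show ?thesis by simp
qed

lemma integrable_mult_continuous:
  fixes g \<psi> :: "real \<Rightarrow> complex"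
  assumes g: "integrable (leb L) g" and \<psi>: "continuous_on {0..L} \<psi>"
  shows "integrable (leb L) (\<lambda>x. g x * \<psi> x)"
proof -
  have "bounded (\<psi> ` {0..L})" by (intro compact_imp_bounded compact_continuous_image \<psi>) simp
  then obtain B where B: "\<And>x. x \<in> {0..L} \<Longrightarrow> norm (\<psi> x) \<le> B"
    unfolding bounded_iff by blast
  show ?thesis
  proof (rule integrable_leb_bounded_by)
    show "integrable (leb L) (\<lambda>x. norm (g x) * B)" using g by simp
    show "(\<lambda>x. g x * \<psi> x) \<in> borel_measurable (leb L)"
      by (intro borel_measurable_times borel_measurable_integrable[OF g] continuous_borel_measurable_leb \<psi>)
    show "norm (g x * \<psi> x) \<le> norm (g x) * B" if "x \<in> {0..L}" for x
      using B[OF that] by (simp add: norm_mult mult_left_mono)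
  qed
qed

text \<open>Since \<open>h\<close> is injective on a compact interval, it is a homeomorphism onto
  its image. So every continuous function is a continuous function of \<open>h\<close> and, by
  Weierstrass, a uniform limit of polynomials in \<open>h\<close>. It is applied with the identity
  and with cos (\<pi> x / L).\<close>

lemma AE_zero_if_moments_zero:
  fixes g :: "real \<Rightarrow> complex" and h :: "real \<Rightarrow> real"
  assumes g: "integrable (leb L) g" and h: "continuous_on {0..L} h" "inj_on h {0..L}"
    and mom: "\<And>n. (\<integral>x. g x * of_real (h x ^ n) \<partial>leb L) = 0"
  shows "AE x in leb L. g x = 0"
proof (rule AE_zero_if_orthogonal_continuous[OF g])
  have real: "(\<integral>x. g x * of_real (\<psi> x) \<partial>leb L) = 0" if \<psi>: "continuous_on {0..L} \<psi>" for \<psi> :: "real \<Rightarrow> real"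
  proof -
    define C where "C = (\<integral>x. norm (g x) \<partial>leb L)"
    have C: "C \<ge> 0" by (simp add: C_def)
    obtain h' where h': "homeomorphism {0..L} (h ` {0..L}) h h'"
      using homeomorphism_compact[OF _ h(1) refl h(2)] by auto
    have cont: "continuous_on (h ` {0..L}) (\<lambda>y. \<psi> (h' y))"
      using h' by (intro continuous_on_compose2[OF \<psi>]) (auto simp: homeomorphism_def)
    have comp: "compact (h ` {0..L})" by (intro compact_continuous_image h) simp
    have bound: "norm (\<integral>x. g x * of_real (\<psi> x) \<partial>leb L) \<le> C * e" if e: "e > 0" for e
    proof -
      obtain P where P: "real_polynomial_function P" "\<And>y. y \<in> h ` {0..L} \<Longrightarrow> \<bar>\<psi> (h' y) - P y\<bar> < e"
        using Stone_Weierstrass_real_polynomial_function[OF comp cont e] by blast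
      obtain a n where an: "P = (\<lambda>x. \<Sum>i\<le>n. a i * x ^ i)"
        using P(1) by (auto simp: real_polynomial_function_iff_sum)
      have ih: "integrable (leb L) (\<lambda>x. g x * of_real (h x ^ i))" for i :: nat
        by (intro integrable_mult_continuous g continuous_intros h)
      have Pint: "integrable (leb L) (\<lambda>x. g x * of_real (P (h x)))"
        unfolding an by (intro integrable_mult_continuous g continuous_intros h)
      have "(\<integral>x. g x * of_real (P (h x)) \<partial>leb L) = (\<integral>x. (\<Sum>i\<le>n. of_real (a i) * (g x * of_real (h x ^ i))) \<partial>leb L)"
        by (simp add: an sum_distrib_left mult_ac)
      also have "\<dots> = (\<Sum>i\<le>n. of_real (a i) * (\<integral>x. g x * of_real (h x ^ i) \<partial>leb L))"
        using ih by (subst Bochner_Integration.integral_sum) (auto intro: integrable_mult_right)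
      also have "\<dots> = 0" using mom by simp
      finally have P0: "(\<integral>x. g x * of_real (P (h x)) \<partial>leb L) = 0" .
      have \<psi>int: "integrable (leb L) (\<lambda>x. g x * of_real (\<psi> x))"
        by (intro integrable_mult_continuous g continuous_intros \<psi>)
      have dint: "integrable (leb L) (\<lambda>x. g x * of_real (\<psi> x - P (h x)))"
        using Bochner_Integration.integrable_diff[OF \<psi>int Pint] by (simp add: algebra_simps)
      have "(\<integral>x. g x * of_real (\<psi> x) \<partial>leb L) = (\<integral>x. g x * of_real (\<psi> x - P (h x)) \<partial>leb L)"
        using P0 \<psi>int Pint by (simp add: right_diff_distrib)
      also have "norm \<dots> \<le> (\<integral>x. norm (g x * of_real (\<psi> x - P (h x))) \<partial>leb L)" by (rule integral_norm_bound)
      also have "\<dots> \<le> (\<integral>x. norm (g x) * e \<partial>leb L)"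
      proof (intro integral_mono integrable_norm dint)
        show "norm (g x * of_real (\<psi> x - P (h x))) \<le> norm (g x) * e" if "x \<in> space (leb L)" for x
        proof -
          have "h' (h x) = x" "x \<in> {0..L}" using h' that by (auto simp: homeomorphism_def)
          then have "\<bar>\<psi> x - P (h x)\<bar> \<le> e" using P(2)[of "h x"] by fastforce
          then show ?thesis by (metis norm_mult norm_of_real mult_left_mono norm_ge_zero)
        qed
      qed (use g in simp)
      finally show ?thesis by (simp add: C_def)
    qed
    show ?thesis
    proof (rule ccontr)
      assume "\<not> ?thesis"
      then have p: "norm (\<integral>x. g x * of_real (\<psi> x) \<partial>leb L) > 0" (is "?n > 0") by simp
      have "?n \<le> C * (?n / (2 * (C + 1)))" by (rule bound) (use p C in \<open>auto intro!: divide_pos_pos\<close>)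
      also have "\<dots> < ?n"
        using p C mult_nonneg_nonneg[of C ?n] by (simp add: pos_divide_less_eq algebra_simps add_nonneg_pos)
      finally show False by simp
    qed
  qed
  fix \<psi> :: "real \<Rightarrow> complex" assume "continuous_on UNIV \<psi>"
  then have \<psi>: "continuous_on {0..L} \<psi>" by (rule continuous_on_subset) simp
  have "(\<integral>x. g x * \<psi> x \<partial>leb L) = (\<integral>x. g x * of_real (Re (\<psi> x)) + \<i> * (g x * of_real (Im (\<psi> x))) \<partial>leb L)"
    by (intro Bochner_Integration.integral_cong refl) (simp add: complex_eq_iff algebra_simps)
  also have "\<dots> = (\<integral>x. g x * of_real (Re (\<psi> x)) \<partial>leb L) + \<i> * (\<integral>x. g x * of_real (Im (\<psi> x)) \<partial>leb L)"
    by (subst Bochner_Integration.integral_add)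
       (auto intro!: integrable_mult_right integrable_mult_continuous g continuous_intros \<psi>)
  also have "\<dots> = 0" using real \<psi> by (simp add: continuous_on_Re continuous_on_Im)
  finally show "(\<integral>x. g x * \<psi> x \<partial>leb L) = 0" .
qed

lemma integral_leb_eq_integral:
  fixes f :: "real \<Rightarrow> 'a::euclidean_space"
  assumes "continuous_on {0..L} f" shows "(\<integral>x. f x \<partial>leb L) = integral {0..L} f"
  by (simp add: assms continuous_imp_integrable_real lebesgue_integral_eq_integral)

lemma integral_leb_derivative:
  fixes f :: "real \<Rightarrow> complex"
  assumes "0 \<le> x" "\<And>y. y \<in> {0..x} \<Longrightarrow> (f has_vector_derivative f' y) (at y within {0..x})"
    and "continuous_on {0..x} f'"
  shows "(\<integral>y. f' y \<partial>leb x) = f x - f 0"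
  using fundamental_theorem_of_calculus[OF assms(1,2)] integral_leb_eq_integral[OF assms(3)]
  by (simp add: integral_unique)

text \<open>
  The defect of the identity on \<open>[0, x]\<close>, as a function \<open>F\<close> of \<open>x\<close>, satisfies
  \<open>norm (F y - F x) \<le> 2 C (y - x) \<integral>\<^sub>x\<^sup>y norm g\<close>, so its derivative vanishes.
\<close>

lemma integral_by_parts_indefinite:
  fixes g \<phi> :: "real \<Rightarrow> complex"
  assumes L: "0 \<le> L" and g: "integrable (leb L) g"
    and d: "\<And>x. x \<in> {0..L} \<Longrightarrow> (\<phi> has_vector_derivative \<phi>' x) (at x within {0..L})"
    and c: "continuous_on {0..L} \<phi>'"
  defines "G \<equiv> \<lambda>x. \<integral>y. g y \<partial>leb x"
  shows "(\<integral>x. g x * \<phi> x \<partial>leb L) = G L * \<phi> L - (\<integral>x. G x * \<phi>' x \<partial>leb L)"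
proof -
  have cG: "continuous_on {0..L} G" unfolding G_def by (rule indefinite_integral_continuous_real[OF g])
  have c\<phi>: "continuous_on {0..L} \<phi>" using d continuous_on_vector_derivative by blast
  define H where "H x = (\<integral>y. norm (g y) \<partial>leb x)" for x
  have cH: "continuous_on {0..L} H" unfolding H_def
    by (rule indefinite_integral_continuous_real) (use g in simp)
  have "bounded (\<phi>' ` {0..L})" by (intro compact_imp_bounded compact_continuous_image c) simp
  then obtain C where C: "C > 0" "\<And>x. x \<in> {0..L} \<Longrightarrow> norm (\<phi>' x) \<le> C" unfolding bounded_pos by auto
  have ig\<phi>: "integrable (leb L) (\<lambda>x. g x * \<phi> x)" by (rule integrable_mult_continuous[OF g c\<phi>])
  have iG: "integrable (leb L) (\<lambda>x. G x * \<phi>' x)"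
    by (intro continuous_imp_integrable_real continuous_intros cG c)
  define F where "F x = (\<integral>y. g y * \<phi> y \<partial>leb x) + (\<integral>y. G y * \<phi>' y \<partial>leb x) - G x * \<phi> x" for x
  have key: "norm (F y - F x) \<le> 2 * C * (y - x) * (H y - H x)" if xy: "0 \<le> x" "x \<le> y" "y \<le> L" for x y
  proof -
    let ?I = "lebesgue_on {x..y}"
    have sub: "{x..y} \<subseteq> {0..L}" "{0..y} \<subseteq> {0..L}" using xy by auto
    have split: "(\<integral>z. f z \<partial>leb y) = (\<integral>z. f z \<partial>leb x) + (\<integral>z. f z \<partial>?I)" if "integrable (leb L) f"
      for f :: "real \<Rightarrow> 'b::euclidean_space"
      using integral_combine[OF integrable_subinterval[OF that sub(2)]] xy by simp
    have gI: "integrable ?I g" using integrable_subinterval[OF g sub(1)] .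
    have ng: "integrable (leb L) (\<lambda>x. norm (g x))" using g by simp
    have ngI: "integrable ?I (\<lambda>x. norm (g x))" using gI by simp
    have \<phi>I: "integrable ?I \<phi>'" "integrable ?I (\<lambda>z. G z * \<phi>' z)" "integrable ?I (\<lambda>z. g z * \<phi> z)"
      using integrable_subinterval[OF _ sub(1)] continuous_imp_integrable_real[OF c] iG ig\<phi> by blast+
    have "(\<phi>' has_integral (\<phi> y - \<phi> x)) {x..y}"
      using xy sub d by (intro fundamental_theorem_of_calculus)
        (auto intro: has_vector_derivative_within_subset[where S="{0..L}"])
    then have \<phi>int: "(\<integral>z. \<phi>' z \<partial>?I) = \<phi> y - \<phi> x"
      using \<phi>I(1) by (simp add: lebesgue_integral_eq_integral integral_unique)
    have Gd: "G y - G x = (\<integral>z. g z \<partial>?I)" unfolding G_def using split[OF g] by simp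
    have Hd: "H y - H x = (\<integral>z. norm (g z) \<partial>?I)" unfolding H_def using split[OF ng] by simp
    have i1: "integrable ?I (\<lambda>z. g z * (\<phi> z - \<phi> x))"
      using Bochner_Integration.integrable_diff[OF \<phi>I(3) integrable_mult_left[OF gI, of "\<phi> x"]]
      by (simp add: right_diff_distrib)
    have i2: "integrable ?I (\<lambda>z. (G z - G y) * \<phi>' z)"
      using Bochner_Integration.integrable_diff[OF \<phi>I(2) integrable_mult_right[OF \<phi>I(1), of "G y"]]
      by (simp add: left_diff_distrib)
    have "F y - F x = (\<integral>z. g z * \<phi> z \<partial>?I) + (\<integral>z. G z * \<phi>' z \<partial>?I) - (G y * \<phi> y - G x * \<phi> x)"
      unfolding F_def using split[OF ig\<phi>] split[OF iG] by simp
    \<comment> \<open>Expanding around \<phi> at the left end and \<open>G\<close> at the right end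
      leaves only the increments \<phi> z - \<phi> x and G z - G y, bounded by C (y - x) and H y - H
      x.\<close>
    also have "G y * \<phi> y - G x * \<phi> x = (G y - G x) * \<phi> x + G y * (\<phi> y - \<phi> x)" by (simp add: algebra_simps)
    also have "\<dots> = (\<integral>z. g z * \<phi> x \<partial>?I) + (\<integral>z. G y * \<phi>' z \<partial>?I)" by (simp add: Gd \<phi>int)
    also have "(\<integral>z. g z * \<phi> z \<partial>?I) + (\<integral>z. G z * \<phi>' z \<partial>?I) - \<dots> =
        (\<integral>z. g z * (\<phi> z - \<phi> x) \<partial>?I) + (\<integral>z. (G z - G y) * \<phi>' z \<partial>?I)"
      using \<phi>I gI by (simp add: right_diff_distrib left_diff_distrib)
    finally have eq: "F y - F x = (\<integral>z. g z * (\<phi> z - \<phi> x) \<partial>?I) + (\<integral>z. (G z - G y) * \<phi>' z \<partial>?I)" .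
    have b1: "norm (\<integral>z. g z * (\<phi> z - \<phi> x) \<partial>?I) \<le> C * (y - x) * (H y - H x)"
    proof -
      have "norm (\<integral>z. g z * (\<phi> z - \<phi> x) \<partial>?I) \<le> (\<integral>z. norm (g z * (\<phi> z - \<phi> x)) \<partial>?I)" by (rule integral_norm_bound)
      also have "\<dots> \<le> (\<integral>z. norm (g z) * (C * (y - x)) \<partial>?I)"
      proof (intro integral_mono integrable_norm i1)
        fix z assume "z \<in> space ?I"
        then have z: "x \<le> z" "z \<le> y" by auto
        have "norm (\<phi> z - \<phi> x) \<le> C * norm (z - x)"
        proof (rule differentiable_bound[where f'="\<lambda>t h. h *\<^sub>R \<phi>' t" and S="{0..L}"])
          show "(\<phi> has_derivative (\<lambda>h. h *\<^sub>R \<phi>' t)) (at t within {0..L})" if "t \<in> {0..L}" for t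
            using d[OF that] by (simp add: has_vector_derivative_def)
          show "onorm (\<lambda>h. h *\<^sub>R \<phi>' t) \<le> C" if "t \<in> {0..L}" for t
            using C(2)[OF that] by (intro onorm_le) (metis norm_scaleR mult.commute mult_right_mono norm_ge_zero real_norm_def)
        qed (use z xy in auto)
        also have "\<dots> \<le> C * (y - x)" using z C by (intro mult_left_mono) auto
        finally show "norm (g z * (\<phi> z - \<phi> x)) \<le> norm (g z) * (C * (y - x))"
          by (simp add: norm_mult mult_left_mono)
      qed (use ngI in simp)
      finally show ?thesis by (simp add: Hd mult_ac)
    qed
    have b2: "norm (\<integral>z. (G z - G y) * \<phi>' z \<partial>?I) \<le> C * (y - x) * (H y - H x)"
    proof -
      have "norm (\<integral>z. (G z - G y) * \<phi>' z \<partial>?I) \<le> (\<integral>z. norm ((G z - G y) * \<phi>' z) \<partial>?I)" by (rule integral_norm_bound)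
      also have "\<dots> \<le> (\<integral>z. (H y - H x) * C \<partial>?I)"
      proof (intro integral_mono integrable_norm i2)
        fix z assume "z \<in> space ?I"
        then have z: "x \<le> z" "z \<le> y" by auto
        have gz: "integrable (lebesgue_on {z..y}) g" "integrable (lebesgue_on {x..z}) g"
          using integrable_subinterval[OF gI] z by auto
        have "G y - G z = (\<integral>t. g t \<partial>lebesgue_on {z..y})"
          using integral_combine[of 0 y g z] integrable_subinterval[OF g sub(2)] z xy by (simp add: G_def)
        then have "norm (G z - G y) \<le> (\<integral>t. norm (g t) \<partial>lebesgue_on {z..y})"
          by (metis norm_minus_commute integral_norm_bound)
        also have "\<dots> \<le> H y - H x"
          using integral_combine[OF ngI z] by (simp add: Hd)
        finally show "norm ((G z - G y) * \<phi>' z) \<le> (H y - H x) * C"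
          using C(2)[of z] z xy by (auto simp: norm_mult intro!: mult_mono elim: order_trans[OF norm_ge_zero])
      qed simp
      also have "\<dots> = C * (y - x) * (H y - H x)"
        using xy by (simp add: lebesgue_integral_eq_integral measure_restrict_space)
      finally show ?thesis .
    qed
    show ?thesis unfolding eq using norm_triangle_mono[OF b1 b2] by simp
  qed
  have "(F has_derivative (\<lambda>h. 0)) (at x within {0..L})" if x: "x \<in> {0..L}" for x
    unfolding has_derivative_within_alt
  proof (intro conjI allI impI)
    fix e :: real assume e: "e > 0"
    obtain dd where dd: "dd > 0" "\<And>y. y \<in> {0..L} \<Longrightarrow> dist y x < dd \<Longrightarrow> dist (H y) (H x) < e / (2 * C)"
      using cH x e C(1) unfolding continuous_on_iff by (metis divide_pos_pos mult_pos_pos zero_less_numeral)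
    show "\<exists>d>0. \<forall>y\<in>{0..L}. norm (y - x) < d \<longrightarrow> norm (F y - F x - 0) \<le> e * norm (y - x)"
    proof (intro exI[of _ dd] conjI ballI impI dd(1))
      fix y assume y: "y \<in> {0..L}" "norm (y - x) < dd"
      have H: "\<bar>H y - H x\<bar> < e / (2 * C)" using dd(2)[OF y(1)] y(2) by (simp add: dist_norm)
      have "norm (F y - F x) \<le> 2 * C * \<bar>y - x\<bar> * \<bar>H y - H x\<bar>"
      proof (cases "x \<le> y")
        case True
        have "norm (F y - F x) \<le> 2 * C * (y - x) * (H y - H x)" using key[of x y] x y True by simp
        also have "\<dots> \<le> 2 * C * (y - x) * \<bar>H y - H x\<bar>"
          using True C by (intro mult_left_mono) auto
        also have "y - x = \<bar>y - x\<bar>" using True by simp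
        finally show ?thesis .
      next
        case False
        have "norm (F x - F y) \<le> 2 * C * (x - y) * (H x - H y)" using key[of y x] x y False by simp
        also have "\<dots> \<le> 2 * C * (x - y) * \<bar>H y - H x\<bar>"
          using False C by (intro mult_left_mono) auto
        also have "x - y = \<bar>y - x\<bar>" using False by simp
        finally show ?thesis by (simp add: norm_minus_commute)
      qed
      also have "\<dots> \<le> 2 * C * \<bar>y - x\<bar> * (e / (2 * C))"
        using H C by (intro mult_left_mono) auto
      finally show "norm (F y - F x - 0) \<le> e * norm (y - x)" using C by (simp add: mult.commute)
    qed
  qed simp
  then obtain k where "\<And>x. x \<in> {0..L} \<Longrightarrow> F x = k"
    using has_derivative_zero_constant[of "{0..L}" F] by (auto simp: convex_real_interval)
  then have "F L = F 0" using L by simp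
  moreover have "(\<integral>y. f y \<partial>leb 0) = 0" for f :: "real \<Rightarrow> complex"
    by (rule integral_eq_zero_null_sets) (auto simp: null_sets_restrict_space)
  ultimately show ?thesis by (simp add: F_def G_def algebra_simps)
qed

lemma AE_eq_continuous:
  fixes f g :: "real \<Rightarrow> complex"
  assumes "0 < L" "continuous_on {0..L} f" "continuous_on {0..L} g" "AE x in leb L. f x = g x" "x \<in> {0..L}"
  shows "f x = g x"
proof -
  have "(\<integral>x. norm (f x - g x) \<partial>leb L) = 0"
    using assms(4) by (intro integral_eq_zero_AE) (auto elim: eventually_mono)
  then have "\<forall>x\<in>{0..L}. norm (f x - g x) = 0"
    using assms by (subst (asm) integralL_eq_0_iff) (auto intro!: continuous_intros)
  then show ?thesis using assms by simp
qed

lemma C1c_outside: "C1c S \<phi> \<phi>' \<Longrightarrow> x \<notin> S \<Longrightarrow> \<phi> x = 0"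
  by (auto simp: C1c_def)

lemma C1c_continuous:
  assumes "C1c S \<phi> \<phi>'" shows "continuous_on A \<phi>" "continuous_on A \<phi>'"
proof -
  have "continuous_on UNIV \<phi>" using assms unfolding C1c_def by (meson DERIV_continuous_on)
  then show "continuous_on A \<phi>" by (rule continuous_on_subset) simp
  show "continuous_on A \<phi>'" using assms unfolding C1c_def by (blast intro: continuous_on_subset)
qed

text \<open>This manufactures test functions. The primitive is zero up to \<open>a\<close>, and
  because \<open>f\<close> has mean zero it is zero again beyond \<open>b\<close>.\<close>

lemma C1c_antiderivative:
  assumes f: "continuous_on UNIV f" and ab: "0 < a" "a \<le> b" "b < L"
    and supp: "\<And>x. x \<notin> {a..b} \<Longrightarrow> f x = 0" and zero: "integral {0..L} f = 0"
  shows "C1c {0<..<L} (\<lambda>x. integral {0..x} f) f"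
  unfolding C1c_def
proof (intro conjI allI f exI[of _ "{a..b}"] impI)
  have int: "f integrable_on {c..d}" for c d
    by (intro integrable_continuous_real continuous_on_subset[OF f]) auto
  have F0: "integral {0..x} f = 0" if "x \<le> a" for x
  proof -
    have "integral {0..x} f = integral {0..x} (\<lambda>x. 0)"
      by (rule integral_spike[of "{a}"]) (use supp that in auto)
    then show ?thesis by simp
  qed
  show "integral {0..x} f = 0" if "x \<notin> {a..b}" for x
  proof (cases "x < a")
    case False
    have z: "integral {b..c} f = 0" for c
    proof -
      have "integral {b..c} f = integral {b..c} (\<lambda>x. 0)"
        by (rule integral_spike[of "{b}"]) (use supp ab in auto)
      then show ?thesis by simp
    qed
    have "integral {0..b} f + integral {b..L} f = 0"
      using zero Henstock_Kurzweil_Integration.integral_combine[of 0 b L f] int ab by simp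
    moreover have "integral {0..b} f + integral {b..x} f = integral {0..x} f"
      using Henstock_Kurzweil_Integration.integral_combine[of 0 b x f] int ab that False by simp
    ultimately show ?thesis by (simp add: z)
  qed (use F0 in simp)
  show "((\<lambda>x. integral {0..x} f) has_real_derivative f x) (at x)" for x
  proof (cases "x < a")
    case True
    have "((\<lambda>x. integral {0..x} f) has_real_derivative 0) (at x)"
      by (rule has_field_derivative_transform_within_open[where S="{..<a}" and f="\<lambda>_. 0"]) (use True F0 in auto)
    then show ?thesis using supp True by auto
  next
    case False
    have "((\<lambda>x. integral {0..x} f) has_vector_derivative f x) (at x within {0..x + 1})"
      by (intro integral_has_vector_derivative continuous_on_subset[OF f]) (use False ab in auto)
    then show ?thesis
      using False ab at_within_Icc_at[of 0 x "x + 1"] by (simp add: has_real_derivative_iff_has_vector_derivative)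
  qed
qed (use ab in auto)

text \<open>
  The monomials are cut off near the endpoints and corrected by a multiple of the cutoff to have mean
  zero; this makes them derivatives of test functions.
\<close>

lemma weak_deriv_zero_imp_const:
  fixes h :: "real \<Rightarrow> complex"
  assumes L: "L > 0" and h: "integrable (leb L) h" and w: "weak_deriv L h (\<lambda>_. 0)"
  shows "\<exists>c. AE x in leb L. h x = c"
proof -
  \<comment> \<open>The cutoff is 0 within 1/n of an end point and 1 where both distances are at
    least 2/n. Continuity suffices, since the test function will be a primitive.\<close>
  define cut where "cut n x = max 0 (min 1 (real n * x - 1)) * max 0 (min 1 (real n * (L - x) - 1))" for n x
  have cut_cont: "continuous_on A (cut n)" for A n unfolding cut_def by (intro continuous_intros)
  have cut_le: "\<bar>cut n x\<bar> \<le> 1" for n x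
  proof -
    have "\<bar>max 0 (min 1 (real n * x - 1))\<bar> * \<bar>max 0 (min 1 (real n * (L - x) - 1))\<bar> \<le> 1 * 1"
      by (intro mult_mono) auto
    then show ?thesis by (simp add: cut_def abs_mult)
  qed
  have cut_lim: "(\<lambda>n. cut n x) \<longlonglongrightarrow> 1" if "0 < x" "x < L" for x
  proof (rule tendsto_eventually)
    have "eventually (\<lambda>n. real n * x > 2) sequentially" "eventually (\<lambda>n. real n * (L - x) > 2) sequentially"
      using that by real_asymp+
    then show "eventually (\<lambda>n. cut n x = 1) sequentially"
      by eventually_elim (simp add: cut_def)
  qed
  have AE_in: "AE x in leb L. 0 < x \<and> x < L"
  proof -
    have "AE x in lebesgue. x \<noteq> 0" "AE x in lebesgue. x \<noteq> L"
      by (rule AE_I'[of "{0}"]; simp) (rule AE_I'[of "{L}"]; simp)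
    then show ?thesis unfolding AE_leb_iff by eventually_elim auto
  qed
  have lim: "(\<lambda>n. \<integral>x. f x * of_real (cut n x) \<partial>leb L) \<longlonglongrightarrow> (\<integral>x. f x \<partial>leb L)"
    if f: "integrable (leb L) f" for f :: "real \<Rightarrow> complex"
  proof (rule integral_dominated_convergence[where w="\<lambda>x. norm (f x)"])
    show "AE x in leb L. (\<lambda>n. f x * of_real (cut n x)) \<longlonglongrightarrow> f x"
      using AE_in
    proof eventually_elim
      case (elim x)
      then have "(\<lambda>n. f x * of_real (cut n x)) \<longlonglongrightarrow> f x * of_real 1" by (intro tendsto_intros cut_lim) auto
      then show ?case by simp
    qed
    show "(\<lambda>x. f x * of_real (cut n x)) \<in> borel_measurable (leb L)" for n
      by (intro borel_measurable_times borel_measurable_integrable[OF f] continuous_borel_measurable_leb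
          continuous_intros cut_cont)
    show "AE x in leb L. norm (f x * of_real (cut n x)) \<le> norm (f x)" for n
      using cut_le[of n] by (auto simp: norm_mult intro!: AE_I2 mult_left_le)
  qed (use f in auto)
  define c where "c = (\<integral>x. h x \<partial>leb L) / of_real L"
  have orth: "(\<integral>x. (h x - c) * of_real (x ^ m) \<partial>leb L) = 0" for m
  proof -
    define I J where "I n = integral {0..L} (\<lambda>x. x ^ m * cut n x)" and "J n = integral {0..L} (cut n)" for n
    have II: "complex_of_real (I n) = (\<integral>x. of_real (x ^ m) * of_real (cut n x) \<partial>leb L)"
     and JJ: "complex_of_real (J n) = (\<integral>x. 1 * of_real (cut n x) \<partial>leb L)" for n
      unfolding I_def J_def of_real_mult[symmetric] mult_1 integral_complex_of_real
      by (subst integral_leb_eq_integral; (intro continuous_intros cut_cont)?; simp)+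
    have hm: "integrable (leb L) (\<lambda>x. h x * of_real (x ^ m))"
      by (intro integrable_mult_continuous h continuous_intros)
    have l1: "(\<lambda>n. of_real (I n)) \<longlonglongrightarrow> (\<integral>x. complex_of_real (x ^ m) \<partial>leb L)"
      unfolding II by (rule lim) (intro continuous_imp_integrable_real continuous_intros)
    have l2': "(\<lambda>n. of_real (J n)) \<longlonglongrightarrow> (\<integral>x. (1::complex) \<partial>leb L)"
      unfolding JJ by (rule lim) simp
    have 1: "(\<integral>x. (1::complex) \<partial>leb L) = of_real L"
      using L by (subst integral_leb_eq_integral) (auto simp: scaleR_conv_of_real)
    have l2: "(\<lambda>n. complex_of_real (J n)) \<longlonglongrightarrow> of_real L" using l2' by (simp only: 1)
    have lim0: "(\<lambda>n. of_real (J n) * (\<integral>x. h x * of_real (x ^ m) * of_real (cut n x) \<partial>leb L) -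
          of_real (I n) * (\<integral>x. h x * of_real (cut n x) \<partial>leb L)) \<longlonglongrightarrow>
        of_real L * (\<integral>x. h x * of_real (x ^ m) \<partial>leb L) - (\<integral>x. complex_of_real (x ^ m) \<partial>leb L) * (\<integral>x. h x \<partial>leb L)"
      by (intro tendsto_mult tendsto_diff lim l1 l2 h hm)
    have ev0: "eventually (\<lambda>n. of_real (J n) * (\<integral>x. h x * of_real (x ^ m) * of_real (cut n x) \<partial>leb L) -
          of_real (I n) * (\<integral>x. h x * of_real (cut n x) \<partial>leb L) = 0) sequentially"
    proof -
      have "eventually (\<lambda>n. real n * L > 2) sequentially" using L by real_asymp
      then show ?thesis
      proof eventually_elim
        case (elim n)
        then have n: "real n > 0" by (cases n) auto
        \<comment> \<open>This is the correction x^m cut - (I n / J n) cut multiplied by J n, which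
          avoids the division; its integral is J n I n - I n J n = 0.\<close>
        define f where "f x = J n * (x ^ m * cut n x) - I n * cut n x" for x
        have "C1c {0<..<L} (\<lambda>x. integral {0..x} f) f"
        proof (rule C1c_antiderivative[of f "1 / n" "L - 1 / n"])
          show "continuous_on UNIV f" unfolding f_def by (intro continuous_intros cut_cont)
          show "1 / real n \<le> L - 1 / real n" using n elim by (simp add: field_simps)
          have cI: "(\<lambda>x. J n * (x ^ m * cut n x)) integrable_on {0..L}" "(\<lambda>x. I n * cut n x) integrable_on {0..L}"
            by (intro integrable_continuous_real continuous_intros cut_cont)+
          show "integral {0..L} f = 0"
            unfolding f_def using cI by (simp add: Henstock_Kurzweil_Integration.integral_diff I_def J_def)
          show "f x = 0" if "x \<notin> {1 / real n..L - 1 / real n}" for x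
          proof -
            have "real n * x < 1 \<or> real n * (L - x) < 1" using that n by (auto simp: field_simps not_le)
            then have "cut n x = 0" by (auto simp: cut_def)
            then show ?thesis by (simp add: f_def)
          qed
        qed (use n in auto)
        then have "(\<integral>x. h x * of_real (f x) \<partial>leb L) = 0" using w unfolding weak_deriv_def by fastforce
        also have "(\<lambda>x. h x * of_real (f x)) = (\<lambda>x. of_real (J n) * (h x * of_real (x ^ m) * of_real (cut n x)) -
            of_real (I n) * (h x * of_real (cut n x)))" by (auto simp: f_def algebra_simps)
        also have "(\<integral>x. \<dots> x \<partial>leb L) = of_real (J n) * (\<integral>x. h x * of_real (x ^ m) * of_real (cut n x) \<partial>leb L) -
          of_real (I n) * (\<integral>x. h x * of_real (cut n x) \<partial>leb L)"
        proof -
          have "integrable (leb L) (\<lambda>x. h x * of_real (x ^ m) * of_real (cut n x))"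
            "integrable (leb L) (\<lambda>x. h x * of_real (cut n x))"
            by (intro integrable_mult_continuous h hm continuous_intros cut_cont)+
          then show ?thesis by simp
        qed
        finally show ?case .
      qed
    qed
    \<comment> \<open>Divided by L, this says that \<open>h\<close> minus its mean \<open>c\<close>
      is orthogonal to x^m.\<close>
    have "of_real L * (\<integral>x. h x * of_real (x ^ m) \<partial>leb L) - (\<integral>x. complex_of_real (x ^ m) \<partial>leb L) * (\<integral>x. h x \<partial>leb L) = 0"
      by (intro tendsto_unique[OF trivial_limit_sequentially lim0 tendsto_eventually[OF ev0]])
    moreover have "(\<integral>x. (h x - c) * of_real (x ^ m) \<partial>leb L) =
        (\<integral>x. h x * of_real (x ^ m) \<partial>leb L) - c * (\<integral>x. of_real (x ^ m) \<partial>leb L)"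
    proof -
      have "integrable (leb L) (\<lambda>x. complex_of_real (x ^ m))"
        by (intro continuous_imp_integrable_real continuous_intros)
      then show ?thesis unfolding left_diff_distrib using hm by simp
    qed
    ultimately show ?thesis using L by (simp add: c_def field_simps)
  qed
  have "AE x in leb L. h x - c = 0"
    by (rule AE_zero_if_moments_zero[of L _ "\<lambda>x. x"])
       (use h orth in \<open>auto intro!: continuous_intros inj_onI\<close>)
  then show ?thesis by (intro exI[of _ c]) simp
qed

lemma weak_deriv_indefinite:
  assumes "0 \<le> L" and g: "integrable (leb L) g"
  shows "weak_deriv L (\<lambda>x. \<integral>y. g y \<partial>leb x) g"
  unfolding weak_deriv_def
proof (intro allI impI)
  fix \<phi> \<phi>' assume C: "C1c {0<..<L} \<phi> \<phi>'"
  then have d: "(\<phi> has_real_derivative \<phi>' x) (at x)" for x by (simp add: C1c_def)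
  have "\<phi> L = 0" using C1c_outside[OF C] by auto
  have "(\<integral>x. g x * of_real (\<phi> x) \<partial>leb L) = (\<integral>y. g y \<partial>leb L) * of_real (\<phi> L) -
      (\<integral>x. (\<integral>y. g y \<partial>leb x) * of_real (\<phi>' x) \<partial>leb L)"
  proof (rule integral_by_parts_indefinite[OF assms])
    show "((\<lambda>x. complex_of_real (\<phi> x)) has_vector_derivative of_real (\<phi>' x)) (at x within {0..L})" for x
      using d[of x, THEN has_field_derivative_at_within, of "{0..L}"]
      by (intro has_vector_derivative_of_real)
    show "continuous_on {0..L} (\<lambda>x. complex_of_real (\<phi>' x))"
      by (intro continuous_intros C1c_continuous[OF C])
  qed
  then show "(\<integral>x. (\<integral>y. g y \<partial>leb x) * of_real (\<phi>' x) \<partial>leb L) = - (\<integral>x. g x * of_real (\<phi> x) \<partial>leb L)"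
    using \<open>\<phi> L = 0\<close> by simp
qed

lemma integrable_mult_C1c:
  assumes "C1c S \<phi> \<phi>'" "integrable (leb L) (f :: real \<Rightarrow> complex)"
  shows "integrable (leb L) (\<lambda>x. f x * of_real (\<phi> x))" "integrable (leb L) (\<lambda>x. f x * of_real (\<phi>' x))"
  by (intro integrable_mult_continuous assms(2) continuous_intros C1c_continuous[OF assms(1)])+

lemma weak_deriv_diff:
  assumes "integrable (leb L) f" "integrable (leb L) f'" "integrable (leb L) g" "integrable (leb L) g'"
    and "weak_deriv L f f'" "weak_deriv L g g'"
  shows "weak_deriv L (\<lambda>x. f x - g x) (\<lambda>x. f' x - g' x)"
  using assms(5,6) unfolding weak_deriv_def left_diff_distrib
  by (simp add: integrable_mult_C1c[OF _ assms(1)] integrable_mult_C1c[OF _ assms(2)]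
      integrable_mult_C1c[OF _ assms(3)] integrable_mult_C1c[OF _ assms(4)])

lemma weak_deriv_cong:
  assumes "AE x in leb L. f x = g x" "integrable (leb L) f" "integrable (leb L) g" "weak_deriv L f f'"
  shows "weak_deriv L g f'"
  unfolding weak_deriv_def
proof (intro allI impI)
  fix \<phi> \<phi>' assume C: "C1c {0<..<L} \<phi> \<phi>'"
  have "(\<integral>x. g x * of_real (\<phi>' x) \<partial>leb L) = (\<integral>x. f x * of_real (\<phi>' x) \<partial>leb L)"
    using assms(1) integrable_mult_C1c(2)[OF C assms(2)] integrable_mult_C1c(2)[OF C assms(3)]
    by (intro integral_cong_AE) (auto elim: eventually_mono)
  then show "(\<integral>x. g x * of_real (\<phi>' x) \<partial>leb L) = - (\<integral>x. f' x * of_real (\<phi> x) \<partial>leb L)"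
    using assms(4) C by (simp add: weak_deriv_def)
qed

text \<open>The lemma of du Bois-Reymond: subtracting the primitive of \<open>g\<close> leaves a
  function with zero weak derivative. The right-hand side is the continuous representative of
  \<open>f\<close>.\<close>

lemma weak_deriv_rep:
  assumes L: "L > 0" and f: "integrable (leb L) f" and g: "integrable (leb L) g" and w: "weak_deriv L f g"
  shows "\<exists>c. AE x in leb L. f x = c + (\<integral>y. g y \<partial>leb x)"
proof -
  have G: "integrable (leb L) (\<lambda>x. \<integral>y. g y \<partial>leb x)"
    by (intro continuous_imp_integrable_real indefinite_integral_continuous_real g)
  have "weak_deriv L (\<lambda>x. f x - (\<integral>y. g y \<partial>leb x)) (\<lambda>x. g x - g x)"
    using L by (intro weak_deriv_diff f g G w weak_deriv_indefinite) auto
  then have "weak_deriv L (\<lambda>x. f x - (\<integral>y. g y \<partial>leb x)) (\<lambda>_. 0)" by simp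
  with weak_deriv_zero_imp_const[OF L Bochner_Integration.integrable_diff[OF f G]]
  obtain c where "AE x in leb L. f x - (\<integral>y. g y \<partial>leb x) = c" by blast
  then show ?thesis by (intro exI[of _ c]) (auto elim: eventually_mono)
qed

lemma integral_leb_zero [simp]: "(\<integral>y. f y \<partial>leb 0) = (0::complex)"
  by (rule integral_eq_zero_null_sets) (auto simp: null_sets_restrict_space)

text \<open>Test functions vanish near the ends, so monomials cannot be inserted directly. The
  primitive of the difference has weak derivative zero and vanishes at 0, hence vanishes
  identically; integration by parts against x^n then kills all moments of the difference.\<close>

lemma weak_deriv_unique:
  assumes L: "L > 0" and f: "integrable (leb L) f" and g: "integrable (leb L) g1" "integrable (leb L) g2"
    and w: "weak_deriv L f g1" "weak_deriv L f g2"
  shows "AE x in leb L. g1 x = g2 x"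
proof -
  define g where "g x = g1 x - g2 x" for x
  define G where "G x = (\<integral>y. g y \<partial>leb x)" for x
  have gi: "integrable (leb L) g" unfolding g_def using g by simp
  have cG: "continuous_on {0..L} G" unfolding G_def by (rule indefinite_integral_continuous_real[OF gi])
  have "weak_deriv L (\<lambda>x. f x - f x) (\<lambda>x. g1 x - g2 x)" by (intro weak_deriv_diff f g w)
  then have "weak_deriv L (\<lambda>_. 0) g" by (simp add: g_def[abs_def])
  then have "weak_deriv L G (\<lambda>_. 0)"
    using weak_deriv_indefinite[OF less_imp_le[OF L] gi] by (simp add: weak_deriv_def G_def)
  then obtain c where c: "AE x in leb L. G x = c"
    using weak_deriv_zero_imp_const[OF L continuous_imp_integrable_real[OF cG]] by blast
  have "G x = c" if "x \<in> {0..L}" for x using AE_eq_continuous[OF L cG continuous_on_const c that] .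
  moreover have "G 0 = 0" unfolding G_def by (rule integral_leb_zero)
  ultimately have G0: "G x = 0" if "x \<in> {0..L}" for x using that L by fastforce
  have "(\<integral>x. g x * of_real (x ^ n) \<partial>leb L) = 0" for n
  proof -
    have "(\<integral>x. g x * of_real (x ^ n) \<partial>leb L) = G L * of_real (L ^ n) -
        (\<integral>x. G x * of_real (real n * x ^ (n - 1)) \<partial>leb L)"
      unfolding G_def using L
      by (intro integral_by_parts_indefinite gi has_vector_derivative_of_real continuous_intros)
         (auto intro!: derivative_eq_intros)
    also have "(\<integral>x. G x * of_real (real n * x ^ (n - 1)) \<partial>leb L) = (\<integral>x. 0 \<partial>leb L)"
      by (intro Bochner_Integration.integral_cong refl) (simp add: G0)
    finally show ?thesis using G0[of L] L by simp
  qed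
  then have "AE x in leb L. g x = 0"
    by (intro AE_zero_if_moments_zero[of L _ "\<lambda>x. x"] gi) (auto intro!: continuous_intros inj_onI)
  then show ?thesis by (simp add: g_def)
qed

section \<open>Point values and integration by parts in \<open>H1_left\<close>\<close>

lemma trace_at_eq:
  assumes L: "L > 0" and F: "continuous_on {0..L} F" "eq_ae L f F" and p: "p \<in> {0..L}"
  shows "trace_at L f p = F p"
  unfolding trace_at_def
proof (rule the_equality)
  show "\<exists>g. continuous_on {0..L} g \<and> eq_ae L f g \<and> g p = F p" using F by blast
  fix c assume "\<exists>g. continuous_on {0..L} g \<and> eq_ae L f g \<and> g p = c"
  then obtain g where g: "continuous_on {0..L} g" "eq_ae L f g" "g p = c" by blast
  have "eq_ae L F g" using F(2) g(2) eq_ae_sym eq_ae_trans by blast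
  then show "c = F p" using AE_eq_continuous[OF L F(1) g(1) _ p] g(3) by (simp add: eq_ae_def)
qed

lemma sobolev1_iff: "f \<in> sobolev L 1 \<longleftrightarrow> f \<in> L2 L \<and> (\<exists>g\<in>L2 L. weak_deriv L f g)"
  by simp

lemma sobolev_norm1: "sobolev_norm L 1 f = sqrt ((norm2 L f)\<^sup>2 + (norm2 L (wderiv L f))\<^sup>2)"
  by simp

lemma wderiv_props:
  assumes "f \<in> sobolev L 1"
  shows "f \<in> L2 L" "wderiv L f \<in> L2 L" "weak_deriv L f (wderiv L f)"
proof -
  show "f \<in> L2 L" using assms by simp
  have "\<exists>g. g \<in> L2 L \<and> weak_deriv L f g" using assms by auto
  from someI_ex[OF this] show "wderiv L f \<in> L2 L" "weak_deriv L f (wderiv L f)" by (auto simp: wderiv_def)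
qed

lemma wderiv_eq:
  assumes "L > 0" "f \<in> L2 L" "g \<in> L2 L" "weak_deriv L f g"
  shows "eq_ae L (wderiv L f) g"
proof -
  have "f \<in> sobolev L 1" using assms by auto
  from wderiv_props[OF this] show ?thesis
    unfolding eq_ae_def using assms by (intro weak_deriv_unique[where f=f] L2_integrable)
qed

lemma H1_left_rep:
  assumes L: "L > 0" and f: "f \<in> H1_left L"
  shows "AE x in leb L. f x = (\<integral>y. wderiv L f y \<partial>leb x)" "trace_at L f L = (\<integral>y. wderiv L f y \<partial>leb L)"
proof -
  have s: "f \<in> sobolev L 1" and t: "trace_at L f 0 = 0" using f unfolding H1_left_def by auto
  note w = wderiv_props[OF s]
  obtain c where c: "AE x in leb L. f x = c + (\<integral>y. wderiv L f y \<partial>leb x)"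
    using weak_deriv_rep[OF L L2_integrable[OF w(1)] L2_integrable[OF w(2)] w(3)] by blast
  have cont: "continuous_on {0..L} (\<lambda>x. c + (\<integral>y. wderiv L f y \<partial>leb x))"
    by (intro continuous_intros indefinite_integral_continuous_real L2_integrable w)
  have "trace_at L f 0 = c + (\<integral>y. wderiv L f y \<partial>leb 0)"
    using c L by (intro trace_at_eq[OF L cont]) (auto simp: eq_ae_def)
  then have "c = 0" unfolding integral_leb_zero using t by simp
  then show "AE x in leb L. f x = (\<integral>y. wderiv L f y \<partial>leb x)" using c by simp
  then show "trace_at L f L = (\<integral>y. wderiv L f y \<partial>leb L)"
    using trace_at_eq[OF L cont, of f L] \<open>c = 0\<close> L by (simp add: eq_ae_def)
qed

text \<open>There is no boundary term at 0, where \<open>f\<close> vanishes. The one kept at L is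
  the term that later meets the feedback.\<close>

lemma H1_left_integral_by_parts:
  assumes L: "L > 0" and f: "f \<in> H1_left L"
    and d: "\<And>x. x \<in> {0..L} \<Longrightarrow> (\<phi> has_vector_derivative \<phi>' x) (at x within {0..L})"
    and c: "continuous_on {0..L} \<phi>'"
  shows "(\<integral>x. wderiv L f x * \<phi> x \<partial>leb L) = trace_at L f L * \<phi> L - (\<integral>x. f x * \<phi>' x \<partial>leb L)"
proof -
  have s: "f \<in> sobolev L 1" using f unfolding H1_left_def by auto
  note w = wderiv_props[OF s]
  have "(\<integral>x. wderiv L f x * \<phi> x \<partial>leb L) = (\<integral>y. wderiv L f y \<partial>leb L) * \<phi> L -
      (\<integral>x. (\<integral>y. wderiv L f y \<partial>leb x) * \<phi>' x \<partial>leb L)"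
    by (rule integral_by_parts_indefinite) (use L w d c L2_integrable in auto)
  also have "(\<integral>x. (\<integral>y. wderiv L f y \<partial>leb x) * \<phi>' x \<partial>leb L) = (\<integral>x. f x * \<phi>' x \<partial>leb L)"
  proof (rule integral_cong_AE)
    show "AE x in leb L. (\<integral>y. wderiv L f y \<partial>leb x) * \<phi>' x = f x * \<phi>' x"
      using H1_left_rep(1)[OF L f] by (rule eventually_mono) simp
  qed (intro borel_measurable_times L2_measurable[OF w(1)] continuous_borel_measurable_leb[OF c]
      continuous_borel_measurable_leb[OF indefinite_integral_continuous_real] L2_integrable w(2))+
  finally show ?thesis by (simp add: H1_left_rep(2)[OF L f])
qed

lemma weak_deriv_C1:
  assumes L: "0 \<le> L"
    and d: "\<And>x. x \<in> {0..L} \<Longrightarrow> (F has_vector_derivative F' x) (at x within {0..L})"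
    and c: "continuous_on {0..L} F'"
  shows "weak_deriv L F F'"
  unfolding weak_deriv_def
proof (intro allI impI)
  have cF: "continuous_on {0..L} F" by (rule continuous_on_vector_derivative[OF d])
  have iF': "integrable (leb L) F'" by (rule continuous_imp_integrable_real[OF c])
  fix \<phi> \<phi>' assume C: "C1c {0<..<L} \<phi> \<phi>'"
  have z: "\<phi> L = 0" "\<phi> 0 = 0" using C1c_outside[OF C] by auto
  have d\<phi>: "(\<phi> has_field_derivative \<phi>' x) (at x)" for x using C by (simp add: C1c_def)
  note c\<phi> = C1c_continuous[OF C]
  have "(\<integral>x. F x * of_real (\<phi>' x) + F' x * of_real (\<phi> x) \<partial>leb L) = F L * of_real (\<phi> L) - F 0 * of_real (\<phi> 0)"
  proof (rule integral_leb_derivative[where f="\<lambda>x. F x * of_real (\<phi> x)"])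
    show "((\<lambda>x. F x * of_real (\<phi> x)) has_vector_derivative F x * of_real (\<phi>' x) + F' x * of_real (\<phi> x)) (at x within {0..L})"
      if "x \<in> {0..L}" for x
      by (rule has_vector_derivative_mult[OF d[OF that]
            has_vector_derivative_of_real[OF has_field_derivative_at_within[OF d\<phi>]]])
    show "continuous_on {0..L} (\<lambda>x. F x * of_real (\<phi>' x) + F' x * of_real (\<phi> x))"
      by (intro continuous_intros cF c c\<phi>)
  qed (use L in simp)
  then show "(\<integral>x. F x * of_real (\<phi>' x) \<partial>leb L) = - (\<integral>x. F' x * of_real (\<phi> x) \<partial>leb L)"
    using integrable_mult_C1c[OF C] iF' continuous_imp_integrable_real[OF cF] z
    by (simp add: add_eq_0_iff2)
qed

lemma C1_sobolev:
  assumes L: "L > 0" and f: "f \<in> L2 L" "eq_ae L f F"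
    and d: "\<And>x. x \<in> {0..L} \<Longrightarrow> (F has_vector_derivative F' x) (at x within {0..L})"
    and c: "continuous_on {0..L} F'"
  shows "f \<in> sobolev L 1" "eq_ae L (wderiv L f) F'" "F 0 = 0 \<Longrightarrow> f \<in> H1_left L"
    "p \<in> {0..L} \<Longrightarrow> trace_at L f p = F p"
proof -
  have cF: "continuous_on {0..L} F" by (rule continuous_on_vector_derivative[OF d])
  have w: "weak_deriv L f F'"
    by (rule weak_deriv_cong[OF _ _ _ weak_deriv_C1[OF less_imp_le[OF L] d c]])
       (use eq_ae_sym[OF f(2)] L2_integrable[OF f(1)] continuous_imp_integrable_real[OF cF] in \<open>auto simp: eq_ae_def\<close>)
  show s: "f \<in> sobolev L 1" using w f(1) L2_continuous[OF c] by auto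
  show "eq_ae L (wderiv L f) F'" by (rule wderiv_eq[OF L f(1) L2_continuous[OF c] w])
  show t: "trace_at L f p = F p" if "p \<in> {0..L}" for p by (rule trace_at_eq[OF L cF f(2) that])
  show "f \<in> H1_left L" if "F 0 = 0" using s t[of 0] that L by (simp add: H1_left_def)
qed

subsection \<open>The eigenfunctions\<close>

definition freq :: "real \<Rightarrow> nat \<Rightarrow> real" where
  "freq L j = (2 * real j - 1) * pi / (2 * L)"

definition eigenfun_deriv :: "real \<Rightarrow> nat \<Rightarrow> real \<Rightarrow> complex" where
  "eigenfun_deriv L j x = of_real (sqrt (2 / L) * freq L j * cos (freq L j * x))"

lemma eigenfun_freq: "eigenfun L j x = of_real (sqrt (2 / L) * sin (freq L j * x))"
  by (simp add: eigenfun_def freq_def)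

lemma eigenval_freq: "eigenval L j = (freq L j)\<^sup>2"
  by (simp add: eigenval_def freq_def power_mult_distrib power_divide)

lemma freq_pos: "L > 0 \<Longrightarrow> j > 0 \<Longrightarrow> freq L j > 0"
  by (simp add: freq_def)

lemma eigenval_pos: "L > 0 \<Longrightarrow> j > 0 \<Longrightarrow> eigenval L j > 0"
  using freq_pos[of L j] by (simp add: eigenval_freq)

lemma eigenval_eq: "eigenval L j = (2 * real j - 1)\<^sup>2 * eigenval L 1"
  by (simp add: eigenval_def power_divide)

lemma eigenval_mono:
  assumes "0 < i" "i \<le> j" shows "eigenval L i \<le> eigenval L j"
proof -
  have "(2 * real i - 1)\<^sup>2 \<le> (2 * real j - 1)\<^sup>2" using assms by (intro power_mono) auto
  then show ?thesis
    unfolding eigenval_eq[of L i] eigenval_eq[of L j] by (rule mult_right_mono) (simp add: eigenval_freq)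
qed

lemma eigenval_inj:
  assumes "L > 0" "0 < i" "0 < j" "eigenval L i = eigenval L j" shows "i = j"
proof -
  have "freq L i = freq L j"
    using assms freq_pos[of L i] freq_pos[of L j] by (simp add: eigenval_freq power2_eq_iff_nonneg)
  then show ?thesis using assms(1) by (simp add: freq_def)
qed

lemma eigenfun_vector_derivative:
  "(eigenfun L j has_vector_derivative eigenfun_deriv L j x) (at x within S)"
  unfolding eigenfun_freq[abs_def] eigenfun_deriv_def
  by (rule has_vector_derivative_of_real) (auto intro!: derivative_eq_intros)

lemma eigenfun_deriv_vector_derivative:
  "(eigenfun_deriv L j has_vector_derivative - of_real (eigenval L j) * eigenfun L j x) (at x within S)"
proof -
  have "((\<lambda>x. complex_of_real (sqrt (2 / L) * freq L j * cos (freq L j * x))) has_vector_derivative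
      of_real (- (eigenval L j * (sqrt (2 / L) * sin (freq L j * x))))) (at x within S)"
    by (rule has_vector_derivative_of_real) (auto intro!: derivative_eq_intros simp: eigenval_freq power2_eq_square)
  then show ?thesis by (simp add: eigenfun_deriv_def[abs_def] eigenfun_freq)
qed

lemma continuous_on_eigenfun: "continuous_on S (eigenfun L j)"
  unfolding eigenfun_freq[abs_def] by (intro continuous_intros)

lemma continuous_on_eigenfun_deriv: "continuous_on S (eigenfun_deriv L j)"
  unfolding eigenfun_deriv_def[abs_def] by (intro continuous_intros)

lemma eigenfun_L2 [simp]: "eigenfun L j \<in> L2 L"
  by (rule L2_continuous[OF continuous_on_eigenfun])

lemma eigenfun_deriv_L2 [simp]: "eigenfun_deriv L j \<in> L2 L"
  by (rule L2_continuous[OF continuous_on_eigenfun_deriv])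

lemma cnj_eigenfun [simp]: "cnj (eigenfun L j x) = eigenfun L j x" "cnj (eigenfun_deriv L j x) = eigenfun_deriv L j x"
  by (simp_all add: eigenfun_def eigenfun_deriv_def)

lemma eigenfun_0 [simp]: "eigenfun L j 0 = 0"
  by (simp add: eigenfun_def)

lemma cos_freq_L:
  assumes "L > 0" shows "cos (freq L j * L) = 0"
proof -
  have "freq L j * L = real j * pi - pi / 2" using assms by (simp add: freq_def field_simps)
  then show ?thesis by (simp add: cos_diff)
qed

lemma eigenfun_deriv_L: "L > 0 \<Longrightarrow> eigenfun_deriv L j L = 0"
  by (simp add: eigenfun_deriv_def cos_freq_L)

lemma norm_eigenfun_le: "L > 0 \<Longrightarrow> norm (eigenfun L j x) \<le> sqrt (2 / L)"
  by (simp add: eigenfun_freq norm_mult abs_mult mult_left_le)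

lemma norm_eigenfun_deriv_le:
  assumes "L > 0" "j > 0" shows "norm (eigenfun_deriv L j x) \<le> sqrt (2 / L) * freq L j"
proof -
  have "norm (eigenfun_deriv L j x) = (sqrt (2 / L) * freq L j) * \<bar>cos (freq L j * x)\<bar>"
    using freq_pos[OF assms] assms by (simp add: eigenfun_deriv_def norm_mult abs_mult)
  also have "\<dots> \<le> (sqrt (2 / L) * freq L j) * 1"
    using freq_pos[OF assms] assms by (intro mult_left_mono) auto
  finally show ?thesis by simp
qed

lemma eigenfun_H1_left:
  assumes "L > 0"
  shows "eigenfun L j \<in> H1_left L" "eq_ae L (wderiv L (eigenfun L j)) (eigenfun_deriv L j)"
    "p \<in> {0..L} \<Longrightarrow> trace_at L (eigenfun L j) p = eigenfun L j p"
  using C1_sobolev[OF assms eigenfun_L2 eq_ae_refl eigenfun_vector_derivative continuous_on_eigenfun_deriv]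
  by auto

text \<open>Both boundary terms vanish, since \<open>f\<close> is zero at 0 and
  \<open>eigenfun_deriv L j\<close> is zero at L. Hence the coefficients of the derivative of
  \<open>f\<close> in the orthogonal system \<open>eigenfun_deriv\<close> are controlled by those of
  \<open>f\<close> itself.\<close>

lemma inner2_wderiv_eigenfun_deriv:
  assumes L: "L > 0" and f: "f \<in> H1_left L"
  shows "inner2 L (wderiv L f) (eigenfun_deriv L j) = of_real (eigenval L j) * inner2 L f (eigenfun L j)"
proof -
  have "(\<integral>x. wderiv L f x * eigenfun_deriv L j x \<partial>leb L) = trace_at L f L * eigenfun_deriv L j L -
      (\<integral>x. f x * (- of_real (eigenval L j) * eigenfun L j x) \<partial>leb L)"
    by (rule H1_left_integral_by_parts[OF L f eigenfun_deriv_vector_derivative])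
       (intro continuous_intros continuous_on_eigenfun)
  also have "(\<integral>x. f x * (- of_real (eigenval L j) * eigenfun L j x) \<partial>leb L) =
      (\<integral>x. - of_real (eigenval L j) * (f x * eigenfun L j x) \<partial>leb L)"
    by (intro Bochner_Integration.integral_cong) (auto simp: mult_ac)
  finally show ?thesis by (simp add: inner2_def eigenfun_deriv_L[OF L])
qed

lemma inner2_eigenfun_deriv:
  assumes "L > 0"
  shows "inner2 L (eigenfun_deriv L i) (eigenfun_deriv L j) = of_real (eigenval L j) * inner2 L (eigenfun L i) (eigenfun L j)"
proof -
  have "wderiv L (eigenfun L i) \<in> L2 L"
    using eigenfun_H1_left(1)[OF assms] wderiv_props unfolding H1_left_def by blast
  then have "inner2 L (wderiv L (eigenfun L i)) (eigenfun_deriv L j) = inner2 L (eigenfun_deriv L i) (eigenfun_deriv L j)"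
    by (intro inner2_cong eigenfun_H1_left assms) auto
  then show ?thesis
    using inner2_wderiv_eigenfun_deriv[OF assms eigenfun_H1_left(1)[OF assms]] by metis
qed

text \<open>Off the diagonal, \<open>inner2_eigenfun_deriv\<close> is applied in both orders: its
  left side is symmetric, so the inner product times the difference of the eigenvalues is zero. On
  the diagonal the double angle formula gives a primitive, whose sine term vanishes at L because
  \<open>cos (freq L i * L) = 0\<close>.\<close>

lemma eigenfun_orthonormal:
  assumes L: "L > 0" and ij: "0 < i" "0 < j"
  shows "inner2 L (eigenfun L i) (eigenfun L j) = (if i = j then 1 else 0)"
proof (cases "i = j")
  case False
  have real: "inner2 L (eigenfun L i) (eigenfun L j) = inner2 L (eigenfun L j) (eigenfun L i)"
    "inner2 L (eigenfun_deriv L i) (eigenfun_deriv L j) = inner2 L (eigenfun_deriv L j) (eigenfun_deriv L i)"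
    unfolding inner2_def by (simp_all add: mult.commute)
  have "of_real (eigenval L i - eigenval L j) * inner2 L (eigenfun L i) (eigenfun L j) = 0"
    using inner2_eigenfun_deriv[OF L, of i j] inner2_eigenfun_deriv[OF L, of j i] real
    by (simp add: left_diff_distrib)
  then show ?thesis using False eigenval_inj[OF L ij] by auto
next
  case True
  let ?c = "freq L i"
  have c: "?c > 0" by (rule freq_pos[OF L ij(1)])
  have "(\<integral>x. eigenfun L i x * eigenfun L i x \<partial>leb L) =
      (\<lambda>x. complex_of_real (x / L - sin (2 * ?c * x) / (2 * ?c * L))) L -
      (\<lambda>x. complex_of_real (x / L - sin (2 * ?c * x) / (2 * ?c * L))) 0"
  proof (rule integral_leb_derivative)
    show "((\<lambda>x. complex_of_real (x / L - sin (2 * ?c * x) / (2 * ?c * L))) has_vector_derivative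
        eigenfun L i x * eigenfun L i x) (at x within {0..L})" for x
    proof -
      have e: "eigenfun L i x * eigenfun L i x = of_real (2 / L * (sin (?c * x))\<^sup>2)"
      proof -
        have "sqrt (2 / L) * sin (?c * x) * (sqrt (2 / L) * sin (?c * x)) = (sqrt (2 / L))\<^sup>2 * (sin (?c * x))\<^sup>2"
          by (simp only: power2_eq_square mult_ac)
        then show ?thesis unfolding eigenfun_freq of_real_mult[symmetric] using L by simp
      qed
      have s: "2 / L * (sin (?c * x))\<^sup>2 = 1 / L - cos (2 * ?c * x) / L"
        using cos_double_sin[of "?c * x"] L by (simp add: field_simps)
      show ?thesis unfolding e s
        by (rule has_vector_derivative_of_real)
           (use c L in \<open>auto intro!: derivative_eq_intros simp: field_simps\<close>)
    qed
  qed (use L in \<open>auto intro!: continuous_on_mult continuous_on_eigenfun\<close>)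
  also have "\<dots> = 1"
    using L cos_freq_L[OF L, of i] sin_double[of "?c * L"] by (simp add: mult.assoc)
  finally show ?thesis using True by (simp add: inner2_def)
qed

lemma norm2_diff_sq:
  assumes f: "f \<in> L2 L" and g: "g \<in> L2 L"
  shows "(norm2 L (\<lambda>x. f x - g x))\<^sup>2 = (norm2 L f)\<^sup>2 - 2 * Re (inner2 L g f) + (norm2 L g)\<^sup>2"
proof -
  have fg: "(\<lambda>x. f x - g x) \<in> L2 L" by (rule L2_diff[OF f g])
  have r: "inner2 L h (\<lambda>x. f x - g x) = inner2 L h f - inner2 L h g" if "h \<in> L2 L" for h
    using inner2_diff_left[OF f g that] inner2_cnj[of L h] by (metis complex_cnj_diff)
  have "complex_of_real ((norm2 L (\<lambda>x. f x - g x))\<^sup>2) = inner2 L f f - inner2 L f g - (inner2 L g f - inner2 L g g)"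
    unfolding inner2_self[symmetric] inner2_diff_left[OF f g fg] by (simp add: r f g)
  also have "Re \<dots> = (norm2 L f)\<^sup>2 - 2 * Re (inner2 L g f) + (norm2 L g)\<^sup>2"
    using inner2_cnj[of L f g] by (simp add: inner2_self)
  finally show ?thesis by (simp only: Re_complex_of_real)
qed

lemma inner2_sum_right:
  assumes "\<And>i. i \<in> I \<Longrightarrow> f i \<in> L2 L" "h \<in> L2 L"
  shows "inner2 L h (\<lambda>x. \<Sum>i\<in>I. c i * f i x) = (\<Sum>i\<in>I. cnj (c i) * inner2 L h (f i))"
proof -
  have "inner2 L (\<lambda>x. \<Sum>i\<in>I. c i * f i x) h = (\<Sum>i\<in>I. c i * inner2 L (f i) h)"
    using inner2_sum_left[of I "\<lambda>i x. c i * f i x" L h] assms by (simp add: L2_cmult inner2_cmult_left)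
  then show ?thesis
    by (subst inner2_cnj) (simp add: inner2_cnj[of L h] )
qed

lemma norm2_eigenfun_sum:
  assumes "L > 0"
  shows "(norm2 L (\<lambda>x. \<Sum>j=1..n. a j * eigenfun L j x))\<^sup>2 = (\<Sum>j=1..n. (norm (a j))\<^sup>2)"
    and "(norm2 L (\<lambda>x. \<Sum>j=1..n. a j * eigenfun_deriv L j x))\<^sup>2 = (\<Sum>j=1..n. eigenval L j * (norm (a j))\<^sup>2)"
proof -
  have 1: "inner2 L (eigenfun L i) (\<lambda>x. \<Sum>j=1..n. a j * eigenfun L j x) = cnj (a i)" if "i \<in> {1..n}" for i
    using that assms
    by (subst inner2_sum_right) (auto simp: eigenfun_orthonormal if_distrib sum.delta cong: if_cong sum.cong_simp)
  have "inner2 L (\<lambda>x. \<Sum>j=1..n. a j * eigenfun L j x) (\<lambda>x. \<Sum>j=1..n. a j * eigenfun L j x) =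
      (\<Sum>i=1..n. inner2 L (\<lambda>x. a i * eigenfun L i x) (\<lambda>x. \<Sum>j=1..n. a j * eigenfun L j x))"
    by (intro inner2_sum_left L2_cmult L2_sum eigenfun_L2)
  also have "\<dots> = (\<Sum>i=1..n. a i * cnj (a i))"
    by (intro sum.cong refl) (simp only: inner2_cmult_left 1)
  also have "\<dots> = of_real (\<Sum>j=1..n. (norm (a j))\<^sup>2)" by (simp only: of_real_sum complex_norm_square)
  finally show "(norm2 L (\<lambda>x. \<Sum>j=1..n. a j * eigenfun L j x))\<^sup>2 = (\<Sum>j=1..n. (norm (a j))\<^sup>2)"
    unfolding inner2_self of_real_eq_iff .
  have 2: "inner2 L (eigenfun_deriv L i) (\<lambda>x. \<Sum>j=1..n. a j * eigenfun_deriv L j x) = of_real (eigenval L i) * cnj (a i)"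
    if "i \<in> {1..n}" for i
    using that assms
    by (subst inner2_sum_right) (auto simp: inner2_eigenfun_deriv eigenfun_orthonormal if_distrib sum.delta cong: if_cong sum.cong_simp)
  have "inner2 L (\<lambda>x. \<Sum>j=1..n. a j * eigenfun_deriv L j x) (\<lambda>x. \<Sum>j=1..n. a j * eigenfun_deriv L j x) =
      (\<Sum>i=1..n. inner2 L (\<lambda>x. a i * eigenfun_deriv L i x) (\<lambda>x. \<Sum>j=1..n. a j * eigenfun_deriv L j x))"
    by (intro inner2_sum_left L2_cmult L2_sum eigenfun_deriv_L2)
  also have "\<dots> = (\<Sum>i=1..n. of_real (eigenval L i) * (a i * cnj (a i)))"
    by (intro sum.cong refl) (simp only: inner2_cmult_left 2 mult_ac)
  also have "\<dots> = of_real (\<Sum>j=1..n. eigenval L j * (norm (a j))\<^sup>2)"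
    by (simp only: of_real_sum of_real_mult complex_norm_square)
  finally show "(norm2 L (\<lambda>x. \<Sum>j=1..n. a j * eigenfun_deriv L j x))\<^sup>2 = (\<Sum>j=1..n. eigenval L j * (norm (a j))\<^sup>2)"
    unfolding inner2_self of_real_eq_iff .
qed

text \<open>By \<open>inner2_wderiv_eigenfun_deriv\<close>, \<open>s\<close> is the orthogonal
  projection of the weak derivative onto the first n functions \<open>eigenfun_deriv\<close>, which
  have squared norms \<open>eigenval L j\<close>. What is used is that the squared distance to
  \<open>s\<close> is nonnegative.\<close>

lemma H1_left_Bessel:
  assumes L: "L > 0" and f: "f \<in> H1_left L"
  shows "(\<Sum>j=1..n. eigenval L j * (norm (inner2 L f (eigenfun L j)))\<^sup>2) \<le> (norm2 L (wderiv L f))\<^sup>2"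
proof -
  define b where "b j = inner2 L f (eigenfun L j)" for j
  define s where "s x = (\<Sum>j=1..n. b j * eigenfun_deriv L j x)" for x
  have w: "wderiv L f \<in> L2 L" using f wderiv_props unfolding H1_left_def by blast
  have s: "s \<in> L2 L" unfolding s_def by (intro L2_sum L2_cmult) simp
  have "inner2 L s (wderiv L f) = (\<Sum>j=1..n. inner2 L (\<lambda>x. b j * eigenfun_deriv L j x) (wderiv L f))"
    unfolding s_def by (intro inner2_sum_left L2_cmult eigenfun_deriv_L2 w)
  also have "\<dots> = (\<Sum>j=1..n. b j * cnj (inner2 L (wderiv L f) (eigenfun_deriv L j)))"
    by (intro sum.cong refl) (subst inner2_cmult_left, subst inner2_cnj, rule refl)
  also have "\<dots> = (\<Sum>j=1..n. of_real (eigenval L j) * (b j * cnj (b j)))"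
    unfolding inner2_wderiv_eigenfun_deriv[OF L f] by (simp add: b_def mult_ac)
  also have "\<dots> = of_real (\<Sum>j=1..n. eigenval L j * (norm (b j))\<^sup>2)"
    by (simp only: of_real_sum of_real_mult complex_norm_square)
  finally have "Re (inner2 L s (wderiv L f)) = (\<Sum>j=1..n. eigenval L j * (norm (b j))\<^sup>2)"
    by (simp only: Re_complex_of_real)
  moreover have "(norm2 L s)\<^sup>2 = (\<Sum>j=1..n. eigenval L j * (norm (b j))\<^sup>2)"
    unfolding s_def by (rule norm2_eigenfun_sum(2)[OF L])
  moreover have "0 \<le> (norm2 L (\<lambda>x. wderiv L f x - s x))\<^sup>2" by simp
  ultimately show ?thesis unfolding norm2_diff_sq[OF w s] b_def by simp
qed

text \<open>
  With \<open>\<theta> = \<pi> x / L\<close>, the span of the functions \<open>sin ((j - 1/2) \<theta>)\<close> contains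
  \<open>sin (\<theta>/2) cos (\<theta>)^n\<close>, and \<open>cos \<theta>\<close> is injective on the interval.
\<close>

lemma eigenfun_complete:
  assumes L: "L > 0" and f: "f \<in> L2 L" and orth: "\<And>j. 0 < j \<Longrightarrow> inner2 L f (eigenfun L j) = 0"
  shows "AE x in leb L. f x = 0"
proof -
  define C where "C x = cos (pi * x / L)" for x
  define S where "S j x = sin (freq L j * x)" for j x
  have fi: "integrable (leb L) f" by (rule L2_integrable[OF f])
  have cont: "continuous_on A C" "continuous_on A (S j)" for A j
    unfolding C_def S_def using L by (intro continuous_intros; simp)+
  \<comment> \<open>Index 0 is minus index 1, so the product formula below can be used down to j = 1
    without an exceptional case.\<close>
  have neg: "S 0 x = - S 1 x" for x by (simp add: S_def freq_def)
  have S0: "(\<integral>x. f x * of_real (S j x) \<partial>leb L) = 0" if "0 < j" for j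
  proof -
    have "0 = (\<integral>x. of_real (sqrt (2 / L)) * (f x * of_real (S j x)) \<partial>leb L)"
      using orth[OF that] by (simp add: inner2_def eigenfun_freq S_def mult_ac)
    also have "\<dots> = of_real (sqrt (2 / L)) * (\<integral>x. f x * of_real (S j x) \<partial>leb L)" by simp
    finally show ?thesis using L by simp
  qed
  have CS: "(\<integral>x. f x * of_real (C x ^ n * S j x) \<partial>leb L) = 0" for n j
  proof (induction n arbitrary: j)
    case 0
    show ?case
    proof (cases "j = 0")
      case True
      then show ?thesis using S0[of 1] by (simp add: neg)
    qed (use S0 in simp)
  next
    case (Suc n)
    have step: "(\<integral>x. f x * of_real (C x ^ Suc n * S j x) \<partial>leb L) = 0" if "0 < j" for j
    proof -
      \<comment> \<open>By the addition theorem, twice the product of cos \<theta> and sin ((j -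
        1/2) \<theta>) is the sum of the sines with indices j + 1 and j - 1. The subtraction of
        naturals is exact because 0 < j.\<close>
      have pt: "C x * S j x = (S (j + 1) x + S (j - 1) x) / 2" for x
      proof -
        have "freq L (j + 1) * x = freq L j * x + pi * x / L" "freq L (j - 1) * x = freq L j * x - pi * x / L"
          using L that by (simp_all add: freq_def of_nat_diff field_simps)
        then show ?thesis by (simp add: C_def S_def sin_add sin_diff)
      qed
      have i: "integrable (leb L) (\<lambda>x. f x * of_real (C x ^ n * S i x))" for i
        by (intro integrable_mult_continuous fi continuous_intros cont)
      have "(\<integral>x. f x * of_real (C x ^ Suc n * S j x) \<partial>leb L) =
          (\<integral>x. (f x * of_real (C x ^ n * S (j + 1) x) + f x * of_real (C x ^ n * S (j - 1) x)) / 2 \<partial>leb L)"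
      proof (intro Bochner_Integration.integral_cong refl)
        fix x
        have "C x ^ Suc n * S j x = C x ^ n * ((S (j + 1) x + S (j - 1) x) / 2)" unfolding pt[symmetric] by simp
        then show "f x * of_real (C x ^ Suc n * S j x) =
            (f x * of_real (C x ^ n * S (j + 1) x) + f x * of_real (C x ^ n * S (j - 1) x)) / 2"
          by (simp only: of_real_mult of_real_add of_real_divide of_real_numeral distrib_left add_divide_distrib times_divide_eq_right)
      qed
      also have "\<dots> = 0" using i Suc by simp
      finally show ?thesis .
    qed
    show ?case
    proof (cases "j = 0")
      case True
      have "(\<integral>x. f x * of_real (C x ^ Suc n * S 0 x) \<partial>leb L) = (\<integral>x. - (f x * of_real (C x ^ Suc n * S 1 x)) \<partial>leb L)"
        by (simp add: neg)
      then show ?thesis using True step[of 1] by simp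
    qed (use step in simp)
  qed
  have "AE x in leb L. f x * of_real (S 1 x) = 0"
  proof (rule AE_zero_if_moments_zero)
    show "integrable (leb L) (\<lambda>x. f x * of_real (S 1 x))"
      by (intro integrable_mult_continuous fi continuous_intros cont)
    show "continuous_on {0..L} C" by (rule cont)
    show "inj_on C {0..L}"
    proof (rule inj_onI)
      fix x y assume xy: "x \<in> {0..L}" "y \<in> {0..L}" "C x = C y"
      have b: "0 \<le> pi * z / L \<and> pi * z / L \<le> pi" if "z \<in> {0..L}" for z
        using that L by (simp add: pos_divide_le_eq)
      have "cos (pi * x / L) = cos (pi * y / L)" using xy(3) by (simp only: C_def)
      then have "pi * x / L = pi * y / L"
        using b[OF xy(1)] b[OF xy(2)] cos_inj_pi by blast
      then show "x = y" using L by simp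
    qed
    show "(\<integral>x. f x * of_real (S 1 x) * of_real (C x ^ n) \<partial>leb L) = 0" for n
      using CS[of n 1] by (simp add: mult_ac)
  qed
  moreover have "AE x in leb L. x \<noteq> 0"
    unfolding AE_leb_iff by (rule AE_I'[of "{0}"]) auto
  moreover have "AE x in leb L. x \<in> {0..L}" by (rule AE_I2) simp
  ultimately show ?thesis
  proof eventually_elim
    case (elim x)
    \<comment> \<open>The argument of the sine lies in (0, \<pi>/2], so this factor can be divided
      out.\<close>
    have "0 < S 1 x" unfolding S_def
    proof (rule sin_gt_zero)
      show "0 < freq L 1 * x" using elim L by (simp add: freq_def)
      have "freq L 1 * x \<le> pi / 2" using elim L by (simp add: freq_def field_simps)
      then show "freq L 1 * x < pi" using pi_gt_zero by linarith
    qed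
    then show ?case using elim by simp
  qed
qed

subsection \<open>The integral operator with the backstepping kernel\<close>

text \<open>Lebesgue measure is complete. This serves for integrands that are known only almost
  everywhere, such as those with the weak derivative of \<open>u t\<close> or with the derivative of
  \<open>k\<close> at the corner y = L.\<close>

lemma borel_measurable_lebesgue_on_cong_AE:
  fixes f g :: "real \<Rightarrow> 'a::euclidean_space"
  assumes S: "S \<in> sets lebesgue" and "f \<in> borel_measurable (lebesgue_on S)" "AE x in lebesgue_on S. f x = g x"
  shows "g \<in> borel_measurable (lebesgue_on S)"
proof -
  have "(\<lambda>x. if x \<in> S then g x else 0) \<in> borel_measurable lebesgue"
  proof (rule borel_measurable_AE)
    show "(\<lambda>x. if x \<in> S then f x else 0) \<in> borel_measurable lebesgue"
      by (subst borel_measurable_if) (use assms in simp_all)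
    show "AE x in lebesgue. (if x \<in> S then f x else 0) = (if x \<in> S then g x else 0)"
      using assms(3) S by (subst (asm) AE_restrict_space_iff) (auto elim!: eventually_mono)
  qed
  then show ?thesis by (subst (asm) borel_measurable_if) (use S in simp_all)
qed

lemma has_partials_curve:
  assumes f: "has_partials L f fx fy" and t: "t \<in> X"
    and c: "(c has_vector_derivative a) (at t within X)" "(d has_vector_derivative b) (at t within X)"
    and tri: "\<And>s. s \<in> X \<Longrightarrow> (c s, d s) \<in> triangle L"
  shows "((\<lambda>s. f (c s) (d s)) has_vector_derivative a *\<^sub>R fx (c t) (d t) + b *\<^sub>R fy (c t) (d t)) (at t within X)"
proof -
  have 1: "((\<lambda>s. (c s, d s)) has_derivative (\<lambda>h. (h *\<^sub>R a, h *\<^sub>R b))) (at t within X)"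
    using c by (intro has_derivative_Pair) (simp_all add: has_vector_derivative_def)
  have 2: "((\<lambda>p. f (fst p) (snd p)) has_derivative (\<lambda>h. fst h *\<^sub>R fx (c t) (d t) + snd h *\<^sub>R fy (c t) (d t)))
      (at (c t, d t) within (\<lambda>s. (c s, d s)) ` X)"
    by (rule has_derivative_subset[OF f[unfolded has_partials_def, rule_format, OF tri[OF t]]]) (use tri in auto)
  show ?thesis
    using has_derivative_in_compose[OF 1 2] by (simp add: has_vector_derivative_def scaleR_add_right)
qed

text \<open>For fixed s in [0, 1] the ray y = x s stays in the triangle for all x in [0, L],
  including the corner x = 0. This makes rays the right curves for differentiating integrals over
  [0, x].\<close>

lemma has_partials_ray:
  assumes f: "has_partials L f fx fy" and s: "s \<in> {0..1}" and x: "x \<in> {0..L}"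
  shows "((\<lambda>x. f x (x * s)) has_vector_derivative fx x (x * s) + s *\<^sub>R fy x (x * s)) (at x within {0..L})"
  using has_partials_curve[OF f x has_vector_derivative_id has_vector_derivative_mult_left[OF has_vector_derivative_id], of s] s
  by (simp add: triangle_def mult_left_le)

lemma has_partials_y:
  assumes f: "has_partials L f fx fy" and xy: "(x, y) \<in> triangle L"
  shows "(f x has_vector_derivative fy x y) (at y within {0..x})"
  using has_partials_curve[OF f _ has_vector_derivative_const has_vector_derivative_id, of y "{0..x}" x] xy
  by (auto simp: triangle_def)

lemma has_partials_x:
  assumes f: "has_partials L f fx fy" and xy: "(x, y) \<in> triangle L"
  shows "((\<lambda>x. f x y) has_vector_derivative fx x y) (at x within {y..L})"
  using has_partials_curve[OF f _ has_vector_derivative_id has_vector_derivative_const, of x "{y..L}" y] xy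
  by (auto simp: triangle_def)

lemma has_partials_cont:
  assumes "has_partials L f fx fy" shows "cont_triangle L f"
  unfolding cont_triangle_def
  by (rule has_derivative_continuous_on[where
        f'="\<lambda>p h. fst h *\<^sub>R fx (fst p) (snd p) + snd h *\<^sub>R fy (fst p) (snd p)"])
     (use assms in \<open>auto simp: has_partials_def\<close>)

lemma cont_triangle_mult:
  assumes "cont_triangle L f" "continuous_on UNIV e"
  shows "cont_triangle L (\<lambda>x y. f x y * e y)"
  using assms unfolding cont_triangle_def
  by (intro continuous_on_mult continuous_on_compose2[OF assms(2) continuous_on_snd]) auto

lemma has_partials_mult:
  assumes f: "has_partials L f fx fy" and e: "\<And>y. (e has_vector_derivative e' y) (at y)"
  shows "has_partials L (\<lambda>x y. f x y * e y) (\<lambda>x y. fx x y * e y) (\<lambda>x y. fy x y * e y + f x y * e' y)"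
  unfolding has_partials_def
proof (intro allI impI)
  fix x y assume xy: "(x, y) \<in> triangle L"
  have "((\<lambda>p. e (snd p)) has_derivative (\<lambda>h. snd h *\<^sub>R e' y)) (at (x, y) within triangle L)"
    using e[of y] by (auto intro!: has_derivative_compose[where g=e and f=snd, unfolded o_def] derivative_eq_intros
        simp: has_vector_derivative_def)
  from has_derivative_mult[OF f[unfolded has_partials_def, rule_format, OF xy] this]
  show "((\<lambda>p. f (fst p) (snd p) * e (snd p)) has_derivative
      (\<lambda>h. fst h *\<^sub>R (fx x y * e y) + snd h *\<^sub>R (fy x y * e y + f x y * e' y))) (at (x, y) within triangle L)"
    by (rule has_derivative_eq_rhs) (auto simp: algebra_simps)
qed

lemma cont_triangle_section:
  assumes "cont_triangle L g" "x \<in> {0..L}" shows "continuous_on {0..x} (g x)"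
proof -
  have "continuous_on {0..x} (\<lambda>y. (\<lambda>p. g (fst p) (snd p)) (x, y))"
    by (rule continuous_on_compose2[OF assms(1)[unfolded cont_triangle_def]])
       (use assms(2) in \<open>auto simp: triangle_def intro!: continuous_on_Pair\<close>)
  then show ?thesis by simp
qed

lemma cont_triangle_rays:
  assumes "cont_triangle L g"
  shows "continuous_on ({0..L} \<times> {0..1}) (\<lambda>(x, s). g x (x * s))"
proof -
  have "continuous_on ({0..L} \<times> {0..1}) (\<lambda>q. (\<lambda>p. g (fst p) (snd p)) (fst q, fst q * snd q))"
    by (rule continuous_on_compose2[OF assms(1)[unfolded cont_triangle_def]], intro continuous_intros)
       (auto simp: triangle_def mult_left_le)
  then show ?thesis by (simp add: case_prod_unfold)
qed

lemma cont_triangle_ray: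
  assumes "cont_triangle L g" "x \<in> {0..L}"
  shows "continuous_on {0..1} (\<lambda>s. g x (x * s))"
proof -
  have "continuous_on {0..1} (\<lambda>s. (\<lambda>(x, s). g x (x * s)) (x, s))"
    by (rule continuous_on_compose2[OF cont_triangle_rays[OF assms(1)]])
       (use assms(2) in \<open>auto intro!: continuous_on_Pair\<close>)
  then show ?thesis by simp
qed

lemma integral_ray:
  fixes g :: "real \<Rightarrow> real \<Rightarrow> complex"
  assumes g: "cont_triangle L g" and x: "x \<in> {0..L}"
  shows "(\<integral>y. g x y \<partial>leb x) = x *\<^sub>R integral {0..1} (\<lambda>s. g x (x * s))"
proof -
  have c: "continuous_on {0..x} (g x)" by (rule cont_triangle_section[OF g x])
  have "((\<lambda>s. x *\<^sub>R g x (x * s)) has_integral (integral {x * 0..x * 1} (g x))) {0..1}"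
    by (rule has_integral_substitution[OF _ _ _ c])
       (use x in \<open>auto intro!: derivative_eq_intros simp: mult_left_le\<close>)
  then have "x *\<^sub>R integral {0..1} (\<lambda>s. g x (x * s)) = integral {0..x} (g x)"
    by (drule_tac integral_unique) simp
  then show ?thesis using integral_leb_eq_integral[OF c] by simp
qed

text \<open>Leibniz's rule with a moving end point. Substituting y = x s makes the domain of
  integration fixed, at the cost of a factor x and of a derivative along the ray. Integrating the
  s-derivative of s f(x, x s) turns the surplus into the boundary value f x x. The degenerate point
  x = 0 is included.\<close>

lemma triangle_integral_derivative:
  fixes f :: "real \<Rightarrow> real \<Rightarrow> complex"
  assumes f: "has_partials L f fx fy" and c: "cont_triangle L fx" "cont_triangle L fy" and x: "x \<in> {0..L}"
  shows "((\<lambda>x. \<integral>y. f x y \<partial>leb x) has_vector_derivative f x x + (\<integral>y. fx x y \<partial>leb x)) (at x within {0..L})"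
proof -
  have cf: "cont_triangle L f" by (rule has_partials_cont[OF f])
  define g where "g x s = fx x (x * s) + s *\<^sub>R fy x (x * s)" for x s
  have G: "((\<lambda>x. integral (cbox 0 1) (\<lambda>s. f x (x * s))) has_vector_derivative integral (cbox 0 1) (g x)) (at x within {0..L})"
  proof (rule leibniz_rule_vector_derivative[OF _ _ _ x])
    show "((\<lambda>x. f x (x * s)) has_vector_derivative g x s) (at x within {0..L})" if "x \<in> {0..L}" "s \<in> cbox 0 1" for x s
      unfolding g_def using has_partials_ray[OF f] that by simp
    show "(\<lambda>s. f x (x * s)) integrable_on cbox 0 1" if "x \<in> {0..L}" for x
      using cont_triangle_ray[OF cf that] by (simp add: integrable_continuous_real)
    show "continuous_on ({0..L} \<times> cbox 0 1) (\<lambda>(x, s). g x s)"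
      using cont_triangle_rays[OF c(1)] cont_triangle_rays[OF c(2)]
      unfolding g_def case_prod_unfold by (intro continuous_intros) auto
  qed simp
  have int: "(\<lambda>s. f x (x * s)) integrable_on {0..1}" "(\<lambda>s. fx x (x * s)) integrable_on {0..1}"
     "(\<lambda>s. s *\<^sub>R fy x (x * s)) integrable_on {0..1}"
    by (intro integrable_continuous_real continuous_intros cont_triangle_ray[OF cf x] cont_triangle_ray[OF c(1) x]
        cont_triangle_ray[OF c(2) x])+
  have "((\<lambda>s. f x (x * s) + s *\<^sub>R x *\<^sub>R fy x (x * s)) has_integral (1 *\<^sub>R f x (x * 1) - 0 *\<^sub>R f x (x * 0))) {0..1}"
  proof (rule fundamental_theorem_of_calculus)
    fix s :: real assume s: "s \<in> {0..1}"
    have xs: "(x, x * s) \<in> triangle L" using x s by (auto simp: triangle_def mult_left_le)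
    have im: "(\<lambda>s. x * s) ` {0..1} \<subseteq> {0..x}" using x by (auto simp: mult_left_le)
    have 1: "((\<lambda>s. x * s) has_vector_derivative x) (at s within {0..1})"
      by (auto intro!: derivative_eq_intros simp flip: has_real_derivative_iff_has_vector_derivative)
    have 2: "((\<lambda>s. f x (x * s)) has_vector_derivative x *\<^sub>R fy x (x * s)) (at s within {0..1})"
      using vector_diff_chain_within[OF 1 has_vector_derivative_within_subset[OF has_partials_y[OF f xs] im]]
      by (simp add: o_def)
    show "((\<lambda>s. s *\<^sub>R f x (x * s)) has_vector_derivative f x (x * s) + s *\<^sub>R x *\<^sub>R fy x (x * s)) (at s within {0..1})"
      using has_vector_derivative_scaleR[OF DERIV_ident 2] by (simp add: add.commute)
  qed simp
  then have I: "integral {0..1} (\<lambda>s. f x (x * s) + s *\<^sub>R x *\<^sub>R fy x (x * s)) = f x x" by (simp add: integral_unique)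
  have "((\<lambda>x. x *\<^sub>R integral {0..1} (\<lambda>s. f x (x * s))) has_vector_derivative
      x *\<^sub>R integral {0..1} (g x) + 1 *\<^sub>R integral {0..1} (\<lambda>s. f x (x * s))) (at x within {0..L})"
    using has_vector_derivative_scaleR[OF DERIV_ident G] by simp
  moreover have "x *\<^sub>R integral {0..1} (g x) + 1 *\<^sub>R integral {0..1} (\<lambda>s. f x (x * s)) = f x x + (\<integral>y. fx x y \<partial>leb x)"
  proof -
    have "integral {0..1} (g x) = integral {0..1} (\<lambda>s. fx x (x * s)) + integral {0..1} (\<lambda>s. s *\<^sub>R fy x (x * s))"
      unfolding g_def using int by (intro Henstock_Kurzweil_Integration.integral_add)
    moreover have "f x x = integral {0..1} (\<lambda>s. f x (x * s)) + x *\<^sub>R integral {0..1} (\<lambda>s. s *\<^sub>R fy x (x * s))"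
    proof -
      have "f x x = integral {0..1} (\<lambda>s. f x (x * s) + x *\<^sub>R s *\<^sub>R fy x (x * s))"
        unfolding I[symmetric] by (simp add: mult.commute)
      also have "\<dots> = integral {0..1} (\<lambda>s. f x (x * s)) + integral {0..1} (\<lambda>s. x *\<^sub>R s *\<^sub>R fy x (x * s))"
        using int by (intro Henstock_Kurzweil_Integration.integral_add integrable_cmul)
      finally show ?thesis by (simp only: integral_cmul)
    qed
    ultimately show ?thesis by (simp add: integral_ray[OF c(1) x] scaleR_add_right)
  qed
  ultimately have "((\<lambda>x. x *\<^sub>R integral {0..1} (\<lambda>s. f x (x * s))) has_vector_derivative f x x + (\<integral>y. fx x y \<partial>leb x)) (at x within {0..L})"
    by simp
  then show ?thesis
    by (rule has_vector_derivative_transform[OF x, rotated]) (simp add: integral_ray[OF cf])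
qed

section \<open>Images of the eigenfunctions under the kernel operator\<close>

definition kernel_int :: "real \<Rightarrow> (real \<Rightarrow> real \<Rightarrow> complex) \<Rightarrow> nat \<Rightarrow> real \<Rightarrow> complex" where
  "kernel_int L k m x = (\<integral>y. k x y * eigenfun L m y \<partial>leb x)"

text \<open>Taken as a \<open>vector_derivative\<close> because the partial derivatives of
  \<open>k\<close> are existentially bound in \<open>kernel_solution\<close>, so an explicit formula
  is available only inside the next proof.\<close>

definition kernel_int_deriv :: "real \<Rightarrow> (real \<Rightarrow> real \<Rightarrow> complex) \<Rightarrow> nat \<Rightarrow> real \<Rightarrow> complex" where
  "kernel_int_deriv L k m x = vector_derivative (kernel_int L k m) (at x within {0..L})"

text \<open>Differentiating twice in x produces the integral of k_xx against the eigenfunction and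
  diagonal terms. The kernel equation trades k_xx for k_yy, and two integrations by parts in y move
  both derivatives onto the eigenfunction, where they give minus the eigenvalue. The derivative at L
  is the feedback functional evaluated at the eigenfunction; this turns the control into a finite
  sum of target modes times these numbers.\<close>

lemma kernel_int_derivatives:
  assumes L: "L > 0" and \<nu>: "\<nu> > 0" and k: "kernel_solution L \<nu> \<alpha> \<mu> k"
  defines "\<kappa> \<equiv> Complex \<nu> \<alpha>"
  shows "x \<in> {0..L} \<Longrightarrow> (kernel_int L k m has_vector_derivative kernel_int_deriv L k m x) (at x within {0..L})"
    and "x \<in> {0..L} \<Longrightarrow> (kernel_int_deriv L k m has_vector_derivative
      - (of_real \<mu> / \<kappa>) * eigenfun L m x - (of_real (eigenval L m) + of_real \<mu> / \<kappa>) * kernel_int L k m x) (at x within {0..L})"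
    and "kernel_int_deriv L k m L =
      (\<integral>y. vector_derivative (\<lambda>x. k x y) (at L within {y..L}) * eigenfun L m y \<partial>leb L)
        - of_real (\<mu> * L) / (2 * \<kappa>) * eigenfun L m L"
    and "x \<in> {0..L} \<Longrightarrow> continuous_on {0..x} (k x)"
    and "integrable (leb L) (\<lambda>y. vector_derivative (\<lambda>x. k x y) (at L within {y..L}) * eigenfun L m y)"
proof -
  have \<kappa>: "\<kappa> \<noteq> 0" using \<nu> by (simp add: \<kappa>_def complex_eq_iff)
  obtain kx ky kxx kxy kyx kyy where
    p: "has_partials L k kx ky" "has_partials L kx kxx kxy" "has_partials L ky kyx kyy"
    and c: "cont_triangle L kxx" "cont_triangle L kxy" "cont_triangle L kyx" "cont_triangle L kyy"
    and pde: "\<And>x y. (x, y) \<in> triangle L \<Longrightarrow> \<kappa> * (kxx x y - kyy x y) + of_real \<mu> * k x y = 0"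
    and k0: "\<And>x. x \<in> {0..L} \<Longrightarrow> k x 0 = 0"
    and kd: "\<And>x. x \<in> {0..L} \<Longrightarrow> k x x = - (of_real (\<mu> * x) / (2 * \<kappa>))"
    using k unfolding kernel_solution_def \<kappa>_def by blast
  note ck = has_partials_cont[OF p(1)] and ckx = has_partials_cont[OF p(2)] and cky = has_partials_cont[OF p(3)]
  show "continuous_on {0..x} (k x)" if "x \<in> {0..L}" by (rule cont_triangle_section[OF ck that])
  let ?e = "eigenfun L m" and ?e' = "eigenfun_deriv L m" and ?l = "complex_of_real (eigenval L m)"
  define d where "d = - of_real \<mu> / (2 * \<kappa>)"
  have kd': "k x x = of_real x * d" if "x \<in> {0..L}" for x using kd[OF that] by (simp add: d_def)
  have ce: "continuous_on UNIV ?e" "continuous_on UNIV ?e'"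
    by (rule continuous_on_eigenfun continuous_on_eigenfun_deriv)+
  note de = eigenfun_vector_derivative[of L m]
  note pm = has_partials_mult[OF p(1) de] has_partials_mult[OF p(2) de]
  have c_add: "cont_triangle L (\<lambda>x y. f x y + g x y)" if "cont_triangle L f" "cont_triangle L g" for f g
    using that unfolding cont_triangle_def by (rule continuous_on_add)
  define D1 where "D1 x = of_real x * d * ?e x + (\<integral>y. kx x y * ?e y \<partial>leb x)" for x
  have D: "(kernel_int L k m has_vector_derivative D1 x) (at x within {0..L})" if x: "x \<in> {0..L}" for x
    using triangle_integral_derivative[OF pm(1) cont_triangle_mult[OF ckx ce(1)]
        c_add[OF cont_triangle_mult[OF cky ce(1)] cont_triangle_mult[OF ck ce(2)]] x]
    by (simp add: kernel_int_def[abs_def] D1_def kd'[OF x])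
  have D1: "kernel_int_deriv L k m x = D1 x" if x: "x \<in> {0..L}" for x
    unfolding kernel_int_deriv_def
    by (rule vector_derivative_within_closed_interval[OF L x D[OF x]])
  show "(kernel_int L k m has_vector_derivative kernel_int_deriv L k m x) (at x within {0..L})" if x: "x \<in> {0..L}"
    using D[OF x] D1[OF x] by simp
  have dlin: "((\<lambda>x. of_real x * d) has_vector_derivative d) (at x within {0..L})" for x
    using has_vector_derivative_mult_left[OF has_vector_derivative_of_real[OF DERIV_ident[of "at x within {0..L}"]]] by simp
  \<comment> \<open>The diagonal is the ray s = 1, along which \<open>k\<close> is x d; the two
    expressions for its derivative are compared.\<close>
  have diag: "kx x x + ky x x = d" if x: "x \<in> {0..L}" for x
  proof -
    have "((\<lambda>x. k x (x * 1)) has_vector_derivative kx x (x * 1) + 1 *\<^sub>R ky x (x * 1)) (at x within {0..L})"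
      by (rule has_partials_ray[OF p(1) _ x]) simp
    then have "((\<lambda>x. of_real x * d) has_vector_derivative kx x x + ky x x) (at x within {0..L})"
      by (simp only: mult_1_right scaleR_one) (rule has_vector_derivative_transform[OF x, rotated], assumption, erule kd'[symmetric])
    moreover have "((\<lambda>x. of_real x * d) has_vector_derivative d) (at x within {0..L})"
      by (rule dlin)
    ultimately show ?thesis
      using L x by (intro vector_derivative_unique_within_closed_interval[of 0 L x]) simp_all
  qed
  \<comment> \<open>Green's formula in y for \<open>k\<close> and the eigenfunction. At y = 0 both
    boundary terms vanish, one by \<open>eigenfun_0\<close> and the other by the condition k x 0 =
    0.\<close>
  have ibp: "(\<integral>y. kyy x y * ?e y \<partial>leb x) = ky x x * ?e x - of_real x * d * ?e' x - ?l * kernel_int L k m x"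
    if x: "x \<in> {0..L}" for x
  proof -
    have "(\<integral>y. kyy x y * ?e y + ?l * (k x y * ?e y) \<partial>leb x) =
      (\<lambda>y. ky x y * ?e y - k x y * ?e' y) x - (\<lambda>y. ky x y * ?e y - k x y * ?e' y) 0"
    proof (rule integral_leb_derivative)
      fix y assume "y \<in> {0..x}"
      then have xy: "(x, y) \<in> triangle L" using x by (auto simp: triangle_def)
      show "((\<lambda>y. ky x y * ?e y - k x y * ?e' y) has_vector_derivative kyy x y * ?e y + ?l * (k x y * ?e y)) (at y within {0..x})"
        using has_vector_derivative_diff[OF
            has_vector_derivative_mult[OF has_partials_y[OF p(3) xy] eigenfun_vector_derivative]
            has_vector_derivative_mult[OF has_partials_y[OF p(1) xy] eigenfun_deriv_vector_derivative]]
        by (rule has_vector_derivative_eq_rhs) (simp add: algebra_simps)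
    next
      show "continuous_on {0..x} (\<lambda>y. kyy x y * ?e y + ?l * (k x y * ?e y))"
        by (intro continuous_intros cont_triangle_section[OF _ x] c ck continuous_on_eigenfun)
    qed (use x in simp)
    moreover have "integrable (leb x) (\<lambda>y. kyy x y * ?e y)" "integrable (leb x) (\<lambda>y. k x y * ?e y)"
      by (intro continuous_imp_integrable_real continuous_intros cont_triangle_section[OF _ x] c ck continuous_on_eigenfun)+
    ultimately have "(\<integral>y. kyy x y * ?e y \<partial>leb x) + ?l * kernel_int L k m x = ky x x * ?e x - k x x * ?e' x"
      using k0[OF x] by (simp add: kernel_int_def)
    then show ?thesis unfolding kd'[OF x] by (simp add: eq_diff_eq)
  qed
  have kxx: "(\<integral>y. kxx x y * ?e y \<partial>leb x) = (\<integral>y. kyy x y * ?e y \<partial>leb x) - of_real \<mu> / \<kappa> * kernel_int L k m x"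
    if x: "x \<in> {0..L}" for x
  proof -
    have "(\<integral>y. kxx x y * ?e y \<partial>leb x) = (\<integral>y. kyy x y * ?e y - of_real \<mu> / \<kappa> * (k x y * ?e y) \<partial>leb x)"
    proof (intro Bochner_Integration.integral_cong refl)
      fix y assume "y \<in> space (leb x)"
      then have "(x, y) \<in> triangle L" using x by (auto simp: triangle_def)
      from pde[OF this] have "kxx x y = kyy x y - of_real \<mu> / \<kappa> * k x y" using \<kappa> by (simp add: field_simps)
      then show "kxx x y * ?e y = kyy x y * ?e y - of_real \<mu> / \<kappa> * (k x y * ?e y)"
        by (simp only: left_diff_distrib mult.assoc)
    qed
    moreover have "integrable (leb x) (\<lambda>y. kyy x y * ?e y)" "integrable (leb x) (\<lambda>y. k x y * ?e y)"
      by (intro continuous_imp_integrable_real continuous_intros cont_triangle_section[OF _ x] c ck continuous_on_eigenfun)+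
    ultimately show ?thesis by (simp add: kernel_int_def)
  qed
  show "(kernel_int_deriv L k m has_vector_derivative
      - (of_real \<mu> / \<kappa>) * ?e x - (?l + of_real \<mu> / \<kappa>) * kernel_int L k m x) (at x within {0..L})" if x: "x \<in> {0..L}"
  proof -
    note 1 = dlin[of x]
    have 2: "((\<lambda>x. \<integral>y. kx x y * ?e y \<partial>leb x) has_vector_derivative kx x x * ?e x + (\<integral>y. kxx x y * ?e y \<partial>leb x)) (at x within {0..L})"
      by (rule triangle_integral_derivative[OF pm(2) cont_triangle_mult[OF c(1) ce(1)]
        c_add[OF cont_triangle_mult[OF c(2) ce(1)] cont_triangle_mult[OF ckx ce(2)]] x])
    have A: "(D1 has_vector_derivative (of_real x * d * ?e' x + d * ?e x) + (kx x x * ?e x + (\<integral>y. kxx x y * ?e y \<partial>leb x))) (at x within {0..L})"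
      unfolding D1_def[abs_def] by (intro has_vector_derivative_add 2 has_vector_derivative_mult 1 eigenfun_vector_derivative)
    have B: "(of_real x * d * ?e' x + d * ?e x) + (kx x x * ?e x + (\<integral>y. kxx x y * ?e y \<partial>leb x)) =
        - (of_real \<mu> / \<kappa>) * ?e x - (?l + of_real \<mu> / \<kappa>) * kernel_int L k m x"
    proof -
      have "(of_real x * d * ?e' x + d * ?e x) + (kx x x * ?e x + (\<integral>y. kxx x y * ?e y \<partial>leb x)) =
        (d + (kx x x + ky x x)) * ?e x - (?l + of_real \<mu> / \<kappa>) * kernel_int L k m x"
        unfolding kxx[OF x] ibp[OF x] by (simp add: algebra_simps)
      \<comment> \<open>One d comes from differentiating the factor x d in \<open>D1\<close>, the
        other from the two partials on the diagonal, and 2 d = - \<mu> / \<kappa>.\<close>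
      also have "d + (kx x x + ky x x) = - (of_real \<mu> / \<kappa>)"
        unfolding diag[OF x] using \<kappa> by (simp add: d_def field_simps)
      finally show ?thesis .
    qed
    show ?thesis using has_vector_derivative_transform[OF x D1 A] unfolding B .
  qed
  \<comment> \<open>At y = L the interval {y..L} is a single point and does not determine a
    one-sided derivative; the comparison with \<open>kx\<close> is made off this null set.\<close>
  have "AE y in leb L. y \<noteq> L" unfolding AE_leb_iff by (rule AE_I'[of "{L}"]) auto
  moreover have "AE y in leb L. y \<in> {0..L}" by (rule AE_I2) simp
  ultimately have ae: "AE y in leb L. kx L y * ?e y = vector_derivative (\<lambda>x. k x y) (at L within {y..L}) * ?e y"
  proof eventually_elim
    case (elim y)
    then have "(L, y) \<in> triangle L" by (auto simp: triangle_def)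
    from has_partials_x[OF p(1) this] have "vector_derivative (\<lambda>x. k x y) (at L within {y..L}) = kx L y"
      using elim by (intro vector_derivative_within_closed_interval) auto
    then show ?case by simp
  qed
  have i1: "integrable (leb L) (\<lambda>y. kx L y * ?e y)"
    by (intro continuous_imp_integrable_real continuous_intros cont_triangle_section[OF ckx] continuous_on_eigenfun) (use L in simp)
  note m1 = borel_measurable_integrable[OF i1]
  note m2 = borel_measurable_lebesgue_on_cong_AE[OF _ m1 ae, simplified]
  show "integrable (leb L) (\<lambda>y. vector_derivative (\<lambda>x. k x y) (at L within {y..L}) * ?e y)"
    using i1 integrable_cong_AE[OF m1 m2 ae] by simp
  have "(\<integral>y. kx L y * ?e y \<partial>leb L) = (\<integral>y. vector_derivative (\<lambda>x. k x y) (at L within {y..L}) * ?e y \<partial>leb L)"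
    by (rule integral_cong_AE[OF m1 m2 ae])
  then show "kernel_int_deriv L k m L =
      (\<integral>y. vector_derivative (\<lambda>x. k x y) (at L within {y..L}) * eigenfun L m y \<partial>leb L)
        - of_real (\<mu> * L) / (2 * \<kappa>) * eigenfun L m L"
    using D1[of L] L by (simp add: D1_def d_def)
qed

subsection \<open>The closed loop in modal coordinates\<close>

lemma sum_delta_1:
  fixes a :: "nat \<Rightarrow> complex"
  assumes "0 < j" shows "(\<Sum>m=1..N. (if m = j then 1 else 0) * a m) = (if j \<le> N then a j else 0)"
  using assms by (simp add: if_distrib[of "\<lambda>z. z * _"] sum.delta cong: if_cong)

locale closed_loop =
  fixes L \<nu> \<alpha> \<gamma> \<mu> :: real and k :: "real \<Rightarrow> real \<Rightarrow> complex" and N :: nat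
  assumes L: "L > 0" and \<nu>: "\<nu> > 0" and kernel: "kernel_solution L \<nu> \<alpha> \<mu> k"
    and trafo: "boundedly_invertible L 0 (trafo L k N)"
begin

abbreviation "e \<equiv> eigenfun L"
abbreviation "e' \<equiv> eigenfun_deriv L"
abbreviation "lam j \<equiv> complex_of_real (eigenval L j)"

definition \<kappa> :: complex where "\<kappa> = Complex \<nu> \<alpha>"
definition D :: "nat \<Rightarrow> real \<Rightarrow> complex" where "D = kernel_int L k"
definition D' :: "nat \<Rightarrow> real \<Rightarrow> complex" where "D' = kernel_int_deriv L k"
definition A :: "nat \<Rightarrow> nat \<Rightarrow> complex" where "A j m = inner2 L (D m) (e j)"
definition \<sigma> :: "nat \<Rightarrow> complex" where
  "\<sigma> j = \<kappa> * lam j - of_real \<gamma> + (if j \<le> N then of_real \<mu> else 0)"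

lemma \<kappa>_nz: "\<kappa> \<noteq> 0"
  using \<nu> by (simp add: \<kappa>_def complex_eq_iff)

lemma D_deriv: "x \<in> {0..L} \<Longrightarrow> (D m has_vector_derivative D' m x) (at x within {0..L})"
  unfolding D_def D'_def by (rule kernel_int_derivatives(1)[OF L \<nu> kernel])

lemma D'_deriv:
  "x \<in> {0..L} \<Longrightarrow> (D' m has_vector_derivative
      - (of_real \<mu> / \<kappa>) * e m x - (lam m + of_real \<mu> / \<kappa>) * D m x) (at x within {0..L})"
  unfolding D_def D'_def \<kappa>_def by (rule kernel_int_derivatives(2)[OF L \<nu> kernel])

lemma D_cont: "continuous_on {0..L} (D m)" "continuous_on {0..L} (D' m)"
  by (rule continuous_on_vector_derivative, erule D_deriv D'_deriv)+

lemma D_L2: "D m \<in> L2 L" "D' m \<in> L2 L"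
  by (simp_all add: L2_continuous D_cont)

lemma D_0: "D m 0 = 0"
  unfolding D_def kernel_int_def by (rule integral_leb_zero)

text \<open>
  Both sides are \<open>\<kappa>\<close> times the boundary term of Green's formula for \<open>D m\<close> and \<open>e j\<close>.
\<close>

lemma kernel_mode_identity:
  assumes "0 < j" "0 < m"
  shows "\<kappa> * D' m L * e j L = A j m * (\<kappa> * lam j - \<kappa> * lam m - of_real \<mu>) - (if m = j then of_real \<mu> else 0)"
proof -
  define D2 where "D2 x = - (of_real \<mu> / \<kappa>) * e m x - (lam m + of_real \<mu> / \<kappa>) * D m x" for x
  have cD2: "continuous_on {0..L} D2"
    unfolding D2_def by (intro continuous_intros D_cont continuous_on_eigenfun)
  have "(\<integral>x. D2 x * e j x + lam j * (D m x * e j x) \<partial>leb L) =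
      (\<lambda>x. D' m x * e j x - D m x * e' j x) L - (\<lambda>x. D' m x * e j x - D m x * e' j x) 0"
  proof (rule integral_leb_derivative)
    fix x assume x: "x \<in> {0..L}"
    show "((\<lambda>x. D' m x * e j x - D m x * e' j x) has_vector_derivative D2 x * e j x + lam j * (D m x * e j x)) (at x within {0..L})"
      using has_vector_derivative_diff[OF
          has_vector_derivative_mult[OF D'_deriv[OF x] eigenfun_vector_derivative]
          has_vector_derivative_mult[OF D_deriv[OF x] eigenfun_deriv_vector_derivative]]
      by (rule has_vector_derivative_eq_rhs) (simp add: D2_def algebra_simps)
  next
    show "continuous_on {0..L} (\<lambda>x. D2 x * e j x + lam j * (D m x * e j x))"
      by (intro continuous_intros cD2 D_cont continuous_on_eigenfun)
  qed (use L in simp)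
  \<comment> \<open>At L the derivative of \<open>e j\<close> vanishes, and at 0 both
    \<open>e j\<close> and \<open>D m\<close> do.\<close>
  also have "\<dots> = D' m L * e j L" by (simp add: eigenfun_deriv_L[OF L] D_0)
  also have "(\<integral>x. D2 x * e j x + lam j * (D m x * e j x) \<partial>leb L) = inner2 L D2 (e j) + lam j * A j m"
    unfolding A_def inner2_cmult_left[symmetric]
    using inner2_add_left[OF L2_continuous[OF cD2] L2_cmult[OF D_L2(1)] eigenfun_L2, of "lam j" m j]
    by (simp add: inner2_def algebra_simps)
  also have "inner2 L D2 (e j) = - (of_real \<mu> / \<kappa>) * inner2 L (e m) (e j) - (lam m + of_real \<mu> / \<kappa>) * A j m"
    unfolding A_def inner2_cmult_left[symmetric] D2_def
    by (rule inner2_diff_left) (intro L2_cmult D_L2 eigenfun_L2)+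
  finally have "D' m L * e j L = - (of_real \<mu> / \<kappa>) * (if m = j then 1 else 0) - (lam m + of_real \<mu> / \<kappa>) * A j m + lam j * A j m"
    by (simp only: eigenfun_orthonormal[OF L assms(2,1)])
  then have "\<kappa> * (D' m L * e j L) = \<kappa> * (- (of_real \<mu> / \<kappa>) * (if m = j then 1 else 0) - (lam m + of_real \<mu> / \<kappa>) * A j m + lam j * A j m)"
    by simp
  also have "\<dots> = A j m * (\<kappa> * lam j - \<kappa> * lam m - of_real \<mu>) - (if m = j then of_real \<mu> else 0)"
    using \<kappa>_nz by (simp add: field_simps)
  finally show ?thesis by (simp add: mult.assoc)
qed

text \<open>The left side is the rate of change of the j-th coefficient of \<open>u\<close>, written
  as w + (A q) j, under the feedback with low target modes \<open>q\<close>. The right side is what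
  the decoupled equations w' = - \<sigma> j w and (q m)' = - \<sigma> m q m would give. The
  hypothesis on \<open>w\<close> ties it to \<open>q j\<close> for a low mode and leaves it free for
  a high one.\<close>

lemma mode_identity:
  assumes j: "0 < j" and w: "w = (if j \<le> N then q j else w)"
  shows "(of_real \<gamma> - \<kappa> * lam j) * (w + (\<Sum>m=1..N. A j m * q m)) + \<kappa> * (\<Sum>m=1..N. q m * D' m L) * e j L =
    - \<sigma> j * w - (\<Sum>m=1..N. A j m * (\<sigma> m * q m))"
proof -
  have "\<kappa> * (\<Sum>m=1..N. q m * D' m L) * e j L = (\<Sum>m=1..N. q m * (\<kappa> * D' m L * e j L))"
    by (simp add: sum_distrib_left sum_distrib_right mult_ac)
  also have "\<dots> = (\<Sum>m=1..N. q m * (A j m * (\<kappa> * lam j - \<kappa> * lam m - of_real \<mu>) - (if m = j then of_real \<mu> else 0)))"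
    by (intro sum.cong refl arg_cong2[where f="(*)"] kernel_mode_identity j) auto
  \<comment> \<open>For m \<le> N the factor of A j m is (\<kappa> lam j - \<gamma>) - \<sigma>
    m.\<close>
  also have "\<dots> = (\<Sum>m=1..N. A j m * q m * (\<kappa> * lam j - of_real \<gamma>) - A j m * (\<sigma> m * q m) - (if m = j then 1 else 0) * (of_real \<mu> * q m))"
    by (intro sum.cong refl) (auto simp: \<sigma>_def algebra_simps)
  also have "\<dots> = (\<Sum>m=1..N. A j m * q m) * (\<kappa> * lam j - of_real \<gamma>) - (\<Sum>m=1..N. A j m * (\<sigma> m * q m)) - (if j \<le> N then of_real \<mu> * q j else 0)"
    using sum_delta_1[OF j, where a="\<lambda>m. of_real \<mu> * q m"] by (simp only: sum_subtractf sum_distrib_right)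
  also have "(if j \<le> N then of_real \<mu> * q j else 0) = (if j \<le> N then of_real \<mu> else 0) * w"
    by (subst w) simp
  finally show ?thesis by (simp only: \<sigma>_def) (simp add: algebra_simps)
qed

lemma trafo_eq:
  assumes \<phi>: "\<phi> \<in> L2 L" and x: "x \<in> {0..L}"
  shows "trafo L k N \<phi> x = \<phi> x + (\<Sum>m=1..N. inner2 L \<phi> (e m) * D m x)"
proof -
  have i: "integrable (leb x) (\<lambda>y. k x y * e m y)" for m
    by (intro continuous_imp_integrable_real continuous_intros kernel_int_derivatives(4)[OF L \<nu> kernel x]
        continuous_on_eigenfun)
  have "(\<integral>y. k x y * proj L N \<phi> y \<partial>leb x) = (\<integral>y. (\<Sum>m=1..N. inner2 L \<phi> (e m) * (k x y * e m y)) \<partial>leb x)"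
    by (simp add: proj_def sum_distrib_left mult_ac)
  also have "\<dots> = (\<Sum>m=1..N. inner2 L \<phi> (e m) * D m x)"
    unfolding D_def kernel_int_def using i by (subst Bochner_Integration.integral_sum) auto
  finally show ?thesis by (simp add: trafo_def)
qed

lemma eq_ae_I: "(\<And>x. x \<in> {0..L} \<Longrightarrow> f x = g x) \<Longrightarrow> eq_ae L f g"
  unfolding eq_ae_def by (rule AE_I2) simp

lemma inner2_eigen_sum:
  assumes j: "0 < j" shows "inner2 L (\<lambda>x. \<Sum>m=1..n. a m * e m x) (e j) = (if j \<le> n then a j else 0)"
proof -
  have "inner2 L (\<lambda>x. \<Sum>m=1..n. a m * e m x) (e j) = (\<Sum>m=1..n. inner2 L (\<lambda>x. a m * e m x) (e j))"
    by (intro inner2_sum_left L2_cmult eigenfun_L2)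
  also have "\<dots> = (\<Sum>m=1..n. (if m = j then 1 else 0) * a m)"
    by (intro sum.cong refl) (use j in \<open>simp add: inner2_cmult_left eigenfun_orthonormal[OF L]\<close>)
  finally show ?thesis unfolding sum_delta_1[OF j] .
qed

lemma inner2_D_sum: "inner2 L (\<lambda>x. \<Sum>m=1..N. q m * D m x) (e j) = (\<Sum>m=1..N. A j m * q m)"
proof -
  have "inner2 L (\<lambda>x. \<Sum>m=1..N. q m * D m x) (e j) = (\<Sum>m=1..N. inner2 L (\<lambda>x. q m * D m x) (e j))"
    by (intro inner2_sum_left L2_cmult eigenfun_L2 D_L2)
  then show ?thesis by (simp add: inner2_cmult_left A_def mult.commute)
qed

lemma D_sum_L2: "(\<lambda>x. \<Sum>m=1..N. q m * D m x) \<in> L2 L"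
  by (intro L2_sum L2_cmult D_L2)

lemma e_sum_L2: "(\<lambda>x. \<Sum>m=1..n. q m * e m x) \<in> L2 L"
  by (intro L2_sum L2_cmult eigenfun_L2)

lemma trafo_inner2:
  assumes \<phi>: "\<phi> \<in> L2 L" and f: "f \<in> L2 L" "eq_ae L (trafo L k N \<phi>) f"
  shows "inner2 L f (e j) = inner2 L \<phi> (e j) + (\<Sum>m=1..N. A j m * inner2 L \<phi> (e m))"
proof -
  let ?g = "\<lambda>x. \<phi> x + (\<Sum>m=1..N. inner2 L \<phi> (e m) * D m x)"
  have g: "?g \<in> L2 L" by (rule L2_add[OF \<phi> D_sum_L2])
  have "eq_ae L (trafo L k N \<phi>) ?g" by (rule eq_ae_I) (rule trafo_eq[OF \<phi>])
  then have "eq_ae L f ?g" using f(2) eq_ae_sym eq_ae_trans by blast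
  then have "inner2 L f (e j) = inner2 L ?g (e j)"
    by (rule inner2_cong[OF _ eq_ae_refl f(1) g eigenfun_L2 eigenfun_L2])
  then show ?thesis unfolding inner2_add_left[OF \<phi> D_sum_L2 eigenfun_L2] inner2_D_sum .
qed

lemma trafo_surj: "f \<in> L2 L \<Longrightarrow> \<exists>\<phi>. \<phi> \<in> L2 L \<and> eq_ae L (trafo L k N \<phi>) f"
  using trafo unfolding boundedly_invertible_def by auto

text \<open>
  If the coefficients \<open>q\<close> solve the homogeneous equation, then the transformation maps
  \<open>\<phi> = \<Sum> q m e m\<close> to a function \<open>\<psi>\<close> without low modes, which is a fixed point of it.
\<close>

lemma mode_matrix_inj:
  assumes q: "\<And>j. j \<in> {1..N} \<Longrightarrow> q j + (\<Sum>m=1..N. A j m * q m) = 0" and j: "j \<in> {1..N}"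
  shows "q j = 0"
proof -
  define \<phi> where "\<phi> x = (\<Sum>m=1..N. q m * e m x)" for x
  define \<psi> where "\<psi> x = \<phi> x + (\<Sum>m=1..N. q m * D m x)" for x
  have \<phi>: "\<phi> \<in> L2 L" unfolding \<phi>_def by (rule e_sum_L2)
  have \<psi>: "\<psi> \<in> L2 L" unfolding \<psi>_def by (rule L2_add[OF \<phi> D_sum_L2])
  have \<phi>j: "inner2 L \<phi> (e j) = q j" if "j \<in> {1..N}" for j
    using that unfolding \<phi>_def by (subst inner2_eigen_sum) auto
  have \<psi>j: "inner2 L \<psi> (e j) = 0" if "j \<in> {1..N}" for j
    unfolding \<psi>_def inner2_add_left[OF \<phi> D_sum_L2 eigenfun_L2] inner2_D_sum \<phi>j[OF that] by (rule q[OF that])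
  have "trafo L k N \<phi> x = \<psi> x" if "x \<in> {0..L}" for x
    unfolding trafo_eq[OF \<phi> that] \<psi>_def by (simp add: \<phi>j)
  moreover have "trafo L k N \<psi> x = \<psi> x" if "x \<in> {0..L}" for x
    unfolding trafo_eq[OF \<psi> that] by (simp add: \<psi>j)
  ultimately have "eq_ae L (trafo L k N \<phi>) (trafo L k N \<psi>)" by (intro eq_ae_I) simp
  then have "eq_ae L \<phi> \<psi>"
    using trafo \<phi> \<psi> unfolding boundedly_invertible_def by simp
  then have "inner2 L \<phi> (e j) = inner2 L \<psi> (e j)" by (rule inner2_cong[OF _ eq_ae_refl \<phi> \<psi> eigenfun_L2 eigenfun_L2])
  then show ?thesis using \<phi>j[OF j] \<psi>j[OF j] by simp
qed

text \<open>The inverse of the block I + A by which the transformation acts on the low modes. Fixing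
  it once makes the constants of the estimates independent of the datum.\<close>

definition C :: "nat \<Rightarrow> nat \<Rightarrow> complex" where
  "C = (SOME C. \<forall>i\<in>{1..N}. \<forall>j\<in>{1..N}. C j i + (\<Sum>m=1..N. A j m * C m i) = (if i = j then 1 else 0))"

text \<open>The low modes of the target state that belong to low modes \<open>a\<close> of the
  original state.\<close>

definition Q :: "(nat \<Rightarrow> complex) \<Rightarrow> nat \<Rightarrow> complex" where
  "Q a m = (\<Sum>i=1..N. C m i * a i)"

text \<open>Column i consists of the low Fourier coefficients of a preimage of \<open>e i\<close>
  under the transformation. So existence comes from its surjectivity, while uniqueness came from its
  injectivity in \<open>mode_matrix_inj\<close>.\<close>

lemma C_inverse:
  assumes "i \<in> {1..N}" "j \<in> {1..N}"
  shows "C j i + (\<Sum>m=1..N. A j m * C m i) = (if i = j then 1 else 0)"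
proof -
  have "\<exists>c. \<forall>j\<in>{1..N}. c j + (\<Sum>m=1..N. A j m * c m) = (if i = j then 1 else 0)" if i: "i \<in> {1..N}" for i
  proof -
    obtain \<phi> where \<phi>: "\<phi> \<in> L2 L" "eq_ae L (trafo L k N \<phi>) (e i)" using trafo_surj[OF eigenfun_L2] by blast
    show ?thesis
    proof (intro exI ballI)
      fix j assume j: "j \<in> {1..N}"
      have "inner2 L (e i) (e j) = (if i = j then 1 else 0)" using i j by (intro eigenfun_orthonormal[OF L]) auto
      then show "inner2 L \<phi> (e j) + (\<Sum>m=1..N. A j m * inner2 L \<phi> (e m)) = (if i = j then 1 else 0)"
        using trafo_inner2[OF \<phi>(1) eigenfun_L2 \<phi>(2)] by simp
    qed
  qed
  then obtain c where "\<And>i j. i \<in> {1..N} \<Longrightarrow> j \<in> {1..N} \<Longrightarrow> c i j + (\<Sum>m=1..N. A j m * c i m) = (if i = j then 1 else 0)"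
    by metis
  then have "\<exists>C. \<forall>i\<in>{1..N}. \<forall>j\<in>{1..N}. C j i + (\<Sum>m=1..N. A j m * C m i) = (if i = j then 1 else 0)"
    by (intro exI[of _ "\<lambda>j i. c i j"]) blast
  from someI_ex[OF this] assms show ?thesis unfolding C_def[symmetric] by blast
qed

lemma Q_solves:
  assumes j: "j \<in> {1..N}" shows "Q a j + (\<Sum>m=1..N. A j m * Q a m) = a j"
proof -
  have "(\<Sum>m=1..N. A j m * Q a m) = (\<Sum>i=1..N. (\<Sum>m=1..N. A j m * C m i) * a i)"
    unfolding Q_def sum_distrib_left sum_distrib_right by (subst sum.swap) (simp add: mult.assoc)
  then have "Q a j + (\<Sum>m=1..N. A j m * Q a m) = (\<Sum>i=1..N. (C j i + (\<Sum>m=1..N. A j m * C m i)) * a i)"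
    by (simp add: Q_def distrib_right sum.distrib)
  also have "\<dots> = (\<Sum>i=1..N. (if i = j then 1 else 0) * a i)"
    by (intro sum.cong refl) (use C_inverse[OF _ j] in simp)
  finally show ?thesis using j sum_delta_1[where a=a and N=N and j=j] by simp
qed

lemma Q_unique:
  assumes q: "\<And>j. j \<in> {1..N} \<Longrightarrow> q j + (\<Sum>m=1..N. A j m * q m) = a j" and j: "j \<in> {1..N}"
  shows "Q a j = q j"
proof -
  have "q j - Q a j = 0"
  proof (rule mode_matrix_inj[OF _ j, of "\<lambda>j. q j - Q a j"])
    fix j assume j: "j \<in> {1..N}"
    show "q j - Q a j + (\<Sum>m=1..N. A j m * (q m - Q a m)) = 0"
      using q[OF j] Q_solves[OF j, of a] by (simp add: right_diff_distrib sum_subtractf algebra_simps)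
  qed
  then show ?thesis by simp
qed

text \<open>With p the projection of \<open>f\<close> and \<phi> the preimage of p, the low modes of
  p - (p - \<phi>) are those of \<phi>, so \<open>Gam\<close> yields the projection of \<phi>.
  Whichever preimage was selected, its low modes solve the system with matrix I + A and are
  therefore given by \<open>Q\<close>. The rest is the boundary formula in
  \<open>kernel_int_derivatives\<close>.\<close>

lemma feedback_eq:
  assumes f: "f \<in> L2 L"
  shows "feedback L \<nu> \<alpha> \<mu> k N (proj L N f) = (\<Sum>m=1..N. Q (\<lambda>j. inner2 L f (e j)) m * D' m L)"
proof -
  define p where "p = proj L N f"
  define \<phi> where "\<phi> = trafo_inv L k N p"
  have p: "p \<in> L2 L" unfolding p_def proj_def[abs_def] by (rule e_sum_L2)
  have pj: "inner2 L p (e j) = inner2 L f (e j)" if "j \<in> {1..N}" for j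
    using that unfolding p_def proj_def[abs_def] by (subst inner2_eigen_sum) auto
  have \<phi>: "\<phi> \<in> L2 L" "eq_ae L (trafo L k N \<phi>) p"
    unfolding \<phi>_def trafo_inv_def using someI_ex[OF trafo_surj[OF p]] by auto
  define q where "q = Q (\<lambda>j. inner2 L f (e j))"
  have q: "q j = inner2 L \<phi> (e j)" if "j \<in> {1..N}" for j
    unfolding q_def using trafo_inner2[OF \<phi>(1) p \<phi>(2)] pj by (intro Q_unique[OF _ that]) simp
  have Ups: "Ups L k N p = (\<lambda>x. p x - \<phi> x)" by (simp add: Ups_def[abs_def] \<phi>_def)
  have Gam: "Gam L k N p x = (\<Sum>m=1..N. q m * e m x)" for x
  proof -
    have "Gam L k N p x = (\<Sum>m=1..N. inner2 L f (e m) * e m x) - (\<Sum>m=1..N. inner2 L (\<lambda>x. p x - \<phi> x) (e m) * e m x)"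
      by (simp only: Gam_def Ups) (simp add: proj_def p_def)
    also have "\<dots> = (\<Sum>m=1..N. inner2 L f (e m) * e m x - inner2 L (\<lambda>x. p x - \<phi> x) (e m) * e m x)"
      by (simp add: sum_subtractf)
    also have "\<dots> = (\<Sum>m=1..N. q m * e m x)"
      by (intro sum.cong refl) (simp add: inner2_diff_left[OF p \<phi>(1) eigenfun_L2] pj q left_diff_distrib)
    finally show ?thesis .
  qed
  let ?kx = "\<lambda>y. vector_derivative (\<lambda>x. k x y) (at L within {y..L})"
  have i: "integrable (leb L) (\<lambda>y. ?kx y * e m y)" for m
    by (rule kernel_int_derivatives(5)[OF L \<nu> kernel])
  have "(\<integral>y. ?kx y * Gam L k N p y \<partial>leb L) = (\<integral>y. (\<Sum>m=1..N. q m * (?kx y * e m y)) \<partial>leb L)"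
    unfolding Gam by (simp add: sum_distrib_left mult_ac)
  also have "\<dots> = (\<Sum>m=1..N. q m * (\<integral>y. ?kx y * e m y \<partial>leb L))"
    using i by (subst Bochner_Integration.integral_sum) auto
  finally have "feedback L \<nu> \<alpha> \<mu> k N p = (\<Sum>m=1..N. q m * (\<integral>y. ?kx y * e m y \<partial>leb L)) -
      of_real (\<mu> * L) / (2 * Complex \<nu> \<alpha>) * (\<Sum>m=1..N. q m * e m L)"
    by (simp add: feedback_def Gam)
  also have "\<dots> = (\<Sum>m=1..N. q m * ((\<integral>y. ?kx y * e m y \<partial>leb L) - of_real (\<mu> * L) / (2 * Complex \<nu> \<alpha>) * e m L))"
    by (simp only: right_diff_distrib sum_subtractf sum_distrib_left mult.left_commute)
  also have "\<dots> = (\<Sum>m=1..N. q m * D' m L)"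
    unfolding D'_def kernel_int_derivatives(3)[OF L \<nu> kernel] ..
  finally show ?thesis by (simp add: p_def q_def)
qed

end

subsection \<open>Uniformly convergent series\<close>

lemma series_vector_derivative:
  fixes f :: "nat \<Rightarrow> real \<Rightarrow> complex"
  assumes S: "convex S" and d: "\<And>n x. x \<in> S \<Longrightarrow> (f n has_vector_derivative f' n x) (at x within S)"
    and b: "\<And>n x. x \<in> S \<Longrightarrow> norm (f' n x) \<le> M n" and M: "summable M"
    and x: "x \<in> S" and s: "summable (\<lambda>n. f n x)"
  shows "((\<lambda>x. \<Sum>n. f n x) has_vector_derivative (\<Sum>n. f' n x)) (at x within S)"
proof -
  have ul: "uniform_limit S (\<lambda>n x. \<Sum>i<n. f' i x) (\<lambda>x. \<Sum>i. f' i x) sequentially"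
    by (rule Weierstrass_m_test[OF b M])
  have "\<exists>g. \<forall>x\<in>S. (\<lambda>n. f n x) sums g x \<and> (g has_derivative (\<lambda>h. h *\<^sub>R (\<Sum>i. f' i x))) (at x within S)"
  proof (rule has_derivative_series[OF S _ _ x])
    show "(f n has_derivative (\<lambda>h. h *\<^sub>R f' n x)) (at x within S)" if "x \<in> S" for n x
      using d[OF that] by (simp add: has_vector_derivative_def)
    show "(\<lambda>n. f n x) sums (\<Sum>n. f n x)" by (rule summable_sums[OF s])
    show "\<forall>\<^sub>F n in sequentially. \<forall>x\<in>S. \<forall>h. norm ((\<Sum>i<n. h *\<^sub>R f' i x) - h *\<^sub>R (\<Sum>i. f' i x)) \<le> e * norm h"
      if "e > 0" for e
      using uniform_limitD[OF ul that]
    proof eventually_elim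
      case (elim n)
      show ?case
      proof (intro ballI allI)
        fix x h assume "x \<in> S"
        then have "norm ((\<Sum>i<n. f' i x) - (\<Sum>i. f' i x)) \<le> e" using elim by (auto simp: dist_norm less_imp_le)
        then have "\<bar>h\<bar> * norm ((\<Sum>i<n. f' i x) - (\<Sum>i. f' i x)) \<le> \<bar>h\<bar> * e" by (rule mult_left_mono) simp
        then show "norm ((\<Sum>i<n. h *\<^sub>R f' i x) - h *\<^sub>R (\<Sum>i. f' i x)) \<le> e * norm h"
          by (simp add: scaleR_sum_right[symmetric] scaleR_diff_right[symmetric] mult.commute)
      qed
    qed
  qed
  then obtain g where g: "\<And>x. x \<in> S \<Longrightarrow> (\<lambda>n. f n x) sums g x"
    "\<And>x. x \<in> S \<Longrightarrow> (g has_derivative (\<lambda>h. h *\<^sub>R (\<Sum>i. f' i x))) (at x within S)" by blast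
  have "(g has_vector_derivative (\<Sum>i. f' i x)) (at x within S)"
    using g(2)[OF x] by (simp add: has_vector_derivative_def)
  then show ?thesis
    by (rule has_vector_derivative_transform[OF x, rotated]) (use g(1) sums_unique in force)
qed

lemma series_continuous_on:
  fixes f :: "nat \<Rightarrow> real \<Rightarrow> complex"
  assumes c: "\<And>n. continuous_on S (f n)" and b: "\<And>n x. x \<in> S \<Longrightarrow> norm (f n x) \<le> M n" and M: "summable M"
  shows "continuous_on S (\<lambda>x. \<Sum>n. f n x)"
  by (rule uniform_limit_theorem[OF _ Weierstrass_m_test[OF b M]])
     (auto intro!: always_eventually continuous_on_sum c)

lemma series_norm2_tail:
  fixes f :: "nat \<Rightarrow> real \<Rightarrow> complex"
  assumes L: "0 \<le> L" and c: "\<And>n. continuous_on {0..L} (f n)"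
    and b: "\<And>n x. x \<in> {0..L} \<Longrightarrow> norm (f n x) \<le> M n" and M: "summable M"
  shows "norm2 L (\<lambda>x. (\<Sum>n. f n x) - (\<Sum>i<n. f i x)) \<le> (suminf M - (\<Sum>i<n. M i)) * sqrt L"
proof (rule norm2_le_sup)
  show "(\<lambda>x. (\<Sum>n. f n x) - (\<Sum>i<n. f i x)) \<in> L2 L"
    by (intro L2_continuous continuous_intros series_continuous_on[OF c b M] c)
  have M0: "0 \<le> M i" for i by (rule order_trans[OF norm_ge_zero b[of 0 i]]) (use L in simp)
  show "0 \<le> suminf M - (\<Sum>i<n. M i)" using sum_le_suminf[OF M, of "{..<n}"] M0 by auto
  fix x assume x: "x \<in> {0..L}"
  have s: "summable (\<lambda>n. norm (f n x))"
    by (rule summable_comparison_test'[OF M, of 0]) (use b[OF x] in simp)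
  have "(\<Sum>n. f n x) - (\<Sum>i<n. f i x) = (\<Sum>i. f (i + n) x)"
    using suminf_minus_initial_segment[OF summable_norm_cancel[OF s], of n] by simp
  also have "norm \<dots> \<le> (\<Sum>i. norm (f (i + n) x))"
    by (rule summable_norm) (use summable_ignore_initial_segment[OF s, of n] in simp)
  also have "\<dots> \<le> (\<Sum>i. M (i + n))"
    by (rule suminf_le) (use b[OF x] summable_ignore_initial_segment[OF s, of n] summable_ignore_initial_segment[OF M, of n] in auto)
  also have "\<dots> = suminf M - (\<Sum>i<n. M i)" by (rule suminf_minus_initial_segment[OF M])
  finally show "norm ((\<Sum>n. f n x) - (\<Sum>i<n. f i x)) \<le> suminf M - (\<Sum>i<n. M i)" .
qed (rule L)

lemma summable_tail_LIMSEQ: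
  fixes M :: "nat \<Rightarrow> real"
  assumes "summable M" shows "(\<lambda>n. (suminf M - (\<Sum>i<n. M i)) * c) \<longlonglongrightarrow> 0"
proof -
  have "(\<lambda>n. (suminf M - (\<Sum>i<n. M i)) * c) \<longlonglongrightarrow> (suminf M - suminf M) * c"
    by (intro tendsto_intros summable_LIMSEQ assms)
  then show ?thesis by simp
qed

lemma series_inner2:
  fixes f :: "nat \<Rightarrow> real \<Rightarrow> complex"
  assumes L: "0 \<le> L" and c: "\<And>n. continuous_on {0..L} (f n)"
    and b: "\<And>n x. x \<in> {0..L} \<Longrightarrow> norm (f n x) \<le> M n" and M: "summable M" and v: "v \<in> L2 L"
  shows "(\<lambda>n. inner2 L (f n) v) sums inner2 L (\<lambda>x. \<Sum>n. f n x) v"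
proof -
  have f: "f n \<in> L2 L" for n by (rule L2_continuous[OF c])
  have S: "(\<lambda>x. \<Sum>n. f n x) \<in> L2 L" by (rule L2_continuous[OF series_continuous_on[OF c b M]])
  have Sn: "(\<lambda>x. \<Sum>i<n. f i x) \<in> L2 L" for n by (intro L2_sum f)
  have "(\<lambda>n. (\<Sum>i<n. inner2 L (f i) v) - inner2 L (\<lambda>x. \<Sum>n. f n x) v) \<longlonglongrightarrow> 0"
  proof (rule Lim_null_comparison[OF always_eventually summable_tail_LIMSEQ[OF M]], rule allI)
    fix n
    have "norm ((\<Sum>i<n. inner2 L (f i) v) - inner2 L (\<lambda>x. \<Sum>n. f n x) v) =
        norm (inner2 L (\<lambda>x. (\<Sum>n. f n x) - (\<Sum>i<n. f i x)) v)"
      unfolding inner2_diff_left[OF S Sn v] inner2_sum_left[OF f v] by (rule norm_minus_commute)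
    also have "\<dots> \<le> norm2 L (\<lambda>x. (\<Sum>n. f n x) - (\<Sum>i<n. f i x)) * norm2 L v"
      by (rule norm_inner2_le[OF L2_diff[OF S Sn] v])
    also have "\<dots> \<le> ((suminf M - (\<Sum>i<n. M i)) * sqrt L) * norm2 L v"
      by (intro mult_right_mono series_norm2_tail[OF L c b M] norm2_nonneg)
    finally show "norm ((\<Sum>i<n. inner2 L (f i) v) - inner2 L (\<lambda>x. \<Sum>n. f n x) v) \<le>
        (suminf M - (\<Sum>i<n. M i)) * (sqrt L * norm2 L v)" by (simp add: mult.assoc)
  qed
  then show ?thesis unfolding sums_def by (rule LIM_zero_cancel)
qed

text \<open>The majorant \<open>M\<close> only secures convergence. The bound \<open>B\<close> is
  inherited from the partial sums, where orthogonality can be used.\<close>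

lemma series_norm2_le:
  fixes f :: "nat \<Rightarrow> real \<Rightarrow> complex"
  assumes L: "0 \<le> L" and c: "\<And>n. continuous_on {0..L} (f n)"
    and b: "\<And>n x. x \<in> {0..L} \<Longrightarrow> norm (f n x) \<le> M n" and M: "summable M"
    and B: "\<And>n. norm2 L (\<lambda>x. \<Sum>i<n. f i x) \<le> B"
  shows "norm2 L (\<lambda>x. \<Sum>n. f n x) \<le> B"
proof (rule LIMSEQ_le_const)
  have f: "f n \<in> L2 L" for n by (rule L2_continuous[OF c])
  have S: "(\<lambda>x. \<Sum>n. f n x) \<in> L2 L" by (rule L2_continuous[OF series_continuous_on[OF c b M]])
  have Sn: "(\<lambda>x. \<Sum>i<n. f i x) \<in> L2 L" for n by (intro L2_sum f)
  show "(\<lambda>n. B + (suminf M - (\<Sum>i<n. M i)) * sqrt L) \<longlonglongrightarrow> B"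
    using tendsto_add[OF tendsto_const summable_tail_LIMSEQ[OF M, of "sqrt L"], of B] by simp
  have "norm2 L (\<lambda>x. \<Sum>n. f n x) \<le> B + (suminf M - (\<Sum>i<n. M i)) * sqrt L" for n
  proof -
    have "norm2 L (\<lambda>x. (\<Sum>i<n. f i x) + ((\<Sum>n. f n x) - (\<Sum>i<n. f i x))) \<le>
        norm2 L (\<lambda>x. \<Sum>i<n. f i x) + norm2 L (\<lambda>x. (\<Sum>n. f n x) - (\<Sum>i<n. f i x))"
      by (rule norm2_triangle[OF Sn L2_diff[OF S Sn]])
    then show ?thesis using B[of n] series_norm2_tail[OF L c b M, of n] by simp
  qed
  then show "\<exists>n0. \<forall>n\<ge>n0. norm2 L (\<lambda>x. \<Sum>n. f n x) \<le> B + (suminf M - (\<Sum>i<n. M i)) * sqrt L" by blast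
qed

text \<open>Continuity in time of a series whose terms separate time and space. Tannery's theorem
  interchanges limit and sum. The majorant is required only near t, since for the derivative series
  it degenerates as time tends to 0.\<close>

lemma series_norm2_tendsto:
  fixes g :: "nat \<Rightarrow> real \<Rightarrow> complex" and c :: "nat \<Rightarrow> real \<Rightarrow> complex"
  assumes L: "0 \<le> L" and g: "\<And>n. continuous_on {0..L} (g n)" "\<And>n x. x \<in> {0..L} \<Longrightarrow> norm (g n x) \<le> K n"
    and c: "\<And>n. (c n \<longlongrightarrow> c n t) F"
    and b: "eventually (\<lambda>s. \<forall>n. norm (c n s) * K n \<le> M n) F" "\<And>n. norm (c n t) * K n \<le> M n" and M: "summable M"
  shows "((\<lambda>s. norm2 L (\<lambda>x. (\<Sum>n. c n s * g n x) - (\<Sum>n. c n t * g n x))) \<longlongrightarrow> 0) F"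
proof (cases "F = bot")
  case False
  have K: "0 \<le> K n" for n by (rule order_trans[OF norm_ge_zero g(2)[of 0 n]]) (use L in simp)
  have lim: "((\<lambda>s. \<Sum>n. norm (c n s - c n t) * K n) \<longlongrightarrow> (\<Sum>n. 0)) F"
  proof -
    have le: "norm (norm (c n s - c n t) * K n) \<le> 2 * M n" if "\<forall>n. norm (c n s) * K n \<le> M n" for n s
    proof -
      have "norm (c n s - c n t) * K n \<le> (norm (c n s) + norm (c n t)) * K n"
        by (intro mult_right_mono norm_triangle_ineq4 K)
      also have "\<dots> \<le> 2 * M n" using that[rule_format, of n] b(2)[of n] by (simp add: distrib_right)
      finally show ?thesis using K by simp
    qed
    show ?thesis
    proof (rule tannerys_theorem[THEN conjunct2, THEN conjunct2])
      show "((\<lambda>s. norm (c n s - c n t) * K n) \<longlongrightarrow> 0) F" for n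
        by (intro tendsto_mult_left_zero tendsto_norm_zero LIM_zero c)
      show "\<forall>\<^sub>F (n, s) in sequentially \<times>\<^sub>F F. norm (norm (c n s - c n t) * K n) \<le> 2 * M n"
        unfolding eventually_prod_filter using b(1) le
        by (intro exI[of _ "\<lambda>_. True"] exI[of _ "\<lambda>s. \<forall>n. norm (c n s) * K n \<le> M n"]) auto
      show "summable (\<lambda>n. 2 * M n)" using M by (rule summable_mult)
    qed (rule False)
  qed
  have "((\<lambda>s. (\<Sum>n. norm (c n s - c n t) * K n) * sqrt L) \<longlongrightarrow> 0) F"
    using tendsto_mult_right[OF lim, of "sqrt L"] by simp
  then show ?thesis
  proof (rule Lim_null_comparison[rotated])
    show "\<forall>\<^sub>F s in F. norm (norm2 L (\<lambda>x. (\<Sum>n. c n s * g n x) - (\<Sum>n. c n t * g n x)))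
        \<le> (\<Sum>n. norm (c n s - c n t) * K n) * sqrt L"
      using b(1)
    proof eventually_elim
      case (elim s)
      have bd: "norm (c n r * g n x) \<le> M n" if "r = s \<or> r = t" "x \<in> {0..L}" for n x r
      proof -
        have "norm (c n r * g n x) \<le> norm (c n r) * K n"
          unfolding norm_mult by (intro mult_left_mono g that) simp
        also have "\<dots> \<le> M n" using that(1) elim b(2) by auto
        finally show ?thesis .
      qed
      have sm: "summable (\<lambda>n. c n r * g n x)" if "r = s \<or> r = t" "x \<in> {0..L}" for r x
        by (rule summable_comparison_test'[OF M, of 0]) (use bd[OF that] in simp)
      have sk: "summable (\<lambda>n. norm (c n s - c n t) * K n)"
      proof (rule summable_comparison_test'[of "\<lambda>n. 2 * M n" 0])
        fix n
        have "norm (c n s - c n t) * K n \<le> (norm (c n s) + norm (c n t)) * K n"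
          by (intro mult_right_mono norm_triangle_ineq4 K)
        also have "\<dots> \<le> 2 * M n" using elim[rule_format, of n] b(2)[of n] by (simp add: distrib_right)
        finally show "norm (norm (c n s - c n t) * K n) \<le> 2 * M n" using K by simp
      qed (use M in simp)
      have "norm2 L (\<lambda>x. (\<Sum>n. c n s * g n x) - (\<Sum>n. c n t * g n x)) \<le> (\<Sum>n. norm (c n s - c n t) * K n) * sqrt L"
      proof (rule norm2_le_sup[OF _ L])
        have "continuous_on {0..L} (\<lambda>x. \<Sum>n. c n r * g n x)" if "r = s \<or> r = t" for r
          by (rule series_continuous_on[OF _ bd[OF that] M]) (intro continuous_intros g)
        then show "(\<lambda>x. (\<Sum>n. c n s * g n x) - (\<Sum>n. c n t * g n x)) \<in> L2 L"
          by (intro L2_continuous continuous_intros) auto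
        show "0 \<le> (\<Sum>n. norm (c n s - c n t) * K n)" by (intro suminf_nonneg sk mult_nonneg_nonneg K norm_ge_zero)
        fix x assume x: "x \<in> {0..L}"
        have le: "norm ((c n s - c n t) * g n x) \<le> norm (c n s - c n t) * K n" for n
          unfolding norm_mult by (intro mult_left_mono g x) simp
        have "(\<Sum>n. c n s * g n x) - (\<Sum>n. c n t * g n x) = (\<Sum>n. (c n s - c n t) * g n x)"
          using suminf_diff[OF sm[OF _ x] sm[OF _ x], of s t] by (simp add: left_diff_distrib)
        also have "norm \<dots> \<le> (\<Sum>n. norm (c n s - c n t) * K n)"
          by (rule norm_suminf_le[OF le sk])
        finally show "norm ((\<Sum>n. c n s * g n x) - (\<Sum>n. c n t * g n x)) \<le> (\<Sum>n. norm (c n s - c n t) * K n)" .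
      qed
      then show ?case by simp
    qed
  qed
qed simp

subsection \<open>The explicit solution\<close>

text \<open>
  \<open>w0\<close> are the initial Fourier coefficients of the target state, and \<open>W\<close> bounds the norm of its
  derivative.
\<close>

locale modal_evolution = closed_loop +
  fixes w0 :: "nat \<Rightarrow> complex" and W \<eta> :: real
  assumes \<mu>: "\<mu> > 0" and \<gamma>: "\<gamma> \<ge> 0" and \<eta>: "\<eta> > 0" "\<And>j. 0 < j \<Longrightarrow> \<eta> \<le> Re (\<sigma> j)"
    and W: "W \<ge> 0" "\<And>n. (\<Sum>j=1..n. eigenval L j * (norm (w0 j))\<^sup>2) \<le> W\<^sup>2"
begin

definition wt :: "nat \<Rightarrow> real \<Rightarrow> complex" where
  "wt j t = exp (- \<sigma> j * of_real t) * w0 j"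

text \<open>The target state. Sums over \<open>nat\<close> start at 0 and modes at 1, whence the
  shift by \<open>Suc\<close>.\<close>

definition S :: "real \<Rightarrow> real \<Rightarrow> complex" where
  "S t x = (\<Sum>n. wt (Suc n) t * e (Suc n) x)"

definition S' :: "real \<Rightarrow> real \<Rightarrow> complex" where
  "S' t x = (\<Sum>n. wt (Suc n) t * e' (Suc n) x)"

text \<open>The transformation applied to the target state, whose low Fourier coefficients are
  \<open>wt m t\<close>.\<close>

definition U :: "real \<Rightarrow> real \<Rightarrow> complex" where
  "U t x = S t x + (\<Sum>m=1..N. wt m t * D m x)"

definition U' :: "real \<Rightarrow> real \<Rightarrow> complex" where
  "U' t x = S' t x + (\<Sum>m=1..N. wt m t * D' m x)"

lemma norm_wt: "norm (wt j t) = exp (- Re (\<sigma> j) * t) * norm (w0 j)"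
  by (simp add: wt_def norm_mult)

lemma norm_wt_le:
  assumes "0 < j" "0 \<le> t" shows "norm (wt j t) \<le> exp (- \<eta> * t) * norm (w0 j)"
  unfolding norm_wt using \<eta>(2)[OF assms(1)] assms(2) by (intro mult_right_mono) (auto intro: mult_right_mono)

lemma norm_wt_le':
  assumes "0 < j" "0 \<le> t" shows "norm (wt j t) \<le> norm (w0 j)"
proof -
  have "exp (- \<eta> * t) * norm (w0 j) \<le> 1 * norm (w0 j)" using \<eta>(1) assms by (intro mult_right_mono) auto
  then show ?thesis using norm_wt_le[OF assms] by simp
qed

text \<open>Parabolic smoothing. The datum is only in H^1, while the time derivative of the series
  costs a full factor of the eigenvalue. For t \<ge> \<delta> the exponential absorbs it, by z \<le>
  exp z at z = \<nu> \<lambda> t. The factor exp (\<gamma> T) bounds the growth caused by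
  \<gamma>.\<close>

lemma eigenval_wt_le:
  assumes "0 < j" "0 < \<delta>" "\<delta> \<le> t" "t \<le> T"
  shows "eigenval L j * norm (wt j t) \<le> exp (\<gamma> * T) / (\<nu> * \<delta>) * norm (w0 j)"
proof -
  have l: "eigenval L j > 0" by (rule eigenval_pos[OF L assms(1)])
  have "Re (\<sigma> j) \<ge> \<nu> * eigenval L j - \<gamma>" using \<mu> by (simp add: \<sigma>_def \<kappa>_def)
  then have "(\<nu> * eigenval L j - \<gamma>) * t \<le> Re (\<sigma> j) * t" using assms by (intro mult_right_mono) auto
  moreover have "\<gamma> * t \<le> \<gamma> * T" using \<gamma> assms by (intro mult_left_mono)
  ultimately have "exp (- Re (\<sigma> j) * t) \<le> exp (\<gamma> * T) * exp (- (\<nu> * eigenval L j * t))"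
    unfolding exp_add[symmetric] by (simp add: algebra_simps)
  then have "eigenval L j * exp (- Re (\<sigma> j) * t) \<le> exp (\<gamma> * T) * (eigenval L j * exp (- (\<nu> * eigenval L j * t)))"
    using l by (simp add: mult_left_mono mult.left_commute)
  also have "eigenval L j * exp (- (\<nu> * eigenval L j * t)) \<le> 1 / (\<nu> * \<delta>)"
  proof -
    have "\<nu> * eigenval L j * \<delta> \<le> \<nu> * eigenval L j * t" using \<nu> l assms by (intro mult_left_mono) auto
    also have "\<dots> \<le> exp (\<nu> * eigenval L j * t)" using exp_ge_add_one_self[of "\<nu> * eigenval L j * t"] by linarith
    finally show ?thesis using \<nu> assms by (simp add: exp_minus field_simps)
  qed
  finally have "eigenval L j * exp (- Re (\<sigma> j) * t) \<le> exp (\<gamma> * T) / (\<nu> * \<delta>)" by simp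
  then have "eigenval L j * exp (- Re (\<sigma> j) * t) * norm (w0 j) \<le> exp (\<gamma> * T) / (\<nu> * \<delta>) * norm (w0 j)"
    by (rule mult_right_mono) simp
  then show ?thesis by (simp add: norm_wt mult.assoc)
qed

text \<open>By 2 |w| \<le> \<lambda> |w|^2 + 1/\<lambda>: the first terms are summable by the bound
  \<open>W\<close>, the second because the eigenvalues grow at least like n^2. This absolute
  summability is behind all majorants below.\<close>

lemma summable_w0: "summable (\<lambda>n. norm (w0 (Suc n)))"
proof (rule summable_comparison_test')
  have l1: "eigenval L 1 > 0" using eigenval_pos[OF L] by simp
  show "summable (\<lambda>n. eigenval L (Suc n) * (norm (w0 (Suc n)))\<^sup>2 + 1 / eigenval L 1 * (1 / real (Suc n) ^ 2))"
  proof (intro summable_add summable_mult)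
    show "summable (\<lambda>n. eigenval L (Suc n) * (norm (w0 (Suc n)))\<^sup>2)"
    proof (rule bounded_imp_summable)
      show "0 \<le> eigenval L (Suc n) * (norm (w0 (Suc n)))\<^sup>2" for n using eigenval_pos[OF L, of "Suc n"] by simp
      show "(\<Sum>k\<le>n. eigenval L (Suc k) * (norm (w0 (Suc k)))\<^sup>2) \<le> W\<^sup>2" for n
        using W(2)[of "Suc n"] sum.atLeast1_atMost_eq[of "\<lambda>j. eigenval L j * (norm (w0 j))\<^sup>2" "Suc n"]
        by (simp add: lessThan_Suc_atMost)
    qed
    show "summable (\<lambda>n. 1 / real (Suc n) ^ 2)"
      using inverse_power_summable[of 2, where 'a=real] by (subst summable_Suc_iff) (simp add: inverse_eq_divide)
  qed
  fix n
  have l: "eigenval L (Suc n) > 0" by (rule eigenval_pos[OF L]) simp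
  have "(real (Suc n))\<^sup>2 \<le> (2 * real (Suc n) - 1)\<^sup>2" by (intro power_mono) auto
  then have le: "(real (Suc n))\<^sup>2 * eigenval L 1 \<le> eigenval L (Suc n)"
    unfolding eigenval_eq[of L "Suc n"] using l1 by (intro mult_right_mono) auto
  have "2 * norm (w0 (Suc n)) \<le> eigenval L (Suc n) * (norm (w0 (Suc n)))\<^sup>2 + 1 / eigenval L (Suc n)"
    using sum_squares_bound[of "sqrt (eigenval L (Suc n)) * norm (w0 (Suc n))" "1 / sqrt (eigenval L (Suc n))"] l
    by (simp add: power_mult_distrib power_divide)
  moreover have "1 / eigenval L (Suc n) \<le> 1 / eigenval L 1 * (1 / real (Suc n) ^ 2)"
    using le l l1 by (simp add: field_simps)
  ultimately show "norm (norm (w0 (Suc n))) \<le>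
      eigenval L (Suc n) * (norm (w0 (Suc n)))\<^sup>2 + 1 / eigenval L 1 * (1 / real (Suc n) ^ 2)"
    using norm_ge_zero[of "w0 (Suc n)"] unfolding real_norm_def abs_norm_cancel by linarith
qed

definition bnd0 :: "nat \<Rightarrow> real" where
  "bnd0 n = norm (w0 (Suc n)) * sqrt (2 / L)"

text \<open>The derivative of an eigenfunction carries the root of the eigenvalue. It is estimated
  by the eigenvalue over \<open>freq L 1\<close>, so that \<open>eigenval_wt_le\<close> applies;
  this is the origin of the divisor.\<close>

definition bnd1 :: "real \<Rightarrow> real \<Rightarrow> nat \<Rightarrow> real" where
  "bnd1 \<delta> T n = sqrt (2 / L) / freq L 1 * (exp (\<gamma> * T) / (\<nu> * \<delta>) * norm (w0 (Suc n)))"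

lemma summable_bnd: "summable bnd0" "summable (bnd1 \<delta> T)"
  unfolding bnd0_def[abs_def] bnd1_def[abs_def]
  by (intro summable_mult summable_mult2 summable_w0)+

lemma coeff_le0: "0 \<le> t \<Longrightarrow> norm (wt (Suc n) t) * sqrt (2 / L) \<le> bnd0 n"
  unfolding bnd0_def using L by (intro mult_right_mono norm_wt_le') auto

lemma coeff_le1:
  assumes "0 < \<delta>" "\<delta> \<le> t" "t \<le> T"
  shows "norm (wt (Suc n) t) * (sqrt (2 / L) * freq L (Suc n)) \<le> bnd1 \<delta> T n"
proof -
  have f1: "freq L 1 > 0" using freq_pos[OF L] by simp
  have "freq L 1 \<le> freq L (Suc n)" using L by (simp add: freq_def divide_right_mono)
  then have "freq L 1 * freq L (Suc n) \<le> eigenval L (Suc n)"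
    using f1 by (simp add: eigenval_freq power2_eq_square mult_right_mono)
  then have "freq L (Suc n) \<le> eigenval L (Suc n) / freq L 1" using f1 by (simp add: field_simps)
  then have "(norm (wt (Suc n) t) * sqrt (2 / L)) * freq L (Suc n) \<le>
      (norm (wt (Suc n) t) * sqrt (2 / L)) * (eigenval L (Suc n) / freq L 1)"
    using L by (intro mult_left_mono) auto
  also have "\<dots> = sqrt (2 / L) / freq L 1 * (eigenval L (Suc n) * norm (wt (Suc n) t))" by simp
  also have "\<dots> \<le> bnd1 \<delta> T n"
    unfolding bnd1_def using L f1 assms by (intro mult_left_mono eigenval_wt_le) auto
  finally show ?thesis by (simp add: mult.assoc)
qed

lemma S_term_le: "0 \<le> t \<Longrightarrow> norm (wt (Suc n) t * e (Suc n) x) \<le> bnd0 n"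
  using mult_left_mono[OF norm_eigenfun_le[OF L, of "Suc n" x] norm_ge_zero[of "wt (Suc n) t"]] coeff_le0[of t n]
  unfolding norm_mult by linarith

lemma S'_term_le:
  "0 < \<delta> \<Longrightarrow> \<delta> \<le> t \<Longrightarrow> t \<le> T \<Longrightarrow> norm (wt (Suc n) t * e' (Suc n) x) \<le> bnd1 \<delta> T n"
  using mult_left_mono[OF norm_eigenfun_deriv_le[OF L, of "Suc n" x] norm_ge_zero[of "wt (Suc n) t"]] coeff_le1[of \<delta> t T n]
  unfolding norm_mult by simp

lemma S_term_cont: "continuous_on X (\<lambda>x. wt (Suc n) t * e (Suc n) x)" "continuous_on X (\<lambda>x. wt (Suc n) t * e' (Suc n) x)"
  by (intro continuous_intros continuous_on_eigenfun continuous_on_eigenfun_deriv)+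

lemma S_cont: "0 \<le> t \<Longrightarrow> continuous_on {0..L} (S t)"
  unfolding S_def[abs_def] by (rule series_continuous_on[OF S_term_cont(1) S_term_le summable_bnd(1)])

lemma S'_cont: "0 < t \<Longrightarrow> continuous_on {0..L} (S' t)"
  unfolding S'_def[abs_def] by (rule series_continuous_on[OF S_term_cont(2) S'_term_le[of t t t] summable_bnd(2)]) auto

lemma S_deriv:
  assumes "0 < t" "x \<in> {0..L}" shows "(S t has_vector_derivative S' t x) (at x within {0..L})"
  unfolding S_def[abs_def] S'_def
proof (rule series_vector_derivative[OF _ _ S'_term_le[of t t t] summable_bnd(2)])
  show "((\<lambda>x. wt (Suc n) t * e (Suc n) x) has_vector_derivative wt (Suc n) t * e' (Suc n) x) (at x within {0..L})" for n x
    by (rule has_vector_derivative_mult_right[OF eigenfun_vector_derivative])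
  show "summable (\<lambda>n. wt (Suc n) t * e (Suc n) x)"
    by (rule summable_comparison_test'[OF summable_bnd(1), of 0]) (use S_term_le assms in auto)
qed (use assms in auto)

lemma S_inner2:
  assumes "0 \<le> t" "v \<in> L2 L" shows "(\<lambda>n. wt (Suc n) t * inner2 L (e (Suc n)) v) sums inner2 L (S t) v"
  using series_inner2[OF less_imp_le[OF L] S_term_cont(1) S_term_le[OF assms(1)] summable_bnd(1) assms(2)]
  by (simp add: S_def[abs_def] inner2_cmult_left)

lemma S'_inner2:
  assumes "0 < t" "v \<in> L2 L" shows "(\<lambda>n. wt (Suc n) t * inner2 L (e' (Suc n)) v) sums inner2 L (S' t) v"
  using series_inner2[OF less_imp_le[OF L] S_term_cont(2) S'_term_le[OF assms(1), of t t] summable_bnd(2) assms(2)]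
  by (simp add: S'_def[abs_def] inner2_cmult_left)

text \<open>A discrete Poincare inequality: every eigenvalue is at least the first one.\<close>

lemma w0_le: "0 < m \<Longrightarrow> norm (w0 m) \<le> W / sqrt (eigenval L 1)"
  and sum_w0_le: "(\<Sum>j=1..n. (norm (w0 j))\<^sup>2) \<le> (W / sqrt (eigenval L 1))\<^sup>2"
proof -
  have l1: "eigenval L 1 > 0" using eigenval_pos[OF L] by simp
  show sum: "(\<Sum>j=1..n. (norm (w0 j))\<^sup>2) \<le> (W / sqrt (eigenval L 1))\<^sup>2" for n
  proof -
    have "eigenval L 1 * (\<Sum>j=1..n. (norm (w0 j))\<^sup>2) \<le> (\<Sum>j=1..n. eigenval L j * (norm (w0 j))\<^sup>2)"
      unfolding sum_distrib_left by (intro sum_mono mult_right_mono eigenval_mono) auto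
    also have "\<dots> \<le> W\<^sup>2" by (rule W(2))
    finally show ?thesis using l1 by (simp add: power_divide field_simps)
  qed
  show "norm (w0 m) \<le> W / sqrt (eigenval L 1)" if "0 < m"
  proof (rule power2_le_imp_le)
    have "(norm (w0 m))\<^sup>2 \<le> (\<Sum>j=1..m. (norm (w0 j))\<^sup>2)"
      using that by (intro member_le_sum) auto
    then show "(norm (w0 m))\<^sup>2 \<le> (W / sqrt (eigenval L 1))\<^sup>2" using sum[of m] by simp
  qed (use W l1 in simp)
qed

lemma norm2_S_le:
  assumes t: "0 \<le> t" shows "norm2 L (S t) \<le> exp (- \<eta> * t) * (W / sqrt (eigenval L 1))"
  unfolding S_def[abs_def]
proof (rule series_norm2_le[OF less_imp_le[OF L] S_term_cont(1) S_term_le[OF t] summable_bnd(1)])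
  fix n
  have l1: "eigenval L 1 > 0" using eigenval_pos[OF L] by simp
  show "norm2 L (\<lambda>x. \<Sum>i<n. wt (Suc i) t * e (Suc i) x) \<le> exp (- \<eta> * t) * (W / sqrt (eigenval L 1))"
  proof (rule power2_le_imp_le)
    have "(norm2 L (\<lambda>x. \<Sum>i<n. wt (Suc i) t * e (Suc i) x))\<^sup>2 = (\<Sum>j=1..n. (norm (wt j t))\<^sup>2)"
      unfolding norm2_eigenfun_sum(1)[OF L, symmetric] by (simp add: sum.atLeast1_atMost_eq)
    also have "\<dots> \<le> (\<Sum>j=1..n. (exp (- \<eta> * t) * norm (w0 j))\<^sup>2)"
      by (intro sum_mono power_mono norm_wt_le t) auto
    also have "\<dots> = (exp (- \<eta> * t))\<^sup>2 * (\<Sum>j=1..n. (norm (w0 j))\<^sup>2)"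
      by (simp add: power_mult_distrib sum_distrib_left)
    also have "\<dots> \<le> (exp (- \<eta> * t))\<^sup>2 * (W / sqrt (eigenval L 1))\<^sup>2"
      by (intro mult_left_mono sum_w0_le) simp
    finally show "(norm2 L (\<lambda>x. \<Sum>i<n. wt (Suc i) t * e (Suc i) x))\<^sup>2 \<le> (exp (- \<eta> * t) * (W / sqrt (eigenval L 1)))\<^sup>2"
      by (simp only: power_mult_distrib)
  qed (use W l1 in simp)
qed

text \<open>The majorant \<open>bnd1\<close> blows up as t tends to 0 and cannot give a uniform
  estimate. Orthogonality of the partial sums gives the bound in terms of \<open>W\<close> with the
  full rate \<eta>, uniformly in t > 0.\<close>

lemma norm2_S'_le:
  assumes t: "0 < t" shows "norm2 L (S' t) \<le> exp (- \<eta> * t) * W"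
  unfolding S'_def[abs_def]
proof (rule series_norm2_le[OF less_imp_le[OF L] S_term_cont(2) S'_term_le[OF t, of t t] summable_bnd(2)])
  fix n
  show "norm2 L (\<lambda>x. \<Sum>i<n. wt (Suc i) t * e' (Suc i) x) \<le> exp (- \<eta> * t) * W"
  proof (rule power2_le_imp_le)
    have "(norm2 L (\<lambda>x. \<Sum>i<n. wt (Suc i) t * e' (Suc i) x))\<^sup>2 = (\<Sum>j=1..n. eigenval L j * (norm (wt j t))\<^sup>2)"
      unfolding norm2_eigenfun_sum(2)[OF L, symmetric] by (simp add: sum.atLeast1_atMost_eq)
    also have "\<dots> \<le> (\<Sum>j=1..n. eigenval L j * (exp (- \<eta> * t) * norm (w0 j))\<^sup>2)"
      using t by (intro sum_mono mult_left_mono power_mono norm_wt_le) (auto simp: eigenval_freq)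
    also have "\<dots> = (exp (- \<eta> * t))\<^sup>2 * (\<Sum>j=1..n. eigenval L j * (norm (w0 j))\<^sup>2)"
      by (simp add: power_mult_distrib sum_distrib_left mult.left_commute)
    also have "\<dots> \<le> (exp (- \<eta> * t))\<^sup>2 * W\<^sup>2"
      by (intro mult_left_mono W) simp
    finally show "(norm2 L (\<lambda>x. \<Sum>i<n. wt (Suc i) t * e' (Suc i) x))\<^sup>2 \<le> (exp (- \<eta> * t) * W)\<^sup>2"
      by (simp only: power_mult_distrib)
  qed (use W in simp)
qed (use t in auto)

end

section \<open>Auxiliary facts on perturbed data, scalar linear equations and test functions in
  time\<close>

lemma H1_left_diff_C1:
  assumes L: "L > 0" and f: "f \<in> H1_left L"
    and d: "\<And>x. x \<in> {0..L} \<Longrightarrow> (F has_vector_derivative F' x) (at x within {0..L})"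
    and c: "continuous_on {0..L} F'" and F0: "F 0 = 0"
  shows "(\<lambda>x. f x - F x) \<in> H1_left L" "eq_ae L (wderiv L (\<lambda>x. f x - F x)) (\<lambda>x. wderiv L f x - F' x)"
proof -
  have cF: "continuous_on {0..L} F" by (rule continuous_on_vector_derivative[OF d])
  have F: "F \<in> L2 L" "F' \<in> L2 L" by (rule L2_continuous cF c)+
  have s: "f \<in> sobolev L 1" using f unfolding H1_left_def by auto
  note w = wderiv_props[OF s]
  have wF: "weak_deriv L F F'" by (rule weak_deriv_C1[OF less_imp_le[OF L] d c])
  have wd: "weak_deriv L (\<lambda>x. f x - F x) (\<lambda>x. wderiv L f x - F' x)"
    by (intro weak_deriv_diff L2_integrable w F wF)
  show "eq_ae L (wderiv L (\<lambda>x. f x - F x)) (\<lambda>x. wderiv L f x - F' x)"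
    by (rule wderiv_eq[OF L _ _ wd]) (intro L2_diff w F)+
  have "trace_at L (\<lambda>x. f x - F x) 0 = (\<integral>y. wderiv L f y \<partial>leb 0) - F 0"
  proof (rule trace_at_eq[OF L, where F="\<lambda>x. (\<integral>y. wderiv L f y \<partial>leb x) - F x"])
    show "continuous_on {0..L} (\<lambda>x. (\<integral>y. wderiv L f y \<partial>leb x) - F x)"
      by (intro continuous_intros indefinite_integral_continuous_real L2_integrable w cF)
    show "eq_ae L (\<lambda>x. f x - F x) (\<lambda>x. (\<integral>y. wderiv L f y \<partial>leb x) - F x)"
      using H1_left_rep(1)[OF L f] unfolding eq_ae_def by (rule eventually_mono) simp
  qed (use L in simp)
  then have "trace_at L (\<lambda>x. f x - F x) 0 = 0" unfolding integral_leb_zero F0 by simp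
  moreover have "(\<lambda>x. f x - F x) \<in> sobolev L 1"
    unfolding sobolev1_iff by (intro conjI bexI[of _ "\<lambda>x. wderiv L f x - F' x"] wd L2_diff w F)
  ultimately show "(\<lambda>x. f x - F x) \<in> H1_left L" by (simp add: H1_left_def)
qed

lemma norm2_eigenfun:
  assumes "L > 0" "0 < j" shows "norm2 L (eigenfun L j) = 1"
proof -
  have "complex_of_real ((norm2 L (eigenfun L j))\<^sup>2) = 1"
    unfolding inner2_self[symmetric] using eigenfun_orthonormal[OF assms(1) assms(2) assms(2)] by simp
  then have "(norm2 L (eigenfun L j))\<^sup>2 = 1" by (metis of_real_eq_1_iff)
  then show ?thesis by (simp add: power2_eq_1_iff) (metis norm2_nonneg not_one_le_zero neg_0_le_iff_le)
qed

lemma norm2_le_sobolev_norm: "norm2 L f \<le> sobolev_norm L 1 f" "norm2 L (wderiv L f) \<le> sobolev_norm L 1 f"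
  unfolding sobolev_norm1 by (rule real_le_rsqrt; simp)+

lemma linear_ode_unique:
  fixes y :: "real \<Rightarrow> complex"
  assumes d: "\<And>t. t \<in> {0..T} \<Longrightarrow> (y has_vector_derivative s * y t) (at t within {0..T})" and t: "t \<in> {0..T}"
  shows "y t = exp (s * of_real t) * y 0"
proof -
  have ex: "((\<lambda>t. exp (- s * of_real t)) has_vector_derivative - s * exp (- s * of_real t)) (at t within {0..T})" for t
    by (rule has_vector_derivative_real_field[where f="\<lambda>z. exp (- s * z)"]) (auto intro!: derivative_eq_intros)
  have z: "((\<lambda>t. exp (- s * of_real t) * y t) has_vector_derivative 0) (at t within {0..T})" if "t \<in> {0..T}" for t
    using has_vector_derivative_mult[OF ex d[OF that]]
    by (rule has_vector_derivative_eq_rhs) (simp add: algebra_simps)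
  obtain c where c: "\<And>t. t \<in> {0..T} \<Longrightarrow> exp (- s * of_real t) * y t = c"
    by (rule has_vector_derivative_zero_constant[OF convex_real_interval(5) z]) blast+
  have "exp (- s * of_real t) * y t = exp (- s * of_real 0) * y 0"
    using c[OF t] c[of 0] t by (metis atLeastAtMost_iff order_refl order_trans)
  then have "y 0 = exp (- s * of_real t) * y t" by simp
  then show ?thesis by (simp add: exp_minus)
qed

lemma C1c_mono:
  assumes "C1c X \<phi> \<phi>'" "X \<subseteq> Y" shows "C1c Y \<phi> \<phi>'"
proof -
  obtain K where "compact K" "K \<subseteq> X" "\<forall>x. x \<notin> K \<longrightarrow> \<phi> x = 0" using assms(1) unfolding C1c_def by blast
  then have "\<exists>K. compact K \<and> K \<subseteq> Y \<and> (\<forall>x. x \<notin> K \<longrightarrow> \<phi> x = 0)" using assms(2) by (intro exI[of _ K]) auto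
  then show ?thesis using assms(1) unfolding C1c_def by blast
qed

lemma C1c_deriv_outside:
  assumes C: "C1c X \<phi> \<phi>'" and t: "t \<notin> X" shows "\<phi>' t = 0"
proof -
  obtain K where K: "compact K" "K \<subseteq> X" "\<And>x. x \<notin> K \<Longrightarrow> \<phi> x = 0" using C unfolding C1c_def by blast
  have "(\<phi> has_real_derivative 0) (at t)"
    by (rule has_field_derivative_transform_within_open[where S="- K" and f="\<lambda>_. 0"])
       (use K t in \<open>auto intro: compact_imp_closed\<close>)
  moreover have "(\<phi> has_real_derivative \<phi>' t) (at t)" using C unfolding C1c_def by blast
  ultimately show ?thesis using DERIV_unique by blast
qed

lemma integral_halfline_restrict:
  fixes g :: "real \<Rightarrow> complex"
  assumes "0 \<le> a" "\<And>t. 0 \<le> t \<Longrightarrow> t \<notin> {a..b} \<Longrightarrow> g t = 0"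
  shows "(\<integral>t. g t \<partial>lebesgue_on {0..}) = (\<integral>t. g t \<partial>lebesgue_on {a..b})"
proof -
  have "(\<integral>t. g t \<partial>lebesgue_on {0..}) = (\<integral>t. (if t \<in> {a..b} then g t else 0) \<partial>lebesgue_on {0..})"
    by (intro Bochner_Integration.integral_cong refl) (use assms(2) in auto)
  also have "\<dots> = (\<integral>t. g t \<partial>lebesgue_on {a..b})"
    by (rule Lebesgue_Measure.integral_restrict) (use assms(1) in auto)
  finally show ?thesis .
qed

subsection \<open>Weak solutions decouple in modal coordinates\<close>

context closed_loop
begin

lemma weak_solution_mode_continuous:
  assumes sol: "weak_solution L \<nu> \<alpha> \<gamma> \<mu> k N u0 u"
  shows "continuous_on {0..} (\<lambda>t. inner2 L (u t) (e j))"
  unfolding continuous_on_def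
proof
  fix t :: real assume t: "t \<in> {0..}"
  have u: "u s \<in> L2 L" if "s \<ge> 0" for s using sol that unfolding weak_solution_def by blast
  have "((\<lambda>s. norm2 L (\<lambda>x. u s x - u t x)) \<longlongrightarrow> 0) (at t within {0..})"
    using sol t unfolding weak_solution_def by auto
  then have lim: "((\<lambda>s. norm2 L (\<lambda>x. u s x - u t x) * norm2 L (e j)) \<longlongrightarrow> 0) (at t within {0..})"
    by (rule tendsto_mult_left_zero)
  have "((\<lambda>s. inner2 L (u s) (e j) - inner2 L (u t) (e j)) \<longlongrightarrow> 0) (at t within {0..})"
  proof (rule Lim_null_comparison[OF _ lim])
    show "\<forall>\<^sub>F s in at t within {0..}. norm (inner2 L (u s) (e j) - inner2 L (u t) (e j)) \<le> norm2 L (\<lambda>x. u s x - u t x) * norm2 L (e j)"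
      unfolding eventually_at_filter
      by (rule always_eventually)
         (use t in \<open>auto simp: inner2_diff_left[OF u u eigenfun_L2, symmetric] intro!: norm_inner2_le L2_diff u\<close>)
  qed
  then show "((\<lambda>s. inner2 L (u s) (e j)) \<longlongrightarrow> inner2 L (u t) (e j)) (at t within {0..})"
    by (rule LIM_zero_cancel)
qed

text \<open>Tested with v = e j, the weak form states that the coefficient has the weak derivative
  \<open>f\<close> in time. The theory of weak derivatives on an interval is reused with time as the
  variable. Since \<open>f\<close> depends on finitely many continuous coefficients it is
  continuous, so the coefficient is continuously differentiable up to t = 0.\<close>

lemma weak_solution_mode_derivative:
  assumes sol: "weak_solution L \<nu> \<alpha> \<gamma> \<mu> k N u0 u" and T: "T > 0" and t: "t \<in> {0..T}"
  shows "((\<lambda>t. inner2 L (u t) (e j)) has_vector_derivative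
      (of_real \<gamma> - \<kappa> * lam j) * inner2 L (u t) (e j) +
      \<kappa> * (\<Sum>m=1..N. Q (\<lambda>i. inner2 L (u t) (e i)) m * D' m L) * e j L) (at t within {0..T})"
proof -
  define a where "a j t = inner2 L (u t) (e j)" for j t
  define f where "f t = (of_real \<gamma> - \<kappa> * lam j) * a j t + \<kappa> * (\<Sum>m=1..N. Q (\<lambda>i. a i t) m * D' m L) * e j L" for t
  have u: "u s \<in> L2 L" if "s \<ge> 0" for s using sol that unfolding weak_solution_def by blast
  have ca: "continuous_on {0..} (a i)" for i unfolding a_def by (rule weak_solution_mode_continuous[OF sol])
  have cf: "continuous_on {0..} f"
    unfolding f_def Q_def by (intro continuous_intros ca)
  have ca': "continuous_on {0..T} (a j)" and cf': "continuous_on {0..T} f"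
    using ca cf continuous_on_subset[of "{0..}" _ "{0..T}"] by auto
  note iaf = continuous_imp_integrable_real[OF ca'] continuous_imp_integrable_real[OF cf']
  have AE1: "AE t in lebesgue_on {0..}. u t \<in> H1_left L" using sol unfolding weak_solution_def by blast
  have "weak_deriv T (a j) f"
    unfolding weak_deriv_def
  proof (intro allI impI)
    fix \<phi> \<phi>' assume C: "C1c {0<..<T} \<phi> \<phi>'"
    have C': "C1c {0<..} \<phi> \<phi>'" by (rule C1c_mono[OF C]) auto
    have z: "\<phi> s = 0" "\<phi>' s = 0" if "s \<notin> {0..T}" for s
      using that C1c_outside[OF C] C1c_deriv_outside[OF C] by auto
    have eqn: "- (\<integral>t. inner2 L (u t) (e j) * of_real (\<phi>' t) \<partial>lebesgue_on {0..})
        + (\<integral>t. (Complex \<nu> \<alpha> *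
                  (inner2 L (wderiv L (u t)) (wderiv L (e j))
                   - feedback L \<nu> \<alpha> \<mu> k N (proj L N (u t)) * cnj (trace_at L (e j) L))
                 - of_real \<gamma> * inner2 L (u t) (e j)) * of_real (\<phi> t) \<partial>lebesgue_on {0..}) = 0"
      using sol eigenfun_H1_left(1)[OF L] C' unfolding weak_solution_def by blast
    let ?I = "\<lambda>t. (Complex \<nu> \<alpha> *
                  (inner2 L (wderiv L (u t)) (wderiv L (e j))
                   - feedback L \<nu> \<alpha> \<mu> k N (proj L N (u t)) * cnj (trace_at L (e j) L))
                 - of_real \<gamma> * inner2 L (u t) (e j)) * of_real (\<phi> t)"
    have "AE t in lebesgue_on {0..}. t \<in> {0..}" by (rule AE_I2) simp
    \<comment> \<open>Only for almost every t is \<open>u t\<close> known to lie in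
      \<open>H1_left\<close>. There the integrand is an explicit continuous expression, which also
      supplies the measurability of the original one.\<close>
    with AE1 have ae: "AE t in lebesgue_on {0..}. - f t * of_real (\<phi> t) = ?I t"
    proof eventually_elim
      case (elim t)
      have w: "wderiv L (u t) \<in> L2 L" "wderiv L (e j) \<in> L2 L"
        using elim(1) eigenfun_H1_left(1)[OF L] wderiv_props unfolding H1_left_def by blast+
      have "inner2 L (wderiv L (u t)) (wderiv L (e j)) = inner2 L (wderiv L (u t)) (e' j)"
        by (rule inner2_cong[OF eq_ae_refl eigenfun_H1_left(2)[OF L] w(1) w(1) w(2) eigenfun_deriv_L2])
      also have "\<dots> = lam j * a j t" unfolding a_def by (rule inner2_wderiv_eigenfun_deriv[OF L elim(1)])
      finally have 1: "inner2 L (wderiv L (u t)) (wderiv L (e j)) = lam j * a j t" .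
      have 2: "feedback L \<nu> \<alpha> \<mu> k N (proj L N (u t)) = (\<Sum>m=1..N. Q (\<lambda>i. a i t) m * D' m L)"
        unfolding a_def using elim(2) by (intro feedback_eq u) simp
      have 3: "cnj (trace_at L (e j) L) = e j L" using eigenfun_H1_left(3)[OF L, of L j] L by simp
      show ?case unfolding 1 2 3 f_def \<kappa>_def a_def by (simp add: algebra_simps)
    qed
    have fm: "(\<lambda>t. - f t * of_real (\<phi> t)) \<in> borel_measurable (lebesgue_on {0..})"
      by (rule continuous_imp_measurable_on_sets_lebesgue) (auto intro!: continuous_on_mult continuous_on_minus cf continuous_on_of_real C1c_continuous[OF C])
    have "(\<integral>t. ?I t \<partial>lebesgue_on {0..}) = (\<integral>t. - f t * of_real (\<phi> t) \<partial>lebesgue_on {0..})"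
      by (rule integral_cong_AE[OF borel_measurable_lebesgue_on_cong_AE[OF _ fm ae] fm]) (use ae in \<open>auto elim: eventually_mono\<close>)
    also have "\<dots> = (\<integral>t. - f t * of_real (\<phi> t) \<partial>lebesgue_on {0..T})"
      by (rule integral_halfline_restrict) (use z in auto)
    finally have 1: "(\<integral>t. ?I t \<partial>lebesgue_on {0..}) = - (\<integral>t. f t * of_real (\<phi> t) \<partial>lebesgue_on {0..T})" by simp
    have 2: "(\<integral>t. inner2 L (u t) (e j) * of_real (\<phi>' t) \<partial>lebesgue_on {0..}) =
        (\<integral>t. a j t * of_real (\<phi>' t) \<partial>lebesgue_on {0..T})"
      unfolding a_def by (rule integral_halfline_restrict) (use z in auto)
    show "(\<integral>t. a j t * of_real (\<phi>' t) \<partial>lebesgue_on {0..T}) = - (\<integral>t. f t * of_real (\<phi> t) \<partial>lebesgue_on {0..T})"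
      using eqn unfolding 1 2 by algebra
  qed
  from weak_deriv_rep[OF T iaf this] obtain c where c: "AE t in leb T. a j t = c + (\<integral>y. f y \<partial>leb t)" by blast
  \<comment> \<open>Both sides are continuous, so the identity extends from almost every t to all t,
    in particular to t = 0.\<close>
  have rep: "a j t = c + (\<integral>y. f y \<partial>leb t)" if "t \<in> {0..T}" for t
    by (rule AE_eq_continuous[OF T ca' _ c that])
       (intro continuous_intros indefinite_integral_continuous_real iaf)
  have "((\<lambda>t. c + integral {0..t} f) has_vector_derivative f t) (at t within {0..T})"
    using has_vector_derivative_add[OF has_vector_derivative_const integral_has_vector_derivative[OF cf' t], of c] by simp
  then have "(a j has_vector_derivative f t) (at t within {0..T})"
  proof (rule has_vector_derivative_transform[OF t, rotated])
    fix s assume s: "s \<in> {0..T}"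
    have "continuous_on {0..s} f" by (rule continuous_on_subset[OF cf']) (use s in auto)
    then show "a j s = c + integral {0..s} f" using rep[OF s] by (simp add: integral_leb_eq_integral)
  qed
  then show ?thesis by (simp add: a_def[abs_def] f_def)
qed

lemma Q_derivative:
  assumes "\<And>j. ((\<lambda>t. a t j) has_vector_derivative b j) (at t within X)"
  shows "((\<lambda>t. Q (a t) m) has_vector_derivative Q b m) (at t within X)"
  unfolding Q_def by (intro has_vector_derivative_sum has_vector_derivative_mult_right assms)

text \<open>On the low modes, \<open>mode_identity\<close> reads b = (I + A) (- \<sigma> q), so
  uniqueness for I + A gives Q b = - \<sigma> q. Differentiating \<open>w j\<close> then leaves -
  \<sigma> j w j. This also covers j > N, where \<open>w j\<close> is the coefficient of
  \<open>u\<close> minus the contribution of the low modes through the kernel operator.\<close>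

lemma weak_solution_decoupled:
  assumes sol: "weak_solution L \<nu> \<alpha> \<gamma> \<mu> k N u0 u" and t: "t \<ge> 0" and j: "0 < j"
  defines "w \<equiv> \<lambda>j t. inner2 L (u t) (e j) - (\<Sum>m=1..N. A j m * Q (\<lambda>i. inner2 L (u t) (e i)) m)"
  shows "w j t = exp (- \<sigma> j * of_real t) * w j 0"
proof (rule linear_ode_unique[where T="t + 1"])
  fix s assume s: "s \<in> {0..t + 1}"
  define a where "a s i = inner2 L (u s) (e i)" for s i
  define q where "q = Q (a s)"
  define b where "b i = (of_real \<gamma> - \<kappa> * lam i) * a s i + \<kappa> * (\<Sum>m=1..N. q m * D' m L) * e i L" for i
  have w_eq: "w i s = a s i - (\<Sum>m=1..N. A i m * Q (a s) m)" for i s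
    by (simp add: w_def a_def[abs_def])
  have wq: "w i s = q i" if "i \<in> {1..N}" for i
    unfolding w_eq q_def using Q_solves[OF that, of "a s"] by (metis add_diff_cancel_right')
  have b: "b i = - \<sigma> i * w i s - (\<Sum>m=1..N. A i m * (\<sigma> m * q m))" if i: "0 < i" for i
  proof -
    have "a s i = w i s + (\<Sum>m=1..N. A i m * q m)" by (simp add: w_eq q_def)
    then show ?thesis unfolding b_def using mode_identity[OF i, of "w i s" q] wq[of i] i by simp
  qed
  have da: "((\<lambda>t. a t i) has_vector_derivative b i) (at s within {0..t + 1})" for i
    using weak_solution_mode_derivative[OF sol _ s, of i] t by (simp add: a_def[abs_def] b_def q_def)
  have Qb: "Q b m = - \<sigma> m * q m" if m: "m \<in> {1..N}" for m
  proof (rule Q_unique[OF _ m])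
    fix i assume i: "i \<in> {1..N}"
    show "- \<sigma> i * q i + (\<Sum>m=1..N. A i m * (- \<sigma> m * q m)) = b i"
      using b[of i] wq[OF i] i by (simp add: sum_negf)
  qed
  have "((\<lambda>t. a t j - (\<Sum>m=1..N. A j m * Q (a t) m)) has_vector_derivative b j - (\<Sum>m=1..N. A j m * Q b m)) (at s within {0..t + 1})"
    by (intro has_vector_derivative_diff has_vector_derivative_sum has_vector_derivative_mult_right Q_derivative da)
  moreover have "b j - (\<Sum>m=1..N. A j m * Q b m) = - \<sigma> j * w j s"
  proof -
    have "(\<Sum>m=1..N. A j m * Q b m) = - (\<Sum>m=1..N. A j m * (\<sigma> m * q m))"
      unfolding sum_negf[symmetric] by (intro sum.cong refl) (simp add: Qb)
    then show ?thesis by (simp add: b[OF j])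
  qed
  ultimately show "(w j has_vector_derivative - \<sigma> j * w j s) (at s within {0..t + 1})"
    by (simp add: w_eq[abs_def])
qed (use t in auto)

text \<open>This constant bounds the H^1 norm of the explicit solution at time t by exp (- \<eta> t)
  W. The division by \<open>sqrt (eigenval L 1)\<close> stems from estimating undifferentiated
  quantities by \<open>W\<close>.\<close>

definition c1 :: real where
  "c1 = 1 + (1 + (\<Sum>m=1..N. norm2 L (D m) + norm2 L (D' m))) / sqrt (eigenval L 1)"

text \<open>This constant bounds the derivative of the initial target state by the H^1 norm of the
  datum. Both constants depend on the kernel, through \<open>D\<close> and \<open>C\<close>, and not
  on the datum.\<close>

definition c2 :: real where
  "c2 = 1 + (\<Sum>m=1..N. (\<Sum>i=1..N. norm (C m i)) * norm2 L (D' m))"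

lemma c12_pos: "0 < c1" "0 < c2"
proof -
  have "eigenval L 1 > 0" using eigenval_pos[OF L] by simp
  then have "0 \<le> (1 + (\<Sum>m=1..N. norm2 L (D m) + norm2 L (D' m))) / sqrt (eigenval L 1)"
    by (intro divide_nonneg_nonneg add_nonneg_nonneg sum_nonneg norm2_nonneg) auto
  then show "0 < c1" unfolding c1_def by linarith
  have "0 \<le> (\<Sum>m=1..N. (\<Sum>i=1..N. norm (C m i)) * norm2 L (D' m))"
    by (intro sum_nonneg mult_nonneg_nonneg norm2_nonneg) auto
  then show "0 < c2" unfolding c2_def by linarith
qed

lemma D_sum_deriv:
  "x \<in> {0..L} \<Longrightarrow> ((\<lambda>x. \<Sum>m=1..N. q m * D m x) has_vector_derivative (\<Sum>m=1..N. q m * D' m x)) (at x within {0..L})"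
  by (intro has_vector_derivative_sum has_vector_derivative_mult_right D_deriv)

lemma D'_sum_cont: "continuous_on {0..L} (\<lambda>x. \<Sum>m=1..N. q m * D' m x)"
  by (intro continuous_intros D_cont)

text \<open>\<open>g0\<close> is the preimage of \<open>u0\<close> under the transformation: its low
  modes are \<open>Q a\<close> by \<open>Q_solves\<close>, so adding their images under the kernel
  operator returns \<open>u0\<close>. As each \<open>D m\<close> is continuously differentiable and
  vanishes at 0, \<open>g0\<close> stays in \<open>H1_left\<close>.\<close>

lemma initial_target:
  assumes u0: "u0 \<in> H1_left L"
  defines "a \<equiv> \<lambda>j. inner2 L u0 (e j)"
  defines "g0 \<equiv> \<lambda>x. u0 x - (\<Sum>m=1..N. Q a m * D m x)"
  shows "g0 \<in> H1_left L" "inner2 L g0 (e j) = a j - (\<Sum>m=1..N. A j m * Q a m)"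
    "norm2 L (wderiv L g0) \<le> c2 * sobolev_norm L 1 u0"
proof -
  have s: "u0 \<in> sobolev L 1" using u0 unfolding H1_left_def by auto
  note w = wderiv_props[OF s]
  have g: "g0 \<in> H1_left L" "eq_ae L (wderiv L g0) (\<lambda>x. wderiv L u0 x - (\<Sum>m=1..N. Q a m * D' m x))"
    unfolding g0_def by (rule H1_left_diff_C1[OF L u0 D_sum_deriv D'_sum_cont]; simp add: D_0)+
  show "g0 \<in> H1_left L" by (rule g(1))
  show "inner2 L g0 (e j) = a j - (\<Sum>m=1..N. A j m * Q a m)"
    unfolding g0_def inner2_diff_left[OF w(1) D_sum_L2 eigenfun_L2] inner2_D_sum a_def ..
  have "wderiv L g0 \<in> L2 L" using g(1) wderiv_props unfolding H1_left_def by blast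
  moreover have D'L2: "(\<lambda>x. \<Sum>m=1..N. - Q a m * D' m x) \<in> L2 L" by (intro L2_sum L2_cmult D_L2)
  moreover have eq: "(\<lambda>x. wderiv L u0 x - (\<Sum>m=1..N. Q a m * D' m x)) = (\<lambda>x. wderiv L u0 x + (\<Sum>m=1..N. - Q a m * D' m x))"
    by (simp add: sum_negf)
  ultimately have "norm2 L (wderiv L g0) = norm2 L (\<lambda>x. wderiv L u0 x + (\<Sum>m=1..N. - Q a m * D' m x))"
    using g(2) by (intro norm2_cong L2_add w) simp_all
  also have "\<dots> \<le> norm2 L (wderiv L u0) + norm2 L (\<lambda>x. \<Sum>m=1..N. - Q a m * D' m x)"
    by (rule norm2_triangle[OF w(2) D'L2])
  also have "norm2 L (\<lambda>x. \<Sum>m=1..N. - Q a m * D' m x) \<le> (\<Sum>m=1..N. norm2 L (\<lambda>x. - Q a m * D' m x))"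
    by (intro norm2_sum L2_cmult D_L2)
  also have "\<dots> \<le> (\<Sum>m=1..N. (\<Sum>i=1..N. norm (C m i)) * norm2 L (D' m) * sobolev_norm L 1 u0)"
  proof (intro sum_mono)
    fix m
    have a: "norm (a i) \<le> sobolev_norm L 1 u0" if "i \<in> {1..N}" for i
    proof -
      have "norm (a i) \<le> norm2 L u0 * norm2 L (e i)" unfolding a_def by (rule norm_inner2_le[OF w(1) eigenfun_L2])
      also have "norm2 L (e i) = 1" using that by (intro norm2_eigenfun[OF L]) simp
      finally show ?thesis using norm2_le_sobolev_norm(1)[of L u0] by linarith
    qed
    have "norm (Q a m) \<le> (\<Sum>i=1..N. norm (C m i) * norm (a i))"
      unfolding Q_def norm_mult[symmetric] by (rule norm_sum)
    also have "\<dots> \<le> (\<Sum>i=1..N. norm (C m i) * sobolev_norm L 1 u0)"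
      by (intro sum_mono mult_left_mono a norm_ge_zero)
    finally have "norm (Q a m) * norm2 L (D' m) \<le> (\<Sum>i=1..N. norm (C m i) * sobolev_norm L 1 u0) * norm2 L (D' m)"
      by (rule mult_right_mono) simp
    then show "norm2 L (\<lambda>x. - Q a m * D' m x) \<le> (\<Sum>i=1..N. norm (C m i)) * norm2 L (D' m) * sobolev_norm L 1 u0"
      unfolding norm2_cmult norm_minus_cancel sum_distrib_right[symmetric] by (simp only: mult_ac)
  qed
  also have "norm2 L (wderiv L u0) \<le> sobolev_norm L 1 u0" by (rule norm2_le_sobolev_norm)
  finally show "norm2 L (wderiv L g0) \<le> c2 * sobolev_norm L 1 u0"
    unfolding c2_def by (simp only: sum_distrib_right distrib_right mult_1)
qed

end

section \<open>Fourier coefficients and H^1 norm of the explicit solution\<close>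

context modal_evolution
begin

lemma U_cont: "0 \<le> t \<Longrightarrow> continuous_on {0..L} (U t)"
  unfolding U_def[abs_def] by (intro continuous_intros S_cont D_cont)

lemma U'_cont: "0 < t \<Longrightarrow> continuous_on {0..L} (U' t)"
  unfolding U'_def[abs_def] by (intro continuous_intros S'_cont D_cont)

lemma U_L2: "0 \<le> t \<Longrightarrow> U t \<in> L2 L" and U'_L2: "0 < t \<Longrightarrow> U' t \<in> L2 L"
  and S_L2: "0 \<le> t \<Longrightarrow> S t \<in> L2 L" and S'_L2: "0 < t \<Longrightarrow> S' t \<in> L2 L"
  by (simp_all add: L2_continuous U_cont U'_cont S_cont S'_cont)

lemma U_deriv: "0 < t \<Longrightarrow> x \<in> {0..L} \<Longrightarrow> (U t has_vector_derivative U' t x) (at x within {0..L})"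
  unfolding U_def[abs_def] U'_def[abs_def] by (intro has_vector_derivative_add S_deriv D_sum_deriv)

lemma U_0: "U t 0 = 0"
  by (simp add: U_def S_def D_0)

lemma U_H1: "0 < t \<Longrightarrow> U t \<in> H1_left L" "0 < t \<Longrightarrow> eq_ae L (wderiv L (U t)) (U' t)"
  using C1_sobolev(2,3)[OF L U_L2 eq_ae_refl U_deriv U'_cont, of t] U_0 by auto

lemma U_inner2:
  assumes t: "0 \<le> t" and j: "0 < j"
  shows "inner2 L (U t) (e j) = wt j t + (\<Sum>m=1..N. A j m * wt m t)"
proof -
  have "(\<lambda>n. if n = j - 1 then wt (Suc n) t else 0) sums wt (Suc (j - 1)) t" by (rule sums_single)
  moreover have "(\<lambda>n. wt (Suc n) t * inner2 L (e (Suc n)) (e j)) = (\<lambda>n. if n = j - 1 then wt (Suc n) t else 0)"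
    using j by (auto simp: eigenfun_orthonormal[OF L] fun_eq_iff)
  ultimately have "inner2 L (S t) (e j) = wt j t"
    using S_inner2[OF t eigenfun_L2, of j] j sums_unique2 by fastforce
  then show ?thesis
    unfolding U_def[abs_def] inner2_add_left[OF S_L2[OF t] D_sum_L2 eigenfun_L2] inner2_D_sum by simp
qed

text \<open>By completeness, Fourier coefficients identify the function. At t = 0 this gives the
  initial condition of the explicit solution, at t > 0 the uniqueness of weak solutions.\<close>

lemma eq_ae_U:
  assumes t: "0 \<le> t" and f: "f \<in> L2 L"
    and fj: "\<And>j. 0 < j \<Longrightarrow> inner2 L f (e j) = wt j t + (\<Sum>m=1..N. A j m * wt m t)"
  shows "eq_ae L f (U t)"
proof -
  have "AE x in leb L. f x - U t x = 0"
    by (rule eigenfun_complete[OF L L2_diff[OF f U_L2[OF t]]])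
       (simp add: inner2_diff_left[OF f U_L2[OF t] eigenfun_L2] U_inner2[OF t] fj)
  then show ?thesis by (simp add: eq_ae_def)
qed

text \<open>Stated for every representative \<open>f\<close>, because \<open>wderiv\<close> is
  chosen for a function and not for its class; so the estimate can be applied directly to an
  arbitrary weak solution.\<close>

lemma sobolev_norm_U_le:
  assumes t: "0 < t" and f: "f \<in> L2 L" "eq_ae L f (U t)"
  shows "sobolev_norm L 1 f \<le> c1 * exp (- \<eta> * t) * W"
proof -
  have l1: "eigenval L 1 > 0" using eigenval_pos[OF L] by simp
  define E where "E = exp (- \<eta> * t) * (W / sqrt (eigenval L 1))"
  have E: "0 \<le> E" using W l1 by (simp add: E_def)
  have wt_le: "norm (wt m t) \<le> E" if "m \<in> {1..N}" for m
  proof -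
    have "norm (wt m t) \<le> exp (- \<eta> * t) * norm (w0 m)" using that t by (intro norm_wt_le) auto
    also have "\<dots> \<le> E" unfolding E_def using that by (intro mult_left_mono w0_le) auto
    finally show ?thesis .
  qed
  have sum_le: "norm2 L (\<lambda>x. \<Sum>m=1..N. wt m t * G m x) \<le> E * (\<Sum>m=1..N. norm2 L (G m))"
    if "\<And>m. G m \<in> L2 L" for G
  proof -
    have "norm2 L (\<lambda>x. \<Sum>m=1..N. wt m t * G m x) \<le> (\<Sum>m=1..N. norm2 L (\<lambda>x. wt m t * G m x))"
      by (intro norm2_sum L2_cmult that)
    also have "\<dots> \<le> (\<Sum>m=1..N. E * norm2 L (G m))"
      unfolding norm2_cmult by (intro sum_mono mult_right_mono wt_le) auto
    finally show ?thesis by (simp add: sum_distrib_left)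
  qed
  have "norm2 L f = norm2 L (U t)" by (rule norm2_cong[OF f(2,1) U_L2]) (use t in simp)
  also have "\<dots> \<le> norm2 L (S t) + norm2 L (\<lambda>x. \<Sum>m=1..N. wt m t * D m x)"
    unfolding U_def[abs_def] by (intro norm2_triangle S_L2 D_sum_L2) (use t in simp)
  also have "\<dots> \<le> E + E * (\<Sum>m=1..N. norm2 L (D m))"
    using norm2_S_le[of t] t by (intro add_mono sum_le D_L2) (simp add: E_def)
  finally have 1: "norm2 L f \<le> E + E * (\<Sum>m=1..N. norm2 L (D m))" .
  have fw: "eq_ae L (wderiv L f) (U' t)" "wderiv L f \<in> L2 L"
    using C1_sobolev(1,2)[OF L f U_deriv[OF t] U'_cont[OF t]] wderiv_props(2) by auto
  have "norm2 L (wderiv L f) = norm2 L (U' t)" by (rule norm2_cong[OF fw U'_L2[OF t]])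
  also have "\<dots> \<le> norm2 L (S' t) + norm2 L (\<lambda>x. \<Sum>m=1..N. wt m t * D' m x)"
    unfolding U'_def[abs_def] by (intro norm2_triangle S'_L2 t L2_sum L2_cmult D_L2)
  also have "\<dots> \<le> exp (- \<eta> * t) * W + E * (\<Sum>m=1..N. norm2 L (D' m))"
    by (intro add_mono sum_le D_L2 norm2_S'_le t)
  finally have 2: "norm2 L (wderiv L f) \<le> exp (- \<eta> * t) * W + E * (\<Sum>m=1..N. norm2 L (D' m))" .
  have "sobolev_norm L 1 f \<le> norm2 L f + norm2 L (wderiv L f)"
    unfolding sobolev_norm1 by (rule sqrt_sum_squares_le_sum) simp_all
  also have "\<dots> \<le> exp (- \<eta> * t) * W + E * (1 + (\<Sum>m=1..N. norm2 L (D m) + norm2 L (D' m)))"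
    using 1 2 by (simp add: sum.distrib distrib_left)
  also have "\<dots> = c1 * exp (- \<eta> * t) * W"
    using l1 by (simp add: c1_def E_def field_simps)
  finally show ?thesis .
qed

end

lemma norm2_tendsto:
  assumes "eventually (\<lambda>s. f s \<in> L2 L) F" "g \<in> L2 L" "((\<lambda>s. norm2 L (\<lambda>x. f s x - g x)) \<longlongrightarrow> 0) F"
  shows "((\<lambda>s. norm2 L (f s)) \<longlongrightarrow> norm2 L g) F"
proof (rule LIM_zero_cancel, rule Lim_null_comparison[OF _ assms(3)])
  show "eventually (\<lambda>s. norm (norm2 L (f s) - norm2 L g) \<le> norm2 L (\<lambda>x. f s x - g x)) F"
    using assms(1)
  proof eventually_elim
    case (elim s)
    have "norm2 L (\<lambda>x. g x + (f s x - g x)) \<le> norm2 L g + norm2 L (\<lambda>x. f s x - g x)"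
      by (rule norm2_triangle[OF assms(2) L2_diff[OF elim assms(2)]])
    moreover have "norm2 L (\<lambda>x. f s x + (-1) * (f s x - g x)) \<le> norm2 L (f s) + norm2 L (\<lambda>x. (-1) * (f s x - g x))"
      by (rule norm2_triangle[OF elim L2_cmult[OF L2_diff[OF elim assms(2)]]])
    ultimately show ?case unfolding norm2_cmult by (simp add: abs_le_iff)
  qed
qed

text \<open>The support of a test function in time stays away from t = 0, where the majorants of the
  differentiated series blow up. Termwise differentiation can thus take place on
  [\<delta>, T].\<close>

lemma C1c_halfline_bounds:
  assumes C: "C1c {0<..} \<phi> \<phi>'"
  obtains \<delta> T where "0 < \<delta>" "\<delta> < T" "C1c {\<delta><..<T} \<phi> \<phi>'"
proof -
  obtain K where K: "compact K" "K \<subseteq> {0<..}" "\<And>x. x \<notin> K \<Longrightarrow> \<phi> x = 0" using C unfolding C1c_def by blast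
  have "\<exists>\<delta> T. 0 < \<delta> \<and> \<delta> < T \<and> K \<subseteq> {\<delta><..<T}"
  proof (cases "K = {}")
    case False
    obtain a b where ab: "a \<in> K" "\<And>x. x \<in> K \<Longrightarrow> a \<le> x" "b \<in> K" "\<And>x. x \<in> K \<Longrightarrow> x \<le> b"
      using compact_attains_inf[OF K(1) False] compact_attains_sup[OF K(1) False] by blast
    have "0 < a" using ab(1) K(2) by auto
    moreover have "K \<subseteq> {a / 2<..<b + 1}"
    proof
      fix x assume "x \<in> K"
      then show "x \<in> {a / 2<..<b + 1}" using ab(2)[of x] ab(4)[of x] \<open>0 < a\<close> by simp
    qed
    ultimately show ?thesis using ab(2)[OF ab(3)] by (intro exI[of _ "a / 2"] exI[of _ "b + 1"]) auto
  next
    case True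
    then show ?thesis by (intro exI[of _ 1] exI[of _ 2]) auto
  qed
  then obtain \<delta> T where *: "0 < \<delta>" "\<delta> < T" "K \<subseteq> {\<delta><..<T}" by blast
  have "\<exists>K. compact K \<and> K \<subseteq> {\<delta><..<T} \<and> (\<forall>x. x \<notin> K \<longrightarrow> \<phi> x = 0)"
    using K *(3) by (intro exI[of _ K]) auto
  then have "C1c {\<delta><..<T} \<phi> \<phi>'" using C unfolding C1c_def by blast
  then show thesis using * that by blast
qed

subsection \<open>Existence\<close>

context modal_evolution
begin

lemma wt_0: "wt j 0 = w0 j"
  by (simp add: wt_def)

lemma wt_deriv: "(wt j has_vector_derivative - \<sigma> j * wt j t) (at t within X)"
proof -
  have "((\<lambda>z. exp (- \<sigma> j * z) * w0 j) has_field_derivative - \<sigma> j * wt j t) (at (of_real t))"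
    by (auto intro!: derivative_eq_intros simp: wt_def)
  then show ?thesis unfolding wt_def[abs_def] by (rule has_vector_derivative_real_field)
qed

lemma wt_cont: "continuous_on X (wt j)"
  by (rule continuous_on_vector_derivative[OF wt_deriv])

lemma wt_tendsto: "(wt j \<longlongrightarrow> wt j t) (at t within X)"
  using has_vector_derivative_continuous[OF wt_deriv[of j t X]] by (simp only: continuous_within)

lemma modal_sum_tendsto:
  assumes G: "\<And>m. G m \<in> L2 L"
    and V: "((\<lambda>s. norm2 L (\<lambda>x. V s x - V t x)) \<longlongrightarrow> 0) (at t within X)" "\<And>s. s \<in> X \<Longrightarrow> V s \<in> L2 L" "t \<in> X"
  shows "((\<lambda>s. norm2 L (\<lambda>x. (V s x + (\<Sum>m=1..N. wt m s * G m x)) - (V t x + (\<Sum>m=1..N. wt m t * G m x)))) \<longlongrightarrow> 0) (at t within X)"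
proof (rule Lim_null_comparison)
  have "((\<lambda>s. \<Sum>m=1..N. norm (wt m s - wt m t) * norm2 L (G m)) \<longlongrightarrow> (\<Sum>m=1..N. 0)) (at t within X)"
    by (intro tendsto_sum tendsto_mult_left_zero tendsto_norm_zero LIM_zero wt_tendsto)
  then show "((\<lambda>s. norm2 L (\<lambda>x. V s x - V t x) + (\<Sum>m=1..N. norm (wt m s - wt m t) * norm2 L (G m))) \<longlongrightarrow> 0) (at t within X)"
    using tendsto_add[OF V(1)] by fastforce
  have le: "norm2 L (\<lambda>x. (V s x + (\<Sum>m=1..N. wt m s * G m x)) - (V t x + (\<Sum>m=1..N. wt m t * G m x))) \<le>
      norm2 L (\<lambda>x. V s x - V t x) + (\<Sum>m=1..N. norm (wt m s - wt m t) * norm2 L (G m))" if s: "s \<in> X" for s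
  proof -
    have 1: "(\<lambda>x. (V s x + (\<Sum>m=1..N. wt m s * G m x)) - (V t x + (\<Sum>m=1..N. wt m t * G m x))) =
        (\<lambda>x. (V s x - V t x) + (\<Sum>m=1..N. (wt m s - wt m t) * G m x))"
      by (simp add: left_diff_distrib sum_subtractf algebra_simps)
    have 2: "norm2 L (\<lambda>x. (V s x - V t x) + (\<Sum>m=1..N. (wt m s - wt m t) * G m x)) \<le>
        norm2 L (\<lambda>x. V s x - V t x) + norm2 L (\<lambda>x. \<Sum>m=1..N. (wt m s - wt m t) * G m x)"
      by (intro norm2_triangle L2_diff L2_sum L2_cmult V G s)
    have 3: "norm2 L (\<lambda>x. \<Sum>m=1..N. (wt m s - wt m t) * G m x) \<le> (\<Sum>m=1..N. norm2 L (\<lambda>x. (wt m s - wt m t) * G m x))"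
      by (intro norm2_sum L2_cmult G)
    show ?thesis unfolding 1 using 2 3 unfolding norm2_cmult by linarith
  qed
  show "\<forall>\<^sub>F s in at t within X. norm (norm2 L (\<lambda>x. (V s x + (\<Sum>m=1..N. wt m s * G m x)) - (V t x + (\<Sum>m=1..N. wt m t * G m x)))) \<le>
      norm2 L (\<lambda>x. V s x - V t x) + (\<Sum>m=1..N. norm (wt m s - wt m t) * norm2 L (G m))"
    unfolding eventually_at_filter by (rule always_eventually) (use le in simp)
qed

lemma U_tendsto:
  assumes t: "0 \<le> t" shows "((\<lambda>s. norm2 L (\<lambda>x. U s x - U t x)) \<longlongrightarrow> 0) (at t within {0..})"
  unfolding U_def
proof (rule modal_sum_tendsto[OF D_L2(1) _ S_L2])
  show "((\<lambda>s. norm2 L (\<lambda>x. S s x - S t x)) \<longlongrightarrow> 0) (at t within {0..})"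
    unfolding S_def
  proof (rule series_norm2_tendsto[OF less_imp_le[OF L] continuous_on_eigenfun norm_eigenfun_le[OF L] wt_tendsto _ _ summable_bnd(1)])
    show "\<forall>\<^sub>F s in at t within {0..}. \<forall>n. norm (wt (Suc n) s) * sqrt (2 / L) \<le> bnd0 n"
      unfolding eventually_at_filter by (rule always_eventually) (use coeff_le0 in auto)
  qed (use coeff_le0 t in auto)
qed (use t in auto)

lemma U'_tendsto:
  assumes t: "0 < t" shows "((\<lambda>s. norm2 L (\<lambda>x. U' s x - U' t x)) \<longlongrightarrow> 0) (at t within {0<..})"
  unfolding U'_def
proof (rule modal_sum_tendsto[OF D_L2(2) _ S'_L2])
  show "((\<lambda>s. norm2 L (\<lambda>x. S' s x - S' t x)) \<longlongrightarrow> 0) (at t within {0<..})"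
    unfolding S'_def
  proof (rule series_norm2_tendsto[OF less_imp_le[OF L] continuous_on_eigenfun_deriv norm_eigenfun_deriv_le[OF L] wt_tendsto _ _ summable_bnd(2)])
    show "\<forall>\<^sub>F s in at t within {0<..}. \<forall>n. norm (wt (Suc n) s) * (sqrt (2 / L) * freq L (Suc n)) \<le> bnd1 (t / 2) (t + 1) n"
      unfolding eventually_at
    proof (intro exI[of _ "min (t / 2) 1"] conjI ballI impI allI)
      \<comment> \<open>The radius min (t / 2) 1 keeps s between t / 2 and t + 1, where the majorant
        \<open>bnd1 (t / 2) (t + 1)\<close> is valid.\<close>
      fix s n assume s: "s \<noteq> t \<and> dist s t < min (t / 2) 1"
      then have "\<bar>s - t\<bar> < t / 2" "\<bar>s - t\<bar> < 1" unfolding dist_real_def by linarith+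
      then have "t / 2 \<le> s" "s \<le> t + 1" by linarith+
      then show "norm (wt (Suc n) s) * (sqrt (2 / L) * freq L (Suc n)) \<le> bnd1 (t / 2) (t + 1) n"
        using t by (intro coeff_le1) auto
    qed (use t in simp)
    show "norm (wt (Suc n) t) * (sqrt (2 / L) * freq L (Suc n)) \<le> bnd1 (t / 2) (t + 1) n" for n
      using t by (intro coeff_le1) auto
  qed simp
qed (use t in auto)

text \<open>Since \<open>wderiv\<close> is chosen for each t separately, measurability in t is not
  automatic. For t > 0 the energy equals an explicit function \<open>h\<close>, which is continuous
  there because \<open>U\<close> and \<open>U'\<close> are continuous in time in the L^2
  norm.\<close>

lemma U_energy_integrable: "integrable (leb T) (\<lambda>t. (sobolev_norm L 1 (U t))\<^sup>2)"
proof (rule integrable_leb_bounded_by)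
  define h where "h t = (norm2 L (U t))\<^sup>2 + (norm2 L (U' t))\<^sup>2" for t
  have h: "(sobolev_norm L 1 (U t))\<^sup>2 = h t" if t: "0 < t" for t
  proof -
    have "norm2 L (wderiv L (U t)) = norm2 L (U' t)"
      using U_H1[OF t] wderiv_props(2) t unfolding H1_left_def by (intro norm2_cong U'_L2) auto
    then show ?thesis unfolding sobolev_norm1 by (simp add: h_def)
  qed
  have "continuous_on {0<..T} h"
    unfolding continuous_on_def
  proof
    fix t assume t: "t \<in> {0<..T}"
    have ev: "\<forall>\<^sub>F s in at t within {0<..T}. s \<in> {0<..T}" by (simp add: eventually_at_filter)
    have "((\<lambda>s. norm2 L (U s)) \<longlongrightarrow> norm2 L (U t)) (at t within {0<..T})"
      by (rule norm2_tendsto[OF eventually_mono[OF ev] _ tendsto_within_subset[OF U_tendsto]]) (use t U_L2 in auto)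
    moreover have "((\<lambda>s. norm2 L (U' s)) \<longlongrightarrow> norm2 L (U' t)) (at t within {0<..T})"
      by (rule norm2_tendsto[OF eventually_mono[OF ev] _ tendsto_within_subset[OF U'_tendsto]]) (use t U'_L2 in auto)
    ultimately show "(h \<longlongrightarrow> h t) (at t within {0<..T})" unfolding h_def by (intro tendsto_intros)
  qed
  then have "h \<in> borel_measurable (lebesgue_on {0<..T})"
    by (rule continuous_imp_measurable_on_sets_lebesgue) simp
  then have m: "(\<lambda>t. if t \<in> {0<..T} then h t else 0) \<in> borel_measurable (leb T)"
    by (subst borel_measurable_if_lebesgue_on) auto
  have "AE t in leb T. t \<noteq> 0" "AE t in leb T. t \<in> {0..T}"
    unfolding AE_leb_iff by (rule AE_I'[of "{0}"]; auto)+
  then have ae: "AE t in leb T. (if t \<in> {0<..T} then h t else 0) = (sobolev_norm L 1 (U t))\<^sup>2"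
  proof eventually_elim
    case (elim t)
    then have "0 < t" "t \<in> {0<..T}" by auto
    then show ?case by (simp only: if_True h)
  qed
  show "(\<lambda>t. (sobolev_norm L 1 (U t))\<^sup>2) \<in> borel_measurable (leb T)"
    by (rule borel_measurable_lebesgue_on_cong_AE[OF _ m ae]) simp
  \<comment> \<open>The bound has to hold at every point; the second summand covers t = 0, where the
    decay estimate says nothing.\<close>
  show "integrable (leb T) (\<lambda>t. (c1 * W)\<^sup>2 + (sobolev_norm L 1 (U 0))\<^sup>2)"
    by (intro continuous_imp_integrable_real continuous_on_const)
  fix t assume t: "t \<in> {0..T}"
  show "norm ((sobolev_norm L 1 (U t))\<^sup>2) \<le> (c1 * W)\<^sup>2 + (sobolev_norm L 1 (U 0))\<^sup>2"
  proof (cases "t = 0")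
    case False
    then have t: "0 < t" using t by simp
    have "sobolev_norm L 1 (U t) \<le> c1 * exp (- \<eta> * t) * W" using t by (intro sobolev_norm_U_le U_L2) auto
    also have "\<dots> \<le> c1 * 1 * W" using c12_pos W \<eta> t by (intro mult_right_mono mult_left_mono) auto
    finally have "(sobolev_norm L 1 (U t))\<^sup>2 \<le> (c1 * W)\<^sup>2" by (intro power_mono) (simp_all add: sobolev_norm1)
    then show ?thesis
      using zero_le_power2[of "sobolev_norm L 1 (U 0)"] unfolding real_norm_def abs_power2 by linarith
  qed simp
qed

context
  fixes v assumes v: "v \<in> H1_left L"
begin

text \<open>Minus the time derivative of the inner product of \<open>U t\<close> with
  \<open>v\<close>. The weak form amounts to its equality with the stationary part.\<close>

definition G :: "real \<Rightarrow> complex" where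
  "G t = (\<Sum>n. \<sigma> (Suc n) * wt (Suc n) t * inner2 L (e (Suc n)) v) + (\<Sum>m=1..N. \<sigma> m * wt m t * inner2 L (D m) v)"

lemma v_props: "v \<in> L2 L" "wderiv L v \<in> L2 L"
  using v wderiv_props unfolding H1_left_def by blast+

text \<open>Unlike for eigenfunctions, the boundary term at L survives, because D' m L is in general
  nonzero. Summed over the low modes it is what the feedback cancels.\<close>

lemma inner2_D'_wderiv:
  "inner2 L (D' m) (wderiv L v) = cnj (trace_at L v L) * D' m L +
     of_real \<mu> / \<kappa> * inner2 L (e m) v + (lam m + of_real \<mu> / \<kappa>) * inner2 L (D m) v"
proof -
  define D2 where "D2 x = - (of_real \<mu> / \<kappa>) * e m x - (lam m + of_real \<mu> / \<kappa>) * D m x" for x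
  have "(\<integral>x. wderiv L v x * cnj (D' m x) \<partial>leb L) = trace_at L v L * cnj (D' m L) - (\<integral>x. v x * cnj (D2 x) \<partial>leb L)"
  proof (rule H1_left_integral_by_parts[OF L v])
    show "((\<lambda>x. cnj (D' m x)) has_vector_derivative cnj (D2 x)) (at x within {0..L})" if "x \<in> {0..L}" for x
      unfolding D2_def by (rule bounded_linear.has_vector_derivative[OF bounded_linear_cnj D'_deriv[OF that]])
    show "continuous_on {0..L} (\<lambda>x. cnj (D2 x))"
      unfolding D2_def by (intro continuous_intros D_cont continuous_on_eigenfun)
  qed
  then have "inner2 L (wderiv L v) (D' m) = trace_at L v L * cnj (D' m L) - inner2 L v D2"
    by (simp add: inner2_def)
  then have "inner2 L (D' m) (wderiv L v) = cnj (trace_at L v L) * D' m L - inner2 L D2 v"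
    using inner2_cnj[of L "D' m" "wderiv L v"] inner2_cnj[of L D2 v] by simp
  also have "inner2 L D2 v = - (of_real \<mu> / \<kappa>) * inner2 L (e m) v - (lam m + of_real \<mu> / \<kappa>) * inner2 L (D m) v"
    unfolding D2_def inner2_cmult_left[symmetric]
    by (rule inner2_diff_left) (intro L2_cmult D_L2 eigenfun_L2 v_props)+
  finally show ?thesis by simp
qed

lemma U_inner2_v:
  "0 \<le> t \<Longrightarrow> inner2 L (U t) v = (\<Sum>n. wt (Suc n) t * inner2 L (e (Suc n)) v) + (\<Sum>m=1..N. wt m t * inner2 L (D m) v)"
  unfolding U_def[abs_def] inner2_add_left[OF S_L2 D_sum_L2 v_props(1)]
  using sums_unique[OF S_inner2[OF _ v_props(1), of t]]
  by (subst inner2_sum_left) (simp_all add: L2_cmult D_L2 v_props inner2_cmult_left)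

lemma norm_inner2_v_le: "0 < j \<Longrightarrow> norm (inner2 L (e j) v) \<le> norm2 L v"
  using norm_inner2_le[OF eigenfun_L2[of L j] v_props(1)] norm2_eigenfun[OF L, of j] by simp

text \<open>The exponents grow no faster than the eigenvalues, so \<open>eigenval_wt_le\<close> also
  dominates the series differentiated in time.\<close>

lemma \<sigma>_bound:
  assumes "0 < j" shows "norm (\<sigma> j) \<le> (norm \<kappa> + (\<gamma> + \<mu>) / eigenval L 1) * eigenval L j"
proof -
  have l: "eigenval L 1 > 0" "eigenval L 1 \<le> eigenval L j"
    using eigenval_pos[OF L, of 1] eigenval_mono[of 1 j L] assms by auto
  have A: "norm (\<sigma> j) \<le> norm \<kappa> * eigenval L j + \<gamma> + \<mu>"
  proof -
    have "norm (\<sigma> j) \<le> norm (\<kappa> * lam j - of_real \<gamma>) + norm (if j \<le> N then complex_of_real \<mu> else 0)"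
      unfolding \<sigma>_def by (rule norm_triangle_ineq)
    also have "norm (\<kappa> * lam j - of_real \<gamma>) \<le> norm (\<kappa> * lam j) + norm (complex_of_real \<gamma>)" by (rule norm_triangle_ineq4)
    finally show ?thesis using \<mu> \<gamma> l by (auto simp: norm_mult split: if_splits)
  qed
  have B: "\<gamma> + \<mu> \<le> (\<gamma> + \<mu>) / eigenval L 1 * eigenval L j"
  proof -
    have "(\<gamma> + \<mu>) / eigenval L 1 * eigenval L 1 \<le> (\<gamma> + \<mu>) / eigenval L 1 * eigenval L j"
      using l \<mu> \<gamma> by (intro mult_left_mono) auto
    then show ?thesis using l by simp
  qed
  show ?thesis unfolding distrib_right using A B by linarith
qed

definition bnd2 :: "real \<Rightarrow> real \<Rightarrow> nat \<Rightarrow> real" where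
  "bnd2 \<delta> T n = (norm \<kappa> + (\<gamma> + \<mu>) / eigenval L 1) * (exp (\<gamma> * T) / (\<nu> * \<delta>) * norm (w0 (Suc n))) * norm2 L v"

lemma summable_bnd2: "summable (bnd2 \<delta> T)"
  unfolding bnd2_def[abs_def] by (intro summable_mult summable_mult2 summable_w0)

lemma G_term_le:
  assumes "0 < \<delta>" "t \<in> {\<delta>..T}"
  shows "norm (\<sigma> (Suc n) * wt (Suc n) t * inner2 L (e (Suc n)) v) \<le> bnd2 \<delta> T n"
proof -
  define K where "K = norm \<kappa> + (\<gamma> + \<mu>) / eigenval L 1"
  have K: "0 \<le> K" using \<mu> \<gamma> eigenval_pos[OF L, of 1] by (simp add: K_def)
  have "norm (\<sigma> (Suc n)) * norm (wt (Suc n) t) \<le> K * eigenval L (Suc n) * norm (wt (Suc n) t)"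
    unfolding K_def by (intro mult_right_mono \<sigma>_bound) auto
  also have "\<dots> = K * (eigenval L (Suc n) * norm (wt (Suc n) t))" by simp
  also have "\<dots> \<le> K * (exp (\<gamma> * T) / (\<nu> * \<delta>) * norm (w0 (Suc n)))"
    using assms by (intro mult_left_mono eigenval_wt_le K) auto
  finally have "norm (\<sigma> (Suc n)) * norm (wt (Suc n) t) \<le> K * (exp (\<gamma> * T) / (\<nu> * \<delta>) * norm (w0 (Suc n)))" .
  then have "norm (\<sigma> (Suc n)) * norm (wt (Suc n) t) * norm (inner2 L (e (Suc n)) v) \<le>
      K * (exp (\<gamma> * T) / (\<nu> * \<delta>) * norm (w0 (Suc n))) * norm2 L v"
    by (rule mult_mono) (use K \<nu> assms norm_inner2_v_le[of "Suc n"] in auto)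
  then show ?thesis by (simp add: norm_mult bnd2_def K_def)
qed

lemma U_inner2_deriv:
  assumes \<delta>: "0 < \<delta>" and t: "t \<in> {\<delta>..T}"
  shows "((\<lambda>t. inner2 L (U t) v) has_vector_derivative - G t) (at t within {\<delta>..T})"
proof -
  have 1: "((\<lambda>t. \<Sum>n. wt (Suc n) t * inner2 L (e (Suc n)) v) has_vector_derivative
      (\<Sum>n. - \<sigma> (Suc n) * wt (Suc n) t * inner2 L (e (Suc n)) v)) (at t within {\<delta>..T})"
  proof (rule series_vector_derivative[OF _ _ _ summable_bnd2[of \<delta> T] t])
    show "((\<lambda>t. wt (Suc n) t * inner2 L (e (Suc n)) v) has_vector_derivative - \<sigma> (Suc n) * wt (Suc n) t * inner2 L (e (Suc n)) v) (at t within {\<delta>..T})" for n t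
      by (rule has_vector_derivative_mult_left[OF wt_deriv])
    show "norm (- \<sigma> (Suc n) * wt (Suc n) t * inner2 L (e (Suc n)) v) \<le> bnd2 \<delta> T n" if "t \<in> {\<delta>..T}" for n t
      using G_term_le[OF \<delta> that, of n] by (simp add: norm_mult)
    show "summable (\<lambda>n. wt (Suc n) t * inner2 L (e (Suc n)) v)"
      using S_inner2[OF _ v_props(1), of t] t \<delta> by (simp add: sums_iff)
  qed simp
  have "((\<lambda>t. (\<Sum>n. wt (Suc n) t * inner2 L (e (Suc n)) v) + (\<Sum>m=1..N. wt m t * inner2 L (D m) v)) has_vector_derivative
      (\<Sum>n. - \<sigma> (Suc n) * wt (Suc n) t * inner2 L (e (Suc n)) v) + (\<Sum>m=1..N. - \<sigma> m * wt m t * inner2 L (D m) v)) (at t within {\<delta>..T})"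
    by (intro has_vector_derivative_add 1 has_vector_derivative_sum has_vector_derivative_mult_left wt_deriv)
  moreover have "(\<Sum>n. - \<sigma> (Suc n) * wt (Suc n) t * inner2 L (e (Suc n)) v) + (\<Sum>m=1..N. - \<sigma> m * wt m t * inner2 L (D m) v) = - G t"
  proof -
    have "summable (\<lambda>n. \<sigma> (Suc n) * wt (Suc n) t * inner2 L (e (Suc n)) v)"
      by (rule summable_comparison_test'[OF summable_bnd2[of \<delta> T], of 0]) (rule G_term_le[OF \<delta> t])
    from suminf_minus[OF this] show ?thesis by (simp add: G_def sum_negf)
  qed
  ultimately have "((\<lambda>t. (\<Sum>n. wt (Suc n) t * inner2 L (e (Suc n)) v) + (\<Sum>m=1..N. wt m t * inner2 L (D m) v)) has_vector_derivative
      - G t) (at t within {\<delta>..T})" by simp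
  then show ?thesis
    by (rule has_vector_derivative_transform[OF t, rotated]) (rule U_inner2_v, use \<delta> in simp)
qed

lemma G_cont: "0 < \<delta> \<Longrightarrow> continuous_on {\<delta>..T} G"
  unfolding G_def[abs_def]
  by (intro continuous_on_add series_continuous_on[OF _ G_term_le summable_bnd2] continuous_intros wt_cont)

text \<open>The series coming from \<open>S'\<close> lacks \<mu> in the low modes, compared with
  \<sigma>. The images \<open>D m\<close> supply the missing \<mu> (e m, v) through
  \<open>inner2_D'_wderiv\<close>; the remaining inner products with \<open>D m\<close> carry the
  factor \<kappa> lam m + \<mu> - \<gamma> = \<sigma> m, and the boundary terms cancel against the
  feedback.\<close>

lemma U_weak_form:
  assumes t: "0 < t"
  shows "Complex \<nu> \<alpha> * (inner2 L (wderiv L (U t)) (wderiv L v) -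
      feedback L \<nu> \<alpha> \<mu> k N (proj L N (U t)) * cnj (trace_at L v L)) - of_real \<gamma> * inner2 L (U t) v = G t"
proof -
  define V where "V = cnj (trace_at L v L)"
  define b where "b j = inner2 L (e j) v" for j
  define d where "d m = inner2 L (D m) v" for m
  have w: "wderiv L (U t) \<in> L2 L" using U_H1(1)[OF t] wderiv_props(2) unfolding H1_left_def by blast
  have "inner2 L (e' j) (wderiv L v) = lam j * b j" for j
    using inner2_wderiv_eigenfun_deriv[OF L v, of j] inner2_cnj[of L "e' j" "wderiv L v"] inner2_cnj[of L "e j" v]
    by (simp add: b_def)
  then have s1: "(\<lambda>n. wt (Suc n) t * (lam (Suc n) * b (Suc n))) sums inner2 L (S' t) (wderiv L v)"
    using S'_inner2[OF t v_props(2)] by simp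
  have s2: "(\<lambda>n. wt (Suc n) t * b (Suc n)) sums (\<Sum>n. wt (Suc n) t * b (Suc n))"
    using S_inner2[OF _ v_props(1), of t] t by (simp add: b_def sums_iff)
  \<comment> \<open>The low-mode part of \<sigma> as a series with finite support, so that it can be
    added to the other two termwise.\<close>
  have s3: "(\<lambda>n. if Suc n \<le> N then of_real \<mu> * (wt (Suc n) t * b (Suc n)) else 0) sums (\<Sum>m=1..N. of_real \<mu> * (wt m t * b m))"
    using sums_If_finite_set[of "{..<N}" "\<lambda>n. of_real \<mu> * (wt (Suc n) t * b (Suc n))"]
    by (simp add: sum.atLeast1_atMost_eq Suc_le_eq)
  have "(\<lambda>n. \<kappa> * (wt (Suc n) t * (lam (Suc n) * b (Suc n))) - of_real \<gamma> * (wt (Suc n) t * b (Suc n)) +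
      (if Suc n \<le> N then of_real \<mu> * (wt (Suc n) t * b (Suc n)) else 0)) sums
      (\<kappa> * inner2 L (S' t) (wderiv L v) - of_real \<gamma> * (\<Sum>n. wt (Suc n) t * b (Suc n)) + (\<Sum>m=1..N. of_real \<mu> * (wt m t * b m)))"
    by (intro sums_add sums_diff sums_mult s1 s2 s3)
  moreover have "(\<lambda>n. \<kappa> * (wt (Suc n) t * (lam (Suc n) * b (Suc n))) - of_real \<gamma> * (wt (Suc n) t * b (Suc n)) +
      (if Suc n \<le> N then of_real \<mu> * (wt (Suc n) t * b (Suc n)) else 0)) = (\<lambda>n. \<sigma> (Suc n) * wt (Suc n) t * b (Suc n))"
    by (rule ext) (auto simp: \<sigma>_def algebra_simps)
  ultimately have ser: "\<kappa> * inner2 L (S' t) (wderiv L v) - of_real \<gamma> * (\<Sum>n. wt (Suc n) t * b (Suc n)) =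
      (\<Sum>n. \<sigma> (Suc n) * wt (Suc n) t * b (Suc n)) - (\<Sum>m=1..N. of_real \<mu> * (wt m t * b m))"
    by (simp add: sums_iff eq_diff_eq)
  have "inner2 L (wderiv L (U t)) (wderiv L v) = inner2 L (U' t) (wderiv L v)"
    by (rule inner2_cong[OF U_H1(2)[OF t] eq_ae_refl w U'_L2[OF t] v_props(2) v_props(2)])
  also have "\<dots> = inner2 L (S' t) (wderiv L v) + (\<Sum>m=1..N. wt m t * inner2 L (D' m) (wderiv L v))"
    unfolding U'_def[abs_def]
    by (subst inner2_add_left, (intro S'_L2 t L2_sum L2_cmult D_L2 v_props)+)
       (subst inner2_sum_left, simp_all add: L2_cmult D_L2 v_props inner2_cmult_left)
  finally have 1: "inner2 L (wderiv L (U t)) (wderiv L v) = inner2 L (S' t) (wderiv L v) +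
      (\<Sum>m=1..N. wt m t * (V * D' m L + of_real \<mu> / \<kappa> * b m + (lam m + of_real \<mu> / \<kappa>) * d m))"
    unfolding inner2_D'_wderiv V_def b_def d_def .
  have 2: "feedback L \<nu> \<alpha> \<mu> k N (proj L N (U t)) = (\<Sum>m=1..N. wt m t * D' m L)"
    unfolding feedback_eq[OF U_L2[OF less_imp_le[OF t]]]
    by (intro sum.cong refl arg_cong2[where f="(*)"] Q_unique) (use U_inner2[OF less_imp_le[OF t]] in auto)
  have 3: "inner2 L (U t) v = (\<Sum>n. wt (Suc n) t * b (Suc n)) + (\<Sum>m=1..N. wt m t * d m)"
    unfolding b_def d_def by (rule U_inner2_v) (use t in simp)
  have fin: "\<kappa> * (\<Sum>m=1..N. wt m t * (V * D' m L + of_real \<mu> / \<kappa> * b m + (lam m + of_real \<mu> / \<kappa>) * d m))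
      - \<kappa> * ((\<Sum>m=1..N. wt m t * D' m L) * V) - of_real \<gamma> * (\<Sum>m=1..N. wt m t * d m) =
      (\<Sum>m=1..N. of_real \<mu> * (wt m t * b m)) + (\<Sum>m=1..N. \<sigma> m * wt m t * d m)"
    unfolding sum_distrib_left sum_distrib_right sum_subtractf[symmetric] sum.distrib[symmetric]
    by (intro sum.cong refl) (use \<kappa>_nz in \<open>simp add: \<sigma>_def field_simps\<close>)
  have "Complex \<nu> \<alpha> * (inner2 L (wderiv L (U t)) (wderiv L v) -
      feedback L \<nu> \<alpha> \<mu> k N (proj L N (U t)) * cnj (trace_at L v L)) - of_real \<gamma> * inner2 L (U t) v =
      (\<kappa> * inner2 L (S' t) (wderiv L v) - of_real \<gamma> * (\<Sum>n. wt (Suc n) t * b (Suc n))) +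
      (\<kappa> * (\<Sum>m=1..N. wt m t * (V * D' m L + of_real \<mu> / \<kappa> * b m + (lam m + of_real \<mu> / \<kappa>) * d m))
      - \<kappa> * ((\<Sum>m=1..N. wt m t * D' m L) * V) - of_real \<gamma> * (\<Sum>m=1..N. wt m t * d m))"
    unfolding 1 2 3 \<kappa>_def[symmetric] V_def[symmetric]
    by (simp only: right_diff_distrib distrib_left) (simp only: add_diff_eq diff_add_eq diff_diff_eq2 diff_diff_eq add.assoc add.commute add.left_commute)
  also have "\<dots> = G t" unfolding ser fin by (simp add: G_def b_def d_def)
  finally show ?thesis .
qed

lemma U_distributional:
  assumes C: "C1c {0<..} \<phi> \<phi>'"
  shows "- (\<integral>t. inner2 L (U t) v * of_real (\<phi>' t) \<partial>lebesgue_on {0..})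
        + (\<integral>t. (Complex \<nu> \<alpha> *
                  (inner2 L (wderiv L (U t)) (wderiv L v)
                   - feedback L \<nu> \<alpha> \<mu> k N (proj L N (U t)) * cnj (trace_at L v L))
                 - of_real \<gamma> * inner2 L (U t) v) * of_real (\<phi> t) \<partial>lebesgue_on {0..}) = 0"
proof -
  obtain \<delta> T where \<delta>: "0 < \<delta>" "\<delta> < T" and C': "C1c {\<delta><..<T} \<phi> \<phi>'" using C1c_halfline_bounds[OF C] .
  define y where "y t = inner2 L (U t) v" for t
  have z: "\<phi> s = 0" "\<phi>' s = 0" if "s \<notin> {\<delta>..T}" for s
    using that C1c_outside[OF C', of s] C1c_deriv_outside[OF C', of s] by auto
  have dy: "(y has_vector_derivative - G t) (at t within {\<delta>..T})" if "t \<in> {\<delta>..T}" for t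
    unfolding y_def by (rule U_inner2_deriv[OF \<delta>(1) that])
  have cy: "continuous_on {\<delta>..T} y" by (rule continuous_on_vector_derivative[OF dy])
  have cG: "continuous_on {\<delta>..T} G" by (rule G_cont[OF \<delta>(1)])
  have ci: "integrable (lebesgue_on {\<delta>..T}) (\<lambda>t. y t * of_real (\<phi>' t))" "integrable (lebesgue_on {\<delta>..T}) (\<lambda>t. G t * of_real (\<phi> t))"
    by (intro continuous_imp_integrable_real continuous_intros cy cG C1c_continuous[OF C])+
  have d\<phi>: "((\<lambda>t. complex_of_real (\<phi> t)) has_vector_derivative of_real (\<phi>' t)) (at t within {\<delta>..T})" for t
    by (rule has_vector_derivative_of_real[OF has_field_derivative_at_within]) (use C in \<open>simp add: C1c_def\<close>)
  have "((\<lambda>t. y t * of_real (\<phi>' t) + - G t * of_real (\<phi> t)) has_integral (y T * of_real (\<phi> T) - y \<delta> * of_real (\<phi> \<delta>))) {\<delta>..T}"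
    by (rule fundamental_theorem_of_calculus[where f="\<lambda>t. y t * of_real (\<phi> t)",
          OF less_imp_le[OF \<delta>(2)] has_vector_derivative_mult[OF dy d\<phi>]])
  moreover have "\<phi> T = 0" "\<phi> \<delta> = 0" using C1c_outside[OF C'] by auto
  ultimately have "integral {\<delta>..T} (\<lambda>t. y t * of_real (\<phi>' t) - G t * of_real (\<phi> t)) = 0"
    by (simp add: integral_unique)
  then have zero: "(\<integral>t. y t * of_real (\<phi>' t) \<partial>lebesgue_on {\<delta>..T}) - (\<integral>t. G t * of_real (\<phi> t) \<partial>lebesgue_on {\<delta>..T}) = 0"
    using ci lebesgue_integral_eq_integral[OF Bochner_Integration.integrable_diff[OF ci]] by simp
  have r1: "(\<integral>t. inner2 L (U t) v * of_real (\<phi>' t) \<partial>lebesgue_on {0..}) = (\<integral>t. y t * of_real (\<phi>' t) \<partial>lebesgue_on {\<delta>..T})"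
    unfolding y_def by (rule integral_halfline_restrict) (use z \<delta> in auto)
  have r2: "(\<integral>t. (Complex \<nu> \<alpha> * (inner2 L (wderiv L (U t)) (wderiv L v)
                   - feedback L \<nu> \<alpha> \<mu> k N (proj L N (U t)) * cnj (trace_at L v L))
                 - of_real \<gamma> * inner2 L (U t) v) * of_real (\<phi> t) \<partial>lebesgue_on {0..}) =
      (\<integral>t. (Complex \<nu> \<alpha> * (inner2 L (wderiv L (U t)) (wderiv L v)
                   - feedback L \<nu> \<alpha> \<mu> k N (proj L N (U t)) * cnj (trace_at L v L))
                 - of_real \<gamma> * inner2 L (U t) v) * of_real (\<phi> t) \<partial>lebesgue_on {\<delta>..T})"
    by (rule integral_halfline_restrict) (use z \<delta> in auto)
  also have "\<dots> = (\<integral>t. G t * of_real (\<phi> t) \<partial>lebesgue_on {\<delta>..T})"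
    by (intro Bochner_Integration.integral_cong refl arg_cong2[where f="(*)"] U_weak_form) (use \<delta> in auto)
  finally show ?thesis using zero unfolding r1 by simp
qed

end

lemma U_weak_solution:
  assumes u0: "u0 \<in> L2 L" and u0j: "\<And>j. 0 < j \<Longrightarrow> inner2 L u0 (e j) = w0 j + (\<Sum>m=1..N. A j m * w0 m)"
  shows "weak_solution L \<nu> \<alpha> \<gamma> \<mu> k N u0 U"
  unfolding weak_solution_def
proof (intro conjI allI impI ballI)
  show "eq_ae L (U 0) u0" by (rule eq_ae_sym[OF eq_ae_U[OF order_refl u0]]) (simp add: u0j wt_0)
  have "AE t in lebesgue. t \<noteq> (0::real)" by (rule AE_I'[of "{0}"]) auto
  then show "AE t in lebesgue_on {0..}. U t \<in> H1_left L"
    by (subst AE_restrict_space_iff) (auto elim!: eventually_mono intro: U_H1)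
qed (use U_L2 U_tendsto U_energy_integrable U_distributional in auto)

end

subsection \<open>Decay\<close>

context closed_loop
begin

lemma modal_evolution_initial:
  assumes "\<mu> > 0" "\<gamma> \<ge> 0" "\<eta> > 0" "\<And>j. 0 < j \<Longrightarrow> \<eta> \<le> Re (\<sigma> j)" and g: "g \<in> H1_left L"
  shows "modal_evolution L \<nu> \<alpha> \<gamma> \<mu> k N (\<lambda>j. inner2 L g (e j)) (norm2 L (wderiv L g)) \<eta>"
  using H1_left_Bessel[OF L g] assms by unfold_locales auto

text \<open>The target modes of an arbitrary weak solution evolve from those of \<open>g\<close>
  exactly as in the explicit solution. By completeness \<open>u t\<close> agrees with
  \<open>E.U t\<close> almost everywhere in space and inherits its estimate, here for every t >
  0.\<close>

lemma closed_loop_decay: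
  assumes par: "\<mu> > 0" "\<gamma> \<ge> 0" "\<eta> > 0" "\<And>j. 0 < j \<Longrightarrow> \<eta> \<le> Re (\<sigma> j)"
  shows "H1_decay L (weak_solution L \<nu> \<alpha> \<gamma> \<mu> k N) (c1 * c2) \<eta>"
  unfolding H1_decay_def
proof (intro ballI allI impI)
  fix u0 u assume u0: "u0 \<in> H1_left L" and sol: "weak_solution L \<nu> \<alpha> \<gamma> \<mu> k N u0 u"
  define a where "a t j = inner2 L (u t) (e j)" for t j
  define g where "g x = u0 x - (\<Sum>m=1..N. Q (\<lambda>j. inner2 L u0 (e j)) m * D m x)" for x
  note g = initial_target[OF u0, folded g_def]
  interpret E: modal_evolution L \<nu> \<alpha> \<gamma> \<mu> k N "\<lambda>j. inner2 L g (e j)" "norm2 L (wderiv L g)" \<eta>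
    by (rule modal_evolution_initial[OF par g(1)])
  have u: "u s \<in> L2 L" if "s \<ge> 0" for s using sol that unfolding weak_solution_def by blast
  have u0L2: "u0 \<in> L2 L" using u0 unfolding H1_left_def by (auto dest: wderiv_props(1))
  have "eq_ae L (u 0) u0" using sol unfolding weak_solution_def by blast
  then have a0: "a 0 j = inner2 L u0 (e j)" for j
    unfolding a_def by (rule inner2_cong[OF _ eq_ae_refl u[OF order_refl] u0L2 eigenfun_L2 eigenfun_L2])
  have "sobolev_norm L 1 (u t) \<le> c1 * c2 * exp (- \<eta> * t) * sobolev_norm L 1 u0" if t: "t > 0" for t
  proof -
    have w: "a t j - (\<Sum>m=1..N. A j m * Q (a t) m) = E.wt j t" if "0 < j" for j
    proof -
      have "a t j - (\<Sum>m=1..N. A j m * Q (a t) m) = exp (- \<sigma> j * of_real t) * (a 0 j - (\<Sum>m=1..N. A j m * Q (a 0) m))"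
        using weak_solution_decoupled[OF sol less_imp_le[OF t] that] by (simp add: a_def[abs_def])
      moreover have "E.wt j t = exp (- \<sigma> j * of_real t) * inner2 L g (e j)" by (rule E.wt_def)
      ultimately show ?thesis by (simp only: g(2) a0[abs_def])
    qed
    have q: "Q (a t) m = E.wt m t" if "m \<in> {1..N}" for m
      using w[of m] Q_solves[OF that, of "a t"] that by (simp add: eq_diff_eq[symmetric])
    have "inner2 L (u t) (e j) = E.wt j t + (\<Sum>m=1..N. A j m * E.wt m t)" if "0 < j" for j
      using w[OF that] q by (simp add: a_def diff_eq_eq)
    then have "eq_ae L (u t) (E.U t)" using t by (intro E.eq_ae_U u) auto
    then have "sobolev_norm L 1 (u t) \<le> c1 * exp (- \<eta> * t) * norm2 L (wderiv L g)"
      using t by (intro E.sobolev_norm_U_le u) auto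
    also have "\<dots> \<le> c1 * exp (- \<eta> * t) * (c2 * sobolev_norm L 1 u0)"
      using c12_pos by (intro mult_left_mono g(3)) auto
    finally show ?thesis by (simp add: mult_ac)
  qed
  then show "AE t in lebesgue_on {0<..}. sobolev_norm L 1 (u t) \<le> c1 * c2 * exp (- \<eta> * t) * sobolev_norm L 1 u0"
    by (intro AE_I2) simp
qed

lemma closed_loop_existence:
  assumes par: "\<mu> > 0" "\<gamma> \<ge> 0" "\<eta> > 0" "\<And>j. 0 < j \<Longrightarrow> \<eta> \<le> Re (\<sigma> j)" and u0: "u0 \<in> H1_left L"
  shows "\<exists>u. weak_solution L \<nu> \<alpha> \<gamma> \<mu> k N u0 u"
proof -
  define q where "q = Q (\<lambda>j. inner2 L u0 (e j))"
  define g where "g x = u0 x - (\<Sum>m=1..N. q m * D m x)" for x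
  note g = initial_target[OF u0, folded q_def, folded g_def]
  interpret E: modal_evolution L \<nu> \<alpha> \<gamma> \<mu> k N "\<lambda>j. inner2 L g (e j)" "norm2 L (wderiv L g)" \<eta>
    by (rule modal_evolution_initial[OF par g(1)])
  have q: "inner2 L g (e m) = q m" if "m \<in> {1..N}" for m
    using Q_solves[OF that, of "\<lambda>j. inner2 L u0 (e j)"] by (simp add: g(2) q_def diff_eq_eq)
  have "weak_solution L \<nu> \<alpha> \<gamma> \<mu> k N u0 E.U"
  proof (rule E.U_weak_solution)
    show "u0 \<in> L2 L" using u0 unfolding H1_left_def by (auto dest: wderiv_props(1))
    show "inner2 L u0 (e j) = inner2 L g (e j) + (\<Sum>m=1..N. A j m * inner2 L g (e m))" for j
      using q by (simp add: g(2))
  qed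
  then show ?thesis by blast
qed

lemma closed_loop_stable:
  assumes par: "\<mu> > 0" "\<gamma> \<ge> 0" "\<eta> > 0" "\<And>j. 0 < j \<Longrightarrow> \<eta> \<le> Re (\<sigma> j)"
  shows "globally_exp_stable_H1 L (weak_solution L \<nu> \<alpha> \<gamma> \<mu> k N) \<and>
    (\<exists>c>0. H1_decay L (weak_solution L \<nu> \<alpha> \<gamma> \<mu> k N) c \<eta>)"
proof -
  have "0 < c1 * c2" using c12_pos by simp
  then have "\<exists>c>0. H1_decay L (weak_solution L \<nu> \<alpha> \<gamma> \<mu> k N) c \<eta>"
    using closed_loop_decay[OF par] by blast
  then show ?thesis
    unfolding globally_exp_stable_H1_def using closed_loop_existence[OF par] \<open>\<eta> > 0\<close> by blast
qed

section \<open>Comparison of the decay rates\<close>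

lemma Re_\<sigma>: "Re (\<sigma> j) = \<nu> * eigenval L j - \<gamma> + (if j \<le> N then \<mu> else 0)"
  by (simp add: \<sigma>_def \<kappa>_def)

text \<open>The eigenvalues increase, so the slowest mode is 1 among the controlled ones and N + 1
  among the others.\<close>

lemma rate_le_Re_\<sigma>:
  assumes "\<eta> \<le> \<nu> * eigenval L 1 - \<gamma> + \<mu>" "\<eta> \<le> \<nu> * eigenval L (N + 1) - \<gamma>" and j: "0 < j"
  shows "\<eta> \<le> Re (\<sigma> j)"
proof (cases "j \<le> N")
  case True
  have "\<nu> * eigenval L 1 \<le> \<nu> * eigenval L j" using j \<nu> by (intro mult_left_mono eigenval_mono) auto
  then show ?thesis using True assms(1) by (simp add: Re_\<sigma>)
next
  case False
  have "\<nu> * eigenval L (N + 1) \<le> \<nu> * eigenval L j" using False \<nu> by (intro mult_left_mono eigenval_mono) auto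
  then show ?thesis using False assms(2) by (simp add: Re_\<sigma>)
qed

end

text \<open>To be read with n = 2 N + 1, l = \<nu> \<lambda>_1 and d = \<mu> + l - \<gamma>; the two
  conditions on N become \<mu> < 2 l n and \<mu> < n d. The first result compares the rate with that
  of mode N + 1, whose eigenvalue is n^2 times the first; besides the condition on \<mu> it uses 2
  \<le> n + 1. The second is positivity of the rate, which equals d - \<mu> / n.\<close>

lemma rate_bounds_rapid:
  fixes n d l \<mu> :: real
  assumes n: "n \<ge> 1" and l: "0 < l" and \<mu>: "0 < \<mu>" "\<mu> < 2 * l * n" "\<mu> < n * d"
  shows "\<mu> * (1 - 1 / n) \<le> l * (n\<^sup>2 - 1)" "0 < d - \<mu> / n"
proof -
  have "\<mu> * (1 - 1 / n) \<le> 2 * l * n * (1 - 1 / n)" using \<mu> n by (intro mult_right_mono) auto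
  also have "\<dots> = l * ((n - 1) * 2)" using n by (simp add: field_simps)
  also have "\<dots> \<le> l * ((n - 1) * (n + 1))" using n l by (intro mult_left_mono) auto
  finally show "\<mu> * (1 - 1 / n) \<le> l * (n\<^sup>2 - 1)" by (simp add: power2_eq_square algebra_simps)
  show "0 < d - \<mu> / n" using \<mu>(3) n by (simp add: field_simps)
qed

text \<open>To be read with n = 2 M + 1, l = \<nu> \<lambda>_1 and g = \<gamma> - l. The upper bound
  on \<mu> is 2 \<nu> \<lambda>_{M+1} = 2 l n^2, and the factor 1 - 1/n^2 is the one that turns it
  into the gap l (n^2 - 1) between modes M + 1 and 1. The lower bound on \<mu> makes the rate
  positive, as 1 - 1/n \<le> 1 - 1/n^2.\<close>

lemma rate_bounds_minimal:
  fixes n g l \<mu> :: real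
  assumes n: "n > 1" and \<mu>: "0 < \<mu>" "\<mu> < 2 * l * n\<^sup>2" "2 * g * inverse (1 - 1 / n) < \<mu>"
  shows "\<mu> / 2 * (1 - 1 / n\<^sup>2) \<le> l * (n\<^sup>2 - 1)" "g < \<mu> / 2 * (1 - 1 / n\<^sup>2)"
proof -
  have n2: "n\<^sup>2 > 1" "n \<le> n\<^sup>2" using n by (simp_all add: power2_eq_square less_1_mult)
  have "\<mu> / 2 * (1 - 1 / n\<^sup>2) \<le> l * n\<^sup>2 * (1 - 1 / n\<^sup>2)" using \<mu> n2 by (intro mult_right_mono) (simp_all add: divide_le_eq)
  also have "\<dots> = l * (n\<^sup>2 - 1)" using n by (simp add: field_simps)
  finally show "\<mu> / 2 * (1 - 1 / n\<^sup>2) \<le> l * (n\<^sup>2 - 1)" .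
  have pos: "1 - 1 / n > 0" using n by simp
  have "2 * g < \<mu> * (1 - 1 / n)" using \<mu>(3) pos by (simp add: inverse_eq_divide pos_divide_less_eq)
  also have "\<dots> \<le> \<mu> * (1 - 1 / n\<^sup>2)" using \<mu>(1) n n2 by (intro mult_left_mono diff_left_mono frac_le) auto
  finally show "g < \<mu> / 2 * (1 - 1 / n\<^sup>2)" by simp
qed

theorem theorem1p3:
  fixes L \<nu> \<alpha> \<gamma> \<mu> :: real and k :: "real \<Rightarrow> real \<Rightarrow> complex"
  assumes "L > 0" and "\<nu> > 0" and "\<gamma> \<ge> 0" and "\<mu> > 0"
    and "kernel_solution L \<nu> \<alpha> \<mu> k"
  shows
    "(\<forall>N::nat. N > 0 \<longrightarrow>
        \<mu> > \<gamma> - \<nu> * eigenval L 1 \<longrightarrow>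
        real N > max (\<mu> / (4 * \<nu> * eigenval L 1) - 1/2)
                     (\<mu> / (2 * (\<mu> + \<nu> * eigenval L 1 - \<gamma>)) - 1/2) \<longrightarrow>
        admissible L k \<mu> N \<longrightarrow>
        globally_exp_stable_H1 L (weak_solution L \<nu> \<alpha> \<gamma> \<mu> k N) \<and>
        (\<exists>c>0. H1_decay L (weak_solution L \<nu> \<alpha> \<gamma> \<mu> k N) c
                 (\<nu> * eigenval L 1 - \<gamma> + \<mu> * (1 - 1 / (2 * real N + 1)))))
     \<and>
     (\<forall>M::nat. M > 0 \<longrightarrow>
        eigenval L M \<le> \<gamma> / \<nu> \<longrightarrow> \<gamma> / \<nu> < eigenval L (M + 1) \<longrightarrow>
        2 * (\<gamma> - \<nu> * eigenval L 1) * inverse (1 - 1 / (2 * real M + 1)) < \<mu> \<longrightarrow>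
        \<mu> < 2 * \<nu> * eigenval L (M + 1) \<longrightarrow>
        admissible L k \<mu> M \<longrightarrow>
        globally_exp_stable_H1 L (weak_solution L \<nu> \<alpha> \<gamma> \<mu> k M) \<and>
        (\<exists>c>0. H1_decay L (weak_solution L \<nu> \<alpha> \<gamma> \<mu> k M) c
                 (\<nu> * eigenval L 1 - \<gamma> + \<mu> / 2 * (1 - 1 / (2 * real M + 1)\<^sup>2))))"
proof (intro conjI allI impI)
  define l where "l = \<nu> * eigenval L 1"
  have l: "0 < l" unfolding l_def using \<open>L > 0\<close> \<open>\<nu> > 0\<close> eigenval_pos[of L 1] by simp
  have next_eigenval: "\<nu> * eigenval L (N + 1) = l * (2 * real N + 1)\<^sup>2" for N
    unfolding l_def eigenval_eq[of L "N + 1"] by simp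
  have loop: "closed_loop L \<nu> \<alpha> \<mu> k N" if "admissible L k \<mu> N" for N
    using that assms by unfold_locales (auto simp: admissible_def)
  {
    fix N :: nat
    assume N: "N > 0" and \<mu>1: "\<mu> > \<gamma> - \<nu> * eigenval L 1"
      and max: "real N > max (\<mu> / (4 * \<nu> * eigenval L 1) - 1/2) (\<mu> / (2 * (\<mu> + \<nu> * eigenval L 1 - \<gamma>)) - 1/2)"
      and adm: "admissible L k \<mu> N"
    let ?n = "2 * real N + 1" and ?d = "\<mu> + l - \<gamma>"
    let ?\<eta> = "\<nu> * eigenval L 1 - \<gamma> + \<mu> * (1 - 1 / ?n)"
    interpret closed_loop L \<nu> \<alpha> \<gamma> \<mu> k N by (rule loop[OF adm])
    have d: "0 < ?d" using \<mu>1 by (simp add: l_def)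
    \<comment> \<open>Moving the summand 1/2 to the other side turns both conditions on N into
      bounds for 2 N + 1.\<close>
    have "\<mu> / (4 * l) < real N + 1/2" "\<mu> / (2 * ?d) < real N + 1/2"
      using max by (simp_all add: l_def mult.assoc)
    then have "\<mu> < 2 * l * ?n" "\<mu> < ?n * ?d" using l d by (simp_all add: pos_divide_less_eq algebra_simps)
    from rate_bounds_rapid[OF _ l \<open>\<mu> > 0\<close> this]
    have rates: "\<mu> * (1 - 1 / ?n) \<le> l * (?n\<^sup>2 - 1)" "0 < ?d - \<mu> / ?n" by simp_all
    have "0 < ?\<eta>" using rates(2) by (simp add: l_def right_diff_distrib)
    moreover have "?\<eta> \<le> Re (\<sigma> j)" if "0 < j" for j
    proof (rule rate_le_Re_\<sigma>[OF _ _ that])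
      show "?\<eta> \<le> \<nu> * eigenval L 1 - \<gamma> + \<mu>" using \<open>\<mu> > 0\<close> by (simp add: right_diff_distrib)
      show "?\<eta> \<le> \<nu> * eigenval L (N + 1) - \<gamma>"
        unfolding next_eigenval using rates(1) by (simp add: l_def right_diff_distrib)
    qed
    ultimately have "globally_exp_stable_H1 L (weak_solution L \<nu> \<alpha> \<gamma> \<mu> k N) \<and>
        (\<exists>c>0. H1_decay L (weak_solution L \<nu> \<alpha> \<gamma> \<mu> k N) c ?\<eta>)"
      by (intro closed_loop_stable assms)
    then show "globally_exp_stable_H1 L (weak_solution L \<nu> \<alpha> \<gamma> \<mu> k N)"
      "\<exists>c>0. H1_decay L (weak_solution L \<nu> \<alpha> \<gamma> \<mu> k N) c ?\<eta>" by blast+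
  }
  {
    fix M :: nat
    assume M: "M > 0" and \<mu>1: "2 * (\<gamma> - \<nu> * eigenval L 1) * inverse (1 - 1 / (2 * real M + 1)) < \<mu>"
      and \<mu>2: "\<mu> < 2 * \<nu> * eigenval L (M + 1)" and adm: "admissible L k \<mu> M"
    let ?n = "2 * real M + 1"
    let ?\<eta> = "\<nu> * eigenval L 1 - \<gamma> + \<mu> / 2 * (1 - 1 / ?n\<^sup>2)"
    interpret closed_loop L \<nu> \<alpha> \<gamma> \<mu> k M by (rule loop[OF adm])
    have n: "1 < ?n" using M by simp
    have "\<mu> < 2 * l * ?n\<^sup>2" using \<mu>2 next_eigenval[of M] by simp
    from rate_bounds_minimal[OF n \<open>\<mu> > 0\<close> this \<mu>1]
    have rates: "\<mu> / 2 * (1 - 1 / ?n\<^sup>2) \<le> l * (?n\<^sup>2 - 1)" "\<gamma> - \<nu> * eigenval L 1 < \<mu> / 2 * (1 - 1 / ?n\<^sup>2)" .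
    have "0 < ?\<eta>" using rates(2) by linarith
    moreover have "?\<eta> \<le> Re (\<sigma> j)" if "0 < j" for j
    proof (rule rate_le_Re_\<sigma>[OF _ _ that])
      have "\<mu> / 2 * (1 - 1 / ?n\<^sup>2) \<le> \<mu> / 2 * 1" using \<open>\<mu> > 0\<close> by (intro mult_left_mono) auto
      then show "?\<eta> \<le> \<nu> * eigenval L 1 - \<gamma> + \<mu>" using \<open>\<mu> > 0\<close> by linarith
      show "?\<eta> \<le> \<nu> * eigenval L (M + 1) - \<gamma>"
        unfolding next_eigenval using rates(1) by (simp add: l_def right_diff_distrib)
    qed
    ultimately have "globally_exp_stable_H1 L (weak_solution L \<nu> \<alpha> \<gamma> \<mu> k M) \<and>
        (\<exists>c>0. H1_decay L (weak_solution L \<nu> \<alpha> \<gamma> \<mu> k M) c ?\<eta>)"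
      by (intro closed_loop_stable assms)
    then show "globally_exp_stable_H1 L (weak_solution L \<nu> \<alpha> \<gamma> \<mu> k M)"
      "\<exists>c>0. H1_decay L (weak_solution L \<nu> \<alpha> \<gamma> \<mu> k M) c ?\<eta>" by blast+
  }
qed

end
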